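(* Let $X$ be a (finite) 2-dimensional CW complex. If there are two vertices $v,w$ of $X$ such that each 2-cell of $X$ is incident to at least one of $v,w$ (i.e., its attaching map passes through $v$ or $w$), then $X$ admits a PL embedding into $\mathbb{R}^4$.
   Context: A 2-dimensional CW complex is obtained from a finite graph (its 1-skeleton; loops and parallel edges allowed) by attaching disks (2-cells) along closed walks of the graph. Embeddings are piecewise linear. *)

theory Defs
  imports "HOL-Analysis.Analysis"
begin

section \<open>Finite 2-dimensional CW complexes\<close>

text \<open>
  The 1-skeleton is a multigraph, loops and parallel edges allowed; \<open>src\<close> and \<open>tgt\<close> orient each
  edge, but only to parametrize it by \<open>[0,1]\<close>. The attaching walk of a 2-cell starts at \<open>base\<close>; an
  entry \<open>(e, b)\<close> of \<open>walk\<close> traverses \<open>e\<close> along its orientation if \<open>b\<close> and against it otherwise.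
\<close>

record ('v, 'e, 'c) complex2 =
  verts :: "'v set"
  edges :: "'e set"
  src :: "'e \<Rightarrow> 'v"
  tgt :: "'e \<Rightarrow> 'v"
  cells :: "'c set"
  base :: "'c \<Rightarrow> 'v"
  walk :: "'c \<Rightarrow> ('e \<times> bool) list"

definition dart_tail :: "('v, 'e, 'c) complex2 \<Rightarrow> 'e \<times> bool \<Rightarrow> 'v" where
  "dart_tail X d = (if snd d then src X (fst d) else tgt X (fst d))"

definition dart_head :: "('v, 'e, 'c) complex2 \<Rightarrow> 'e \<times> bool \<Rightarrow> 'v" where
  "dart_head X d = (if snd d then tgt X (fst d) else src X (fst d))"

fun is_walk :: "('v, 'e, 'c) complex2 \<Rightarrow> 'v \<Rightarrow> ('e \<times> bool) list \<Rightarrow> 'v \<Rightarrow> bool" where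
  "is_walk X u [] w \<longleftrightarrow> u \<in> verts X \<and> u = w"
| "is_walk X u (d # ds) w \<longleftrightarrow>
     fst d \<in> edges X \<and> dart_tail X d = u \<and> is_walk X (dart_head X d) ds w"

definition finite_complex2 :: "('v, 'e, 'c) complex2 \<Rightarrow> bool" where
  "finite_complex2 X \<longleftrightarrow>
     finite (verts X) \<and> finite (edges X) \<and> finite (cells X) \<and>
     (\<forall>e\<in>edges X. src X e \<in> verts X \<and> tgt X e \<in> verts X) \<and>
     (\<forall>c\<in>cells X. is_walk X (base X c) (walk X c) (base X c))"

definition incident :: "('v, 'e, 'c) complex2 \<Rightarrow> 'c \<Rightarrow> 'v \<Rightarrow> bool" where
  "incident X c v \<longleftrightarrow> v = base X c \<or> v \<in> dart_head X ` set (walk X c)"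


section \<open>The underlying topological space\<close>

text \<open>
  The closed disk is modelled by the polyhedron \<open>{p. l1 p \<le> 1}\<close>. The function \<open>circ\<close> parametrizes
  its boundary counterclockwise: it is a bijection from \<open>{p. l1 p = 1}\<close> onto \<open>[0,1)\<close>, with
  \<open>(1,0)\<close>, \<open>(0,1)\<close>, \<open>(-1,0)\<close>, \<open>(0,-1)\<close> going to \<open>0\<close>, \<open>1/4\<close>, \<open>1/2\<close>, \<open>3/4\<close>, affine on each side.
\<close>

definition l1 :: "real \<times> real \<Rightarrow> real" where
  "l1 p = \<bar>fst p\<bar> + \<bar>snd p\<bar>"

definition disk :: "(real \<times> real) set" where
  "disk = {p. l1 p \<le> 1}"

definition circ :: "real \<times> real \<Rightarrow> real" where
  "circ p = (if snd p \<ge> 0 then 1 - fst p else 3 + fst p) / 4"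

text \<open>
  As a set, the space is the disjoint union of its open cells: the vertices, the open intervals
  and the open disks.
\<close>

datatype ('v, 'e, 'c) point = Vert 'v | EdgePt 'e real | CellPt 'c "real \<times> real"

definition points :: "('v, 'e, 'c) complex2 \<Rightarrow> ('v, 'e, 'c) point set" where
  "points X = Vert ` verts X
     \<union> {EdgePt e t | e t. e \<in> edges X \<and> 0 < t \<and> t < 1}
     \<union> {CellPt c p | c p. c \<in> cells X \<and> l1 p < 1}"

definition edge_map :: "('v, 'e, 'c) complex2 \<Rightarrow> 'e \<Rightarrow> real \<Rightarrow> ('v, 'e, 'c) point" where
  "edge_map X e t =
     (if t \<le> 0 then Vert (src X e) else if t \<ge> 1 then Vert (tgt X e) else EdgePt e t)"

definition dart_map :: "('v, 'e, 'c) complex2 \<Rightarrow> 'e \<times> bool \<Rightarrow> real \<Rightarrow> ('v, 'e, 'c) point" where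
  "dart_map X d t = edge_map X (fst d) (if snd d then t else 1 - t)"

text \<open>
  The attaching map, as a map on \<open>[0,n)\<close> where \<open>n\<close> is the length of the walk: it runs through the
  \<open>i\<close>-th dart during \<open>[i,i+1)\<close>, and is constant if the walk is trivial.
\<close>

definition walk_map :: "('v, 'e, 'c) complex2 \<Rightarrow> 'c \<Rightarrow> real \<Rightarrow> ('v, 'e, 'c) point" where
  "walk_map X c s =
     (if walk X c = [] then Vert (base X c) else dart_map X (walk X c ! nat \<lfloor>s\<rfloor>) (frac s))"

definition cell_map :: "('v, 'e, 'c) complex2 \<Rightarrow> 'c \<Rightarrow> real \<times> real \<Rightarrow> ('v, 'e, 'c) point" where
  "cell_map X c p =
     (if l1 p < 1 then CellPt c p else walk_map X c (real (length (walk X c)) * circ p))"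

text \<open>
  The quotient topology from the disjoint union of the (discrete) vertex set, the intervals and
  the disks.
\<close>

definition cw_open :: "('v, 'e, 'c) complex2 \<Rightarrow> ('v, 'e, 'c) point set \<Rightarrow> bool" where
  "cw_open X U \<longleftrightarrow> U \<subseteq> points X \<and>
     (\<forall>e\<in>edges X. openin (top_of_set {0..1}) {t \<in> {0..1}. edge_map X e t \<in> U}) \<and>
     (\<forall>c\<in>cells X. openin (top_of_set disk) {p \<in> disk. cell_map X c p \<in> U})"

definition cw_space :: "('v, 'e, 'c) complex2 \<Rightarrow> ('v, 'e, 'c) point topology" where
  "cw_space X = topology (cw_open X)"

lemma istopology_cw_open: "istopology (cw_open X)"
proof -
  have inter: "cw_open X (S \<inter> T)" if "cw_open X S" "cw_open X T" for S T
  proof -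
    have "{t \<in> {0..1}. edge_map X e t \<in> S \<inter> T} =
        {t \<in> {0..1}. edge_map X e t \<in> S} \<inter> {t \<in> {0..1}. edge_map X e t \<in> T}" for e
      by auto
    moreover have "{p \<in> disk. cell_map X c p \<in> S \<inter> T} =
        {p \<in> disk. cell_map X c p \<in> S} \<inter> {p \<in> disk. cell_map X c p \<in> T}" for c
      by auto
    ultimately show ?thesis
      using that unfolding cw_open_def by (auto simp only: intro!: openin_Int)
  qed
  have union: "cw_open X (\<Union>K)" if K: "\<forall>S\<in>K. cw_open X S" for K
  proof -
    have "{t \<in> {0..1}. edge_map X e t \<in> \<Union>K} = (\<Union>S\<in>K. {t \<in> {0..1}. edge_map X e t \<in> S})" for e
      by auto
    moreover have "{p \<in> disk. cell_map X c p \<in> \<Union>K} = (\<Union>S\<in>K. {p \<in> disk. cell_map X c p \<in> S})" for c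
      by auto
    ultimately show ?thesis
      using K unfolding cw_open_def by (auto intro!: openin_Union)
  qed
  show ?thesis
    unfolding istopology_def using inter union by blast
qed

lemma openin_cw_space: "openin (cw_space X) U \<longleftrightarrow> cw_open X U"
  unfolding cw_space_def by (simp add: istopology_cw_open topology_inverse')

lemma l1_boundary_circ:
  assumes "l1 p = 1"
  shows "0 \<le> circ p" "circ p < 1"
  using assms by (auto simp: l1_def circ_def split: if_splits)

lemma is_walk_edges:
  "is_walk X u ds w \<Longrightarrow> d \<in> set ds \<Longrightarrow> fst d \<in> edges X"
  by (induction X u ds w rule: is_walk.induct) auto

lemma edge_map_in_points:
  assumes "finite_complex2 X" "e \<in> edges X"
  shows "edge_map X e t \<in> points X"
  using assms by (auto simp: finite_complex2_def edge_map_def points_def)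

lemma cell_map_in_points:
  assumes X: "finite_complex2 X" and c: "c \<in> cells X" and p: "p \<in> disk"
  shows "cell_map X c p \<in> points X"
proof (cases "l1 p < 1")
  case True
  then have "CellPt c p \<in> {CellPt c p | c p. c \<in> cells X \<and> l1 p < 1}" using c by blast
  then show ?thesis using True by (simp add: cell_map_def points_def)
next
  case False
  then have p1: "l1 p = 1" using p by (simp add: disk_def)
  have W: "is_walk X (base X c) (walk X c) (base X c)"
    using X c by (simp add: finite_complex2_def)
  show ?thesis
  proof (cases "walk X c = []")
    case True
    then show ?thesis using W p1 by (simp add: cell_map_def walk_map_def points_def)
  next
    case ne: False
    let ?s = "real (length (walk X c)) * circ p"
    have "0 \<le> ?s" "?s < real (length (walk X c))"
      using l1_boundary_circ[OF p1] ne by simp_all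
    then have "nat \<lfloor>?s\<rfloor> < length (walk X c)" by linarith
    then have "fst (walk X c ! nat \<lfloor>?s\<rfloor>) \<in> edges X"
      using is_walk_edges[OF W] by simp
    then show ?thesis
      using ne p1 edge_map_in_points[OF X]
      by (simp add: cell_map_def walk_map_def dart_map_def)
  qed
qed

lemma topspace_cw_space:
  assumes "finite_complex2 X"
  shows "topspace (cw_space X) = points X"
proof -
  have "{t \<in> {0..1}. edge_map X e t \<in> points X} = {0..1}" if "e \<in> edges X" for e
    using edge_map_in_points[OF assms that] by auto
  moreover have "{p \<in> disk. cell_map X c p \<in> points X} = disk" if "c \<in> cells X" for c
    using cell_map_in_points[OF assms that] by auto
  ultimately have "cw_open X (points X)"
    by (simp add: cw_open_def)
  then show ?thesis
    unfolding topspace_def by (auto simp: openin_cw_space cw_open_def)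
qed


section \<open>Piecewise linear embeddings\<close>

text \<open>
  Piecewise linear maps on a compact polyhedron \<open>S\<close>, given as a finite union of convex polytopes.
  Such a map is automatically continuous, since the pieces are finitely many closed sets.
\<close>

definition pl_on :: "'a::euclidean_space set \<Rightarrow> ('a \<Rightarrow> 'b::euclidean_space) \<Rightarrow> bool" where
  "pl_on S f \<longleftrightarrow> (\<exists>\<P>. finite \<P> \<and> \<Union>\<P> = S \<and>
     (\<forall>P\<in>\<P>. polytope P \<and> (\<exists>A b. linear A \<and> (\<forall>x\<in>P. f x = A x + b))))"

text \<open>
  A 2-cell with trivial attaching walk is a sphere. No PL structure on it makes the collapsing map
  from the disk piecewise linear, so it is given the PL structure of the octahedron \<open>octa\<close>
  instead, through the map \<open>collapse\<close> from the disk onto \<open>octa\<close>, which is injective on the open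
  disk and sends the boundary of the disk to the south pole \<open>((0,0),-1)\<close>.
\<close>

definition octa :: "((real \<times> real) \<times> real) set" where
  "octa = {q. l1 (fst q) + \<bar>snd q\<bar> = 1}"

definition collapse :: "real \<times> real \<Rightarrow> (real \<times> real) \<times> real" where
  "collapse p = ((2 * min (l1 p) (1 - l1 p) / l1 p) *\<^sub>R p, 1 - 2 * l1 p)"

text \<open>
  A map out of the complex is PL if it is PL on each closed cell. For a 2-cell whose walk has
  length \<open>n > 0\<close>, the attaching map is PL on the boundary of the disk, so its characteristic map
  carries over the PL structure of the disk.
\<close>

definition pl_map :: "('v, 'e, 'c) complex2 \<Rightarrow> (('v, 'e, 'c) point \<Rightarrow> 'a::euclidean_space) \<Rightarrow> bool" where
  "pl_map X f \<longleftrightarrow>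
     (\<forall>e\<in>edges X. pl_on {0..1} (\<lambda>t. f (edge_map X e t))) \<and>
     (\<forall>c\<in>cells X.
        if walk X c = []
        then \<exists>g. pl_on octa g \<and> (\<forall>p\<in>disk. f (cell_map X c p) = g (collapse p))
        else pl_on disk (\<lambda>p. f (cell_map X c p)))"

definition pl_embedding :: "('v, 'e, 'c) complex2 \<Rightarrow> (('v, 'e, 'c) point \<Rightarrow> 'a::euclidean_space) \<Rightarrow> bool" where
  "pl_embedding X f \<longleftrightarrow> embedding_map (cw_space X) euclidean f \<and> pl_map X f"

end

theory Submission
  imports Defs
begin

text \<open>
  Split four-space into five convex cones \<open>F\<^sub>t\<close>, any two of which share a three-dimensional wall and
  any three a plane. Assign one of them to \<open>v\<close>, one to \<open>w\<close>, one to the other vertices, one to the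
  edges and one to auxiliary disks inside the 2-cells, and put a node for each of these objects in
  the interior of its cone. Cut every 2-cell into stars of such nodes so that each star is the cone
  over a graph, its link, whose vertices lie on walls. The link vertices are placed generically in
  their walls, and the cell is mapped linearly on each triangle. In a convex cone the stars of
  distinct nodes of the same type are kept apart by a linear functional, and stars in different cones
  can meet only in walls. There, a segment between generic points of three-dimensional walls and
  planes meets another one only where it has to. The apex of a 2-cell, \<open>v\<close> or \<open>w\<close>, has its star in
  contact with all the other ones of the cell. Auxiliary disks are needed only where the walk
  returns to the apex, so that they never touch the star of a vertex other than \<open>v\<close> and \<open>w\<close>. Hence
  no wall between these two types is used, and the functionals separating their nodes can be chosen
  independently.
\<close>

section \<open>Piecewise linear maps\<close>

text \<open>Four-space serves as five-space modulo the diagonal, normalized by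
  \<open>height RR = 0\<close>. Segments with affinely independent ends do not cross, but a point
  where three regions meet is confined to a plane and cannot be made independent of three others. So
  the links are subdivided until each of their segments has an end with only two regions; vertices
  such as \<open>Mid\<close> exist for this reason. A return of the walk to the apex is the second
  obstacle: the corner star and the apex star would be cones from the same node over a common link
  segment, hence have the same image there, and the auxiliary disk keeps them apart. Thirdly, a walk
  may run along an edge repeatedly, so a link vertex on an edge may occur several times in a cell
  and does not locate a point. Only link vertices inside the cell do, and every interior point
  either has one of them with nonzero weight or is the node of an auxiliary disk. Injectivity is
  thus a decoding: the image determines node, parameter and weights, and these determine the
  point.\<close>

lemma polyhedron_affine_vimage:
  fixes A :: "'a::euclidean_space \<Rightarrow> 'b::euclidean_space"
  assumes "linear A" "polyhedron S"
  shows "polyhedron {x. A x + b \<in> S}"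
proof -
  obtain F where F: "finite F" "S = \<Inter>F" "\<And>h. h \<in> F \<Longrightarrow> \<exists>a c. a \<noteq> 0 \<and> h = {x. a \<bullet> x \<le> c}"
    using assms(2) unfolding polyhedron_def by metis
  have "{x. A x + b \<in> S} = \<Inter>((\<lambda>h. {x. A x + b \<in> h}) ` F)"
    using F(2) by auto
  moreover have "polyhedron {x. A x + b \<in> h}" if h: "h \<in> F" for h
  proof -
    obtain a c where "h = {x. a \<bullet> x \<le> c}" using F(3)[OF h] by auto
    then have "{x. A x + b \<in> h} = {x. adjoint A a \<bullet> x \<le> c - a \<bullet> b}"
      by (simp add: adjoint_clauses[OF assms(1)] inner_add_right algebra_simps)
    then show ?thesis by (simp add: polyhedron_halfspace_le)
  qed
  ultimately show ?thesis using F(1) by auto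
qed

lemma polyhedron_linear_le:
  fixes l :: "'a::euclidean_space \<Rightarrow> real"
  assumes "linear l"
  shows "polyhedron {x. l x \<le> c}"
proof -
  have "polyhedron {x. l x + 0 \<in> {..c}}"
    using polyhedron_affine_vimage[OF assms, of "{x. 1 \<bullet> x \<le> c}" 0] polyhedron_halfspace_le[of "1::real" c]
    by (simp add: atMost_def)
  then show ?thesis by simp
qed

lemma pl_onE:
  assumes "pl_on S f"
  obtains \<P> where "finite \<P>" "\<Union>\<P> = S" "\<And>P. P \<in> \<P> \<Longrightarrow> polytope P"
    "\<And>P. P \<in> \<P> \<Longrightarrow> \<exists>A b. linear A \<and> (\<forall>x\<in>P. f x = A x + b)"
proof -
  from assms obtain \<P> where P: "finite \<P> \<and> \<Union>\<P> = S \<and>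
     (\<forall>P\<in>\<P>. polytope P \<and> (\<exists>A b. linear A \<and> (\<forall>x\<in>P. f x = A x + b)))"
    unfolding pl_on_def by (rule exE)
  then show thesis by (intro that[of \<P>]) simp_all
qed

lemma pl_on_affine:
  assumes "polytope S" "linear A" "\<And>x. x \<in> S \<Longrightarrow> f x = A x + b"
  shows "pl_on S f"
  unfolding pl_on_def by (rule exI[of _ "{S}"]) (use assms in auto)

lemma pl_on_UN:
  assumes "finite I" "\<And>i. i \<in> I \<Longrightarrow> pl_on (S i) f"
  shows "pl_on (\<Union>i\<in>I. S i) f"
proof -
  have "\<forall>i\<in>I. \<exists>\<P>. finite \<P> \<and> \<Union>\<P> = S i \<and>
     (\<forall>P\<in>\<P>. polytope P \<and> (\<exists>A b. linear A \<and> (\<forall>x\<in>P. f x = A x + b)))"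
    using assms(2) unfolding pl_on_def by blast
  then obtain PP where PP: "\<And>i. i \<in> I \<Longrightarrow> finite (PP i) \<and> \<Union>(PP i) = S i \<and>
     (\<forall>P\<in>PP i. polytope P \<and> (\<exists>A b. linear A \<and> (\<forall>x\<in>P. f x = A x + b)))"
    by metis
  show ?thesis
    unfolding pl_on_def
  proof (intro exI[of _ "\<Union>i\<in>I. PP i"] conjI ballI)
    show "finite (\<Union>i\<in>I. PP i)" using assms(1) PP by auto
    have "\<Union>(\<Union>i\<in>I. PP i) = (\<Union>i\<in>I. \<Union>(PP i))" by blast
    also have "\<dots> = (\<Union>i\<in>I. S i)" using PP by (intro SUP_cong) simp_all
    finally show "\<Union>(\<Union>i\<in>I. PP i) = (\<Union>i\<in>I. S i)" .
    fix P assume "P \<in> (\<Union>i\<in>I. PP i)"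
    then obtain i where i: "i \<in> I" "P \<in> PP i" by blast
    show "polytope P" "\<exists>A b. linear A \<and> (\<forall>x\<in>P. f x = A x + b)"
      using PP[OF i(1)] i(2) by simp_all
  qed
qed

lemma pl_on_Un:
  assumes "pl_on S f" "pl_on T f"
  shows "pl_on (S \<union> T) f"
proof -
  have "pl_on (\<Union>b\<in>{True, False}. if b then S else T) f"
    using assms by (intro pl_on_UN) auto
  then show ?thesis by (simp add: Un_commute)
qed

lemma pl_on_cong:
  assumes "pl_on S f" "\<And>x. x \<in> S \<Longrightarrow> f x = g x"
  shows "pl_on S g"
proof -
  obtain \<P> where P: "finite \<P>" "\<Union>\<P> = S"
     "\<forall>P\<in>\<P>. polytope P \<and> (\<exists>A b. linear A \<and> (\<forall>x\<in>P. f x = A x + b))"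
    using assms(1) unfolding pl_on_def by blast
  have "x \<in> P \<Longrightarrow> P \<in> \<P> \<Longrightarrow> g x = f x" for x P using assms(2)[of x] P(2) by force
  then show ?thesis
    unfolding pl_on_def using P by (intro exI[of _ \<P>]) simp
qed

text \<open>On a piece \<open>P\<close> the map \<open>f\<close> is affine, so the preimage of a
  piece of \<open>g\<close> cuts a polytope out of \<open>P\<close>, and the composite is affine on
  it.\<close>

lemma pl_on_compose:
  fixes f :: "'a::euclidean_space \<Rightarrow> 'b::euclidean_space" and g :: "'b \<Rightarrow> 'c::euclidean_space"
  assumes "pl_on S f" "pl_on T g" "f ` S \<subseteq> T"
  shows "pl_on S (\<lambda>x. g (f x))"
proof -
  obtain \<P> where P: "finite \<P>" "\<Union>\<P> = S"
     "\<And>P. P\<in>\<P> \<Longrightarrow> polytope P \<and> (\<exists>A b. linear A \<and> (\<forall>x\<in>P. f x = A x + b))"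
    using assms(1) unfolding pl_on_def by blast
  obtain \<Q> where Q: "finite \<Q>" "\<Union>\<Q> = T"
     "\<And>P. P\<in>\<Q> \<Longrightarrow> polytope P \<and> (\<exists>A b. linear A \<and> (\<forall>x\<in>P. g x = A x + b))"
    using assms(2) unfolding pl_on_def by blast
  have *: "pl_on (P \<inter> {x. f x \<in> Q}) (\<lambda>x. g (f x))" if PQ: "P \<in> \<P>" "Q \<in> \<Q>" for P Q
  proof -
    obtain A b where A: "linear A" "\<And>x. x \<in> P \<Longrightarrow> f x = A x + b" using P(3)[OF PQ(1)] by auto
    obtain B c where B: "linear B" "\<And>x. x \<in> Q \<Longrightarrow> g x = B x + c" using Q(3)[OF PQ(2)] by auto
    have eq: "P \<inter> {x. f x \<in> Q} = P \<inter> {x. A x + b \<in> Q}" using A(2) by auto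
    have "polytope (P \<inter> {x. A x + b \<in> Q})"
      using P(3)[OF PQ(1)] Q(3)[OF PQ(2)] A(1)
      by (intro polytope_Int_polyhedron polyhedron_affine_vimage) (auto intro: polytope_imp_polyhedron)
    moreover have "linear (B \<circ> A)" using A(1) B(1) by (rule linear_compose)
    moreover have "g (f x) = (B \<circ> A) x + (B b + c)" if "x \<in> P \<inter> {x. f x \<in> Q}" for x
      using that A(2)[of x] B(2)[of "f x"] by (simp add: linear_add[OF B(1)])
    ultimately show ?thesis unfolding eq by (rule pl_on_affine) (simp_all only: eq[symmetric])
  qed
  have "pl_on (\<Union>PQ\<in>\<P> \<times> \<Q>. fst PQ \<inter> {x. f x \<in> snd PQ}) (\<lambda>x. g (f x))"
    using P(1) Q(1) * by (intro pl_on_UN) auto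
  moreover have "(\<Union>PQ\<in>\<P> \<times> \<Q>. fst PQ \<inter> {x. f x \<in> snd PQ}) = S"
  proof (intro subset_antisym subsetI)
    fix x assume x: "x \<in> S"
    then obtain P Q where "P \<in> \<P>" "x \<in> P" "Q \<in> \<Q>" "f x \<in> Q"
      using P(2) Q(2) assms(3) by (metis UnionE image_subset_iff)
    then show "x \<in> (\<Union>PQ\<in>\<P> \<times> \<Q>. fst PQ \<inter> {x. f x \<in> snd PQ})"
      by (intro UN_I[of "(P, Q)"]) simp_all
  qed (use P(2) in auto)
  ultimately show ?thesis by (simp only:)
qed

lemma pl_on_imp_continuous_on:
  fixes f :: "'a::euclidean_space \<Rightarrow> 'b::euclidean_space"
  assumes "pl_on S f"
  shows "continuous_on S f"
proof -
  obtain \<P> where P: "finite \<P>" "\<Union>\<P> = S"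
     "\<And>P. P\<in>\<P> \<Longrightarrow> polytope P \<and> (\<exists>A b. linear A \<and> (\<forall>x\<in>P. f x = A x + b))"
    using assms unfolding pl_on_def by blast
  have "continuous_on P f" if PP: "P \<in> \<P>" for P
  proof -
    obtain A b where A: "linear A" "\<And>x. x \<in> P \<Longrightarrow> f x = A x + b" using P(3)[OF PP] by blast
    have "continuous_on P (\<lambda>x. A x + b)"
      using A(1) by (intro continuous_intros linear_continuous_on) (simp add: linear_conv_bounded_linear)
    then show ?thesis using A(2) by (simp cong: continuous_on_cong)
  qed
  then show ?thesis
    using continuous_on_closed_Union[of \<P> "\<lambda>P. P" f] P polytope_imp_closed by auto
qed

lemma polytope_real_interval: "polytope {a..b::real}"
  by (metis polytope_interval box_real(2))

lemma polytope_imp_real_interval: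
  assumes "polytope (P :: real set)"
  obtains a b where "P = {a..b}"
  by (metis assms polytope_imp_compact polytope_imp_convex connected_compact_interval_1 convex_connected box_real(2))

lemma pl_on_interval_split:
  assumes "pl_on {a..b} f" "pl_on {b..c} f" "a \<le> b" "b \<le> (c::real)"
  shows "pl_on {a..c} f"
  using pl_on_Un[OF assms(1,2)] assms(3,4) by (simp add: ivl_disj_un_two_touch)

lemma pl_on_interval_affine:
  fixes f :: "real \<Rightarrow> 'a::euclidean_space"
  assumes "\<And>t. a \<le> t \<Longrightarrow> t \<le> b \<Longrightarrow> f t = t *\<^sub>R u + w"
  shows "pl_on {a..b} f"
  by (rule pl_on_affine[where A = "\<lambda>t. t *\<^sub>R u" and b = w])
     (use assms in \<open>auto intro!: polytope_real_interval linearI simp: algebra_simps\<close>)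

text \<open>Cramer's rule turns the barycentric coordinates of a nondegenerate triangle into affine
  functions of the point.\<close>

lemma pl_on_triangle:
  fixes f :: "real \<times> real \<Rightarrow> 'a::euclidean_space" and p u w :: "real \<times> real"
  assumes det: "fst u * snd w \<noteq> snd u * fst w"
    and f: "\<And>a b. 0 \<le> a \<Longrightarrow> 0 \<le> b \<Longrightarrow> a + b \<le> 1 \<Longrightarrow>
              f (p + a *\<^sub>R u + b *\<^sub>R w) = z + a *\<^sub>R x + b *\<^sub>R y"
  shows "pl_on (convex hull {p, p + u, p + w}) f"
proof -
  define d where "d = fst u * snd w - snd u * fst w"
  define \<alpha> where "\<alpha> q = (fst q * snd w - snd q * fst w) / d" for q :: "real \<times> real"
  define \<beta> where "\<beta> q = (fst u * snd q - snd u * fst q) / d" for q :: "real \<times> real"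
  have d: "d \<noteq> 0" using det by (simp add: d_def)
  have lin: "linear \<alpha>" "linear \<beta>"
    by (auto intro!: linearI simp: \<alpha>_def \<beta>_def algebra_simps add_divide_distrib diff_divide_distrib)
  have ab: "\<alpha> (a *\<^sub>R u + b *\<^sub>R w) = a" "\<beta> (a *\<^sub>R u + b *\<^sub>R w) = b" for a b
  proof -
    have "fst (a *\<^sub>R u + b *\<^sub>R w) * snd w - snd (a *\<^sub>R u + b *\<^sub>R w) * fst w = a * d"
      "fst u * snd (a *\<^sub>R u + b *\<^sub>R w) - snd u * fst (a *\<^sub>R u + b *\<^sub>R w) = b * d"
      by (simp_all add: d_def algebra_simps)
    then show "\<alpha> (a *\<^sub>R u + b *\<^sub>R w) = a" "\<beta> (a *\<^sub>R u + b *\<^sub>R w) = b"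
      using d by (simp_all only: \<alpha>_def \<beta>_def) simp_all
  qed
  define A where "A q = \<alpha> q *\<^sub>R x + \<beta> q *\<^sub>R y" for q
  have A: "linear A"
    unfolding A_def using lin
    by (intro linearI) (auto simp: linear_add linear_scale algebra_simps)
  show ?thesis
  proof (rule pl_on_affine[OF _ A, of _ _ "z - A p"])
    show "polytope (convex hull {p, p + u, p + w})" by (simp add: polytope_convex_hull)
    fix q assume "q \<in> convex hull {p, p + u, p + w}"
    then obtain a b where "0 \<le> a" "0 \<le> b" "a + b \<le> 1" "q = p + a *\<^sub>R u + b *\<^sub>R w"
      unfolding convex_hull_3_alt by auto
    moreover from this have "A q = A p + (a *\<^sub>R x + b *\<^sub>R y)"
      using ab[of a b] linear_add[OF A, of p "a *\<^sub>R u + b *\<^sub>R w"]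
      by (simp only: add.assoc) (simp only: A_def)
    ultimately show "f q = A q + (z - A p)" using f by simp
  qed
qed

section \<open>Radial extension of a closed curve over the disk\<close>

definition arc :: "real \<times> real \<Rightarrow> real" where
  "arc p = (if snd p \<ge> 0 then l1 p - fst p else 3 * l1 p + fst p) / 4"

lemma l1_eq_0: "l1 p = 0 \<longleftrightarrow> p = 0"
  by (cases p) (auto simp: l1_def prod_eq_iff)

lemma l1_nonneg: "0 \<le> l1 p"
  by (simp add: l1_def)

lemma l1_scale: "l1 (r *\<^sub>R p) = \<bar>r\<bar> * l1 p"
  by (simp add: l1_def abs_mult algebra_simps)

text \<open>\<open>arc\<close> is the extension of \<open>circ\<close> that is homogeneous of degree
  one. Unlike the angle itself it is piecewise linear, apart from a jump at the positive first
  axis.\<close>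

lemma arc_circ: "p \<noteq> 0 \<Longrightarrow> arc p = l1 p * circ ((1 / l1 p) *\<^sub>R p)"
proof -
  assume "p \<noteq> 0"
  then have "l1 p > 0" using l1_nonneg[of p] l1_eq_0[of p] by linarith
  then show ?thesis by (auto simp: arc_def circ_def field_simps zero_le_divide_iff)
qed

lemma circ_inj:
  assumes "l1 p = 1" "l1 q = 1" "circ p = circ q"
  shows "p = q"
  using assms
proof (cases "snd p \<ge> 0 \<longleftrightarrow> snd q \<ge> 0")
  case True
  then have x: "fst p = fst q" using assms(3) by (simp add: circ_def split: if_splits)
  then have "\<bar>snd p\<bar> = \<bar>snd q\<bar>" using assms(1,2) by (simp add: l1_def)
  then have "snd p = snd q" using True by (cases "snd p \<ge> 0") simp_all
  then show ?thesis using x by (simp add: prod_eq_iff)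
next
  case False
  \<comment> \<open>Both points would be the corner \<open>(-1, 0)\<close>, which belongs to the
    upper half only.\<close>
  have "fst p + fst q = -2" using assms(3) False by (simp add: circ_def split: if_splits)
  moreover have "\<bar>fst p\<bar> = 1 - \<bar>snd p\<bar>" "\<bar>fst q\<bar> = 1 - \<bar>snd q\<bar>"
    using assms(1,2) by (simp_all add: l1_def)
  ultimately have "snd p = 0" "snd q = 0" by linarith+
  then show ?thesis using False by simp
qed

text \<open>The cone construction: \<open>h\<close> on the boundary, \<open>z\<close> at the centre,
  affine along radii. At the origin the factor \<open>l1 p = 0\<close> makes the division by zero
  harmless.\<close>

definition radial :: "'a \<Rightarrow> (real \<Rightarrow> 'a) \<Rightarrow> real \<times> real \<Rightarrow> 'a::real_vector" where
  "radial z h p = z + l1 p *\<^sub>R (h (circ ((1 / l1 p) *\<^sub>R p)) - z)"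

lemma radial_boundary: "l1 p = 1 \<Longrightarrow> radial z h p = h (circ p)"
  by (simp add: radial_def)

lemma circ_range:
  assumes "p \<noteq> 0" shows "circ ((1 / l1 p) *\<^sub>R p) \<in> {0..<1}"
proof -
  have "l1 ((1 / l1 p) *\<^sub>R p) = 1"
    using assms l1_eq_0[of p] l1_nonneg[of p] by (simp add: l1_scale)
  then show ?thesis using l1_boundary_circ by auto
qed

text \<open>The signs \<open>\<sigma>\<close>, \<open>\<tau>\<close> select a closed quadrant, on
  which \<open>\<sigma> * fst p + \<tau> * snd p\<close> is \<open>l1 p\<close>. The conditional is
  \<open>arc\<close> with its branch chosen by \<open>\<tau>\<close> instead of the sign of
  \<open>snd p\<close>, which makes it linear on the whole quadrant.\<close>

definition sector :: "real \<Rightarrow> real \<Rightarrow> real \<Rightarrow> real \<Rightarrow> (real \<times> real) set" where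
  "sector a b \<sigma> \<tau> = {p. 0 \<le> \<sigma> * fst p \<and> 0 \<le> \<tau> * snd p \<and> \<sigma> * fst p + \<tau> * snd p \<le> 1 \<and>
     a * (\<sigma> * fst p + \<tau> * snd p) \<le> (if \<tau> = 1 then \<sigma> * fst p + \<tau> * snd p - fst p else 3 * (\<sigma> * fst p + \<tau> * snd p) + fst p) / 4 \<and>
     (if \<tau> = 1 then \<sigma> * fst p + \<tau> * snd p - fst p else 3 * (\<sigma> * fst p + \<tau> * snd p) + fst p) / 4 \<le> b * (\<sigma> * fst p + \<tau> * snd p)}"

text \<open>
  The sector over an arc on which \<open>h\<close> is affine, cut at the four corners of the disk, is a polytope;
  on it both \<open>l1\<close> and \<open>arc\<close>, hence the radial extension, are linear.
\<close>

lemma pl_on_radial: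
  fixes h :: "real \<Rightarrow> 'a::euclidean_space"
  assumes "pl_on {0..1} h" "h 0 = h 1"
  shows "pl_on disk (radial z h)"
proof -
  obtain \<P> where P: "finite \<P>" "\<Union>\<P> = {0..1}" "\<And>P. P \<in> \<P> \<Longrightarrow> polytope P"
     "\<And>P. P \<in> \<P> \<Longrightarrow> \<exists>A b. linear A \<and> (\<forall>x\<in>P. h x = A x + b)"
    using pl_onE[OF assms(1)] by metis
  define Q :: "real set \<times> real \<times> real \<Rightarrow> (real \<times> real) set" where
    "Q i = sector (Inf (fst i)) (Sup (fst i)) (fst (snd i)) (snd (snd i))" for i
  define I where "I = {P \<in> \<P>. P \<noteq> {}} \<times> {1, -1::real} \<times> {1, -1::real}"
  have piece: "pl_on (Q i) (radial z h)" if i: "i \<in> I" for i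
  proof -
    obtain P \<sigma> \<tau> where i': "i = (P, \<sigma>, \<tau>)" "P \<in> \<P>" "P \<noteq> {}" and st: "\<sigma> \<in> {1,-1}" "\<tau> \<in> {1,-1}"
      using i unfolding I_def by blast
    obtain a b where ab: "P = {a..b}" using P(3)[OF i'(2)] polytope_imp_real_interval by blast
    have ab': "a \<le> b" using i'(3) ab by auto
    have IS: "Inf P = a" "Sup P = b" using ab ab' by simp_all
    obtain A c where A: "linear A" "\<And>x. x \<in> P \<Longrightarrow> h x = A x + c" using P(4)[OF i'(2)] by auto
    have Ax: "A x = x *\<^sub>R A 1" for x using linear_scale[OF A(1), of x 1] by (simp only: real_scaleR_def mult_1_right)
    define l where "l p = \<sigma> * fst p + \<tau> * snd p" for p
    define m where "m p = (if \<tau> = 1 then l p - fst p else 3 * l p + fst p) / 4" for p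
    have lin: "linear l" "linear m"
    proof -
      show "linear l" by (auto intro!: linearI simp: l_def algebra_simps)
      show "linear m" unfolding m_def l_def
        by (cases "\<tau> = 1") (auto intro!: linearI simp: field_simps)
    qed
    have Q: "Q i = {p. - (\<sigma> * fst p) \<le> 0} \<inter> {p. - (\<tau> * snd p) \<le> 0} \<inter> {p. l p \<le> 1}
        \<inter> {p. a * l p - m p \<le> 0} \<inter> {p. m p - b * l p \<le> 0}"
      unfolding Q_def i' fst_conv snd_conv IS sector_def l_def m_def by auto
    have l1l: "l1 p = l p" if "p \<in> Q i" for p
    proof -
      have "\<bar>fst p\<bar> = \<sigma> * fst p" "\<bar>snd p\<bar> = \<tau> * snd p" using that st unfolding Q by auto
      then show ?thesis by (simp add: l1_def l_def)
    qed
    have "linear (\<lambda>p. - (\<sigma> * fst p))" "linear (\<lambda>p. - (\<tau> * snd p))"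
      by (auto intro!: linearI simp: algebra_simps)
    moreover have "linear (\<lambda>p. a * l p - m p)" "linear (\<lambda>p. m p - b * l p)"
      using linear_compose_sub[OF linear_compose_scale_right[OF lin(1), of a] lin(2)]
        linear_compose_sub[OF lin(2) linear_compose_scale_right[OF lin(1), of b]] by simp_all
    ultimately have "polyhedron (Q i)"
      unfolding Q using lin(1)
      by (intro polyhedron_Int polyhedron_linear_le)
    moreover have "bounded (Q i)"
    proof (rule bounded_subset[of "cbox (-1,-1) (1,1)"])
      show "Q i \<subseteq> cbox (-1,-1) (1,1)"
      proof
        fix p assume "p \<in> Q i"
        then have "l1 p \<le> 1" using l1l[of p] unfolding Q by simp
        then have "\<bar>fst p\<bar> \<le> 1" "\<bar>snd p\<bar> \<le> 1" by (simp_all add: l1_def)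
        then show "p \<in> cbox (-1,-1) (1,1)" by (cases p) (simp add: cbox_Pair_eq abs_le_iff)
      qed
    qed simp
    ultimately have "polytope (Q i)" by (simp add: polytope_eq_bounded_polyhedron)
    moreover have "radial z h p = (m p *\<^sub>R A 1 + l p *\<^sub>R (c - z)) + z" if p: "p \<in> Q i" for p
    proof (cases "p = 0")
      case True
      then show ?thesis using lin by (simp add: radial_def linear_0 l1_def)
    next
      case False
      then have l0: "0 < l p" using l1l[OF p] l1_nonneg[of p] l1_eq_0[of p] by linarith
      \<comment> \<open>On the positive first axis, approached from below, the linear formula gives
        the angle 1 where \<open>circ\<close> gives 0; \<open>h 0 = h 1\<close> makes the two
        interchangeable.\<close>
      have m: "m p = arc p \<or> m p = l p \<and> arc p = 0"
      proof (cases "snd p = 0")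
        case True
        then have "l p = \<sigma> * fst p" by (simp add: l_def)
        then show ?thesis using True st l0 by (auto simp: m_def arc_def l1l[OF p])
      next
        case False
        then have "\<tau> = 1 \<longleftrightarrow> snd p \<ge> 0" using p st unfolding Q by auto
        then show ?thesis by (simp add: m_def arc_def l1l[OF p])
      qed
      define \<theta> where "\<theta> = m p / l p"
      have mp: "m p = l p * \<theta>" using l0 by (simp add: \<theta>_def)
      have "arc p = l p * circ ((1 / l1 p) *\<^sub>R p)" using arc_circ[OF False] l1l[OF p] by simp
      then have "\<theta> = circ ((1 / l1 p) *\<^sub>R p) \<or> \<theta> = 1 \<and> circ ((1 / l1 p) *\<^sub>R p) = 0"
        using m l0 by (auto simp: \<theta>_def)
      then have h\<theta>: "h (circ ((1 / l1 p) *\<^sub>R p)) = h \<theta>" using assms(2) by auto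
      have "a * l p \<le> m p" "m p \<le> b * l p" using p unfolding Q by auto
      then have th: "\<theta> \<in> P" using l0 ab mp by (simp add: mult.commute)
      then have "h \<theta> = \<theta> *\<^sub>R A 1 + c" using A(2) Ax by metis
      then show ?thesis using l1l[OF p]
        unfolding radial_def h\<theta> by (simp add: mp algebra_simps)
    qed
    moreover have "linear (\<lambda>p. m p *\<^sub>R A 1 + l p *\<^sub>R (c - z))"
      using lin by (intro linearI) (auto simp: linear_add linear_scale algebra_simps)
    ultimately show ?thesis by (intro pl_on_affine)
  qed
  have "(\<Union>i\<in>I. Q i) = disk"
  proof (intro subset_antisym subsetI)
    fix p assume "p \<in> (\<Union>i\<in>I. Q i)"
    then obtain P \<sigma> \<tau> where p: "p \<in> Q (P, \<sigma>, \<tau>)" and st: "\<sigma> \<in> {1,-1}" "\<tau> \<in> {1,-1}"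
      unfolding I_def by blast
    then have q: "0 \<le> \<sigma> * fst p" "0 \<le> \<tau> * snd p" "\<sigma> * fst p + \<tau> * snd p \<le> 1"
      by (simp_all add: Q_def sector_def)
    have "\<bar>fst p\<bar> = \<sigma> * fst p" "\<bar>snd p\<bar> = \<tau> * snd p" using q st by auto
    then show "p \<in> disk" using q by (simp add: disk_def l1_def)
  next
    fix p assume p: "p \<in> disk"
    define \<sigma> where "\<sigma> = (if fst p \<ge> 0 then 1 else -1::real)"
    define \<tau> where "\<tau> = (if snd p \<ge> 0 then 1 else -1::real)"
    have l: "l1 p = \<sigma> * fst p + \<tau> * snd p" by (auto simp: l1_def \<sigma>_def \<tau>_def)
    have ex: "\<exists>\<theta>\<in>{0..1}. arc p = \<theta> * l1 p"
    proof (cases "p = 0")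
      case True
      then show ?thesis by (intro bexI[of _ 0]) (simp_all add: arc_def l1_def)
    next
      case False
      then show ?thesis using arc_circ[OF False] circ_range[OF False]
        by (intro bexI[of _ "circ ((1 / l1 p) *\<^sub>R p)"]) simp_all
    qed
    then obtain \<theta> where th: "\<theta> \<in> {0..1}" "arc p = \<theta> * l1 p" by blast
    then obtain PP where PP: "PP \<in> \<P>" "\<theta> \<in> PP" using P(2) by blast
    obtain a b where ab: "PP = {a..b}" using P(3)[OF PP(1)] polytope_imp_real_interval by blast
    have "a \<le> \<theta>" "\<theta> \<le> b" using ab PP(2) by auto
    then have IS: "Inf PP = a" "Sup PP = b" using ab by auto
    have m: "arc p = (if \<tau> = 1 then l1 p - fst p else 3 * l1 p + fst p) / 4"
      by (simp add: arc_def \<tau>_def)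
    have "a * l1 p \<le> arc p" "arc p \<le> b * l1 p"
      using th(2) \<open>a \<le> \<theta>\<close> \<open>\<theta> \<le> b\<close> l1_nonneg[of p] by (auto intro: mult_right_mono)
    have "p \<in> Q (PP, \<sigma>, \<tau>)"
    proof -
      have "0 \<le> \<sigma> * fst p" "0 \<le> \<tau> * snd p" by (simp_all add: \<sigma>_def \<tau>_def)
      then show ?thesis using \<open>a * l1 p \<le> arc p\<close> \<open>arc p \<le> b * l1 p\<close> p
        unfolding Q_def fst_conv snd_conv IS sector_def mem_Collect_eq l[symmetric] m[symmetric] disk_def
        by simp
    qed
    moreover have "(PP, \<sigma>, \<tau>) \<in> I" using PP by (auto simp: I_def \<sigma>_def \<tau>_def)
    ultimately show "p \<in> (\<Union>i\<in>I. Q i)" by blast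
  qed
  moreover have "finite I" using P(1) by (simp add: I_def)
  ultimately show ?thesis using pl_on_UN[of I Q "radial z h"] piece by simp
qed

section \<open>A criterion for embeddings\<close>

lemma continuous_map_cw_space:
  fixes f :: "('v, 'e, 'c) point \<Rightarrow> 'a::topological_space"
  assumes X: "finite_complex2 X"
    and edge: "\<And>e. e \<in> edges X \<Longrightarrow> continuous_on {0..1} (\<lambda>t. f (edge_map X e t))"
    and cell: "\<And>c. c \<in> cells X \<Longrightarrow> continuous_on disk (\<lambda>p. f (cell_map X c p))"
  shows "continuous_map (cw_space X) euclidean f"
proof -
  have "cw_open X {x \<in> points X. f x \<in> U}" if U: "open U" for U
  proof -
    have "openin (top_of_set {0..1}) {t \<in> {0..1}. edge_map X e t \<in> {x \<in> points X. f x \<in> U}}"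
      if e: "e \<in> edges X" for e
    proof -
      have "{t \<in> {0..1}. edge_map X e t \<in> {x \<in> points X. f x \<in> U}} = {0..1} \<inter> (\<lambda>t. f (edge_map X e t)) -` U"
        using edge_map_in_points[OF X e] by auto
      then show ?thesis using continuous_openin_preimage_gen[OF edge[OF e] U] by simp
    qed
    moreover have "openin (top_of_set disk) {p \<in> disk. cell_map X c p \<in> {x \<in> points X. f x \<in> U}}"
      if c: "c \<in> cells X" for c
    proof -
      have "{p \<in> disk. cell_map X c p \<in> {x \<in> points X. f x \<in> U}} = disk \<inter> (\<lambda>p. f (cell_map X c p)) -` U"
        using cell_map_in_points[OF X c] by auto
      then show ?thesis using continuous_openin_preimage_gen[OF cell[OF c] U] by simp
    qed
    ultimately show ?thesis by (auto simp: cw_open_def)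
  qed
  then show ?thesis
    by (simp add: continuous_map_def topspace_cw_space[OF X] openin_cw_space)
qed

lemma compact_disk: "compact disk"
proof -
  have "closed disk"
    unfolding disk_def l1_def by (intro closed_Collect_le continuous_intros)
  moreover have "disk \<subseteq> cbox (-1,-1) (1,1)"
    by (force simp: disk_def l1_def)
  then have "bounded disk" using bounded_cbox bounded_subset by blast
  ultimately show ?thesis by (simp add: compact_eq_bounded_closed)
qed

text \<open>The space is a finite union of points and continuous images of intervals and disks.
  Compactness later turns a continuous injection into an embedding.\<close>

lemma compact_space_cw_space:
  assumes X: "finite_complex2 X"
  shows "compact_space (cw_space X)"
proof -
  have edge: "compactin (cw_space X) (edge_map X e ` {0..1})" if e: "e \<in> edges X" for e
  proof (rule image_compactin[of "top_of_set {0..1}"])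
    show "compactin (top_of_set {0..1::real}) {0..1}"
      by (simp add: compactin_subtopology)
    show "continuous_map (top_of_set {0..1}) (cw_space X) (edge_map X e)"
      using e edge_map_in_points[OF X e]
      by (auto simp: continuous_map_def topspace_cw_space[OF X] openin_cw_space cw_open_def Int_def
          vimage_def)
  qed
  have cell: "compactin (cw_space X) (cell_map X c ` disk)" if c: "c \<in> cells X" for c
  proof (rule image_compactin[of "top_of_set disk"])
    show "compactin (top_of_set disk) disk"
      by (simp add: compactin_subtopology compact_disk)
    show "continuous_map (top_of_set disk) (cw_space X) (cell_map X c)"
      using c cell_map_in_points[OF X c]
      by (auto simp: continuous_map_def topspace_cw_space[OF X] openin_cw_space cw_open_def)
  qed
  have fin: "finite (Vert ` verts X)" "finite (edges X)" "finite (cells X)"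
    using X by (auto simp: finite_complex2_def)
  have "points X = Vert ` verts X \<union> (\<Union>e\<in>edges X. edge_map X e ` {0..1}) \<union> (\<Union>c\<in>cells X. cell_map X c ` disk)"
  proof (intro subset_antisym subsetI)
    fix x assume "x \<in> points X"
    then consider "x \<in> Vert ` verts X" | e t where "x = EdgePt e t" "e \<in> edges X" "0 < t" "t < 1"
      | c p where "x = CellPt c p" "c \<in> cells X" "l1 p < 1"
      unfolding points_def by auto
    then show "x \<in> Vert ` verts X \<union> (\<Union>e\<in>edges X. edge_map X e ` {0..1}) \<union> (\<Union>c\<in>cells X. cell_map X c ` disk)"
    proof cases
      case 2
      then have "x = edge_map X e t" "t \<in> {0..1}" by (auto simp: edge_map_def)
      with 2 show ?thesis by blast
    next
      case 3
      then have "x = cell_map X c p" "p \<in> disk" by (auto simp: cell_map_def disk_def)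
      with 3 show ?thesis by blast
    qed blast
  next
    fix x assume "x \<in> Vert ` verts X \<union> (\<Union>e\<in>edges X. edge_map X e ` {0..1}) \<union> (\<Union>c\<in>cells X. cell_map X c ` disk)"
    moreover have "Vert ` verts X \<subseteq> points X" by (auto simp: points_def)
    ultimately show "x \<in> points X"
      using edge_map_in_points[OF X] cell_map_in_points[OF X] by blast
  qed
  moreover have "compactin (cw_space X) (Vert ` verts X)"
    using fin(1) by (intro finite_imp_compactin) (auto simp: topspace_cw_space[OF X] points_def)
  moreover have "compactin (cw_space X) (\<Union>e\<in>edges X. edge_map X e ` {0..1})"
    using fin edge by (intro compactin_Union) auto
  moreover have "compactin (cw_space X) (\<Union>c\<in>cells X. cell_map X c ` disk)"
    using fin cell by (intro compactin_Union) auto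
  ultimately show ?thesis
    by (auto simp: compact_space_def topspace_cw_space[OF X] intro!: compactin_Un)
qed

section \<open>Five mutually adjacent regions in four-space\<close>

text \<open>
  The cone of \<open>t\<close> is where \<open>height t\<close> is the largest of the five heights. \<open>RA\<close> and \<open>RW\<close> belong to \<open>v\<close>
  and \<open>w\<close>, \<open>RV\<close> to the other vertices, \<open>RE\<close> to the edges, \<open>RR\<close> to the auxiliary disks.
\<close>

datatype region = RV | RA | RW | RE | RR

lemma UNIV_region: "(UNIV :: region set) = {RV, RA, RW, RE, RR}"
  by (auto intro: region.exhaust)

instance region :: finite
  by standard (simp add: UNIV_region)

lemma card_region: "CARD(region) = 5"
  by (simp add: UNIV_region)

fun height :: "region \<Rightarrow> real ^ 4 \<Rightarrow> real" where
  "height RV p = p $ 1"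
| "height RA p = p $ 2"
| "height RW p = p $ 3"
| "height RE p = p $ 4"
| "height RR p = 0"

lemma linear_height: "linear (height t)"
  by (cases t) (auto intro!: linearI)

lemmas height_add = linear_add[OF linear_height] and height_scale = linear_scale[OF linear_height]

text \<open>The point whose five heights are the values of \<open>z\<close> up to a common constant,
  which is fixed by \<open>height RR\<close> being 0.\<close>

definition pos :: "(region \<Rightarrow> real) \<Rightarrow> real ^ 4" where
  "pos z = (\<chi> i. if i = 1 then z RV - z RR else if i = 2 then z RA - z RR
     else if i = 3 then z RW - z RR else z RE - z RR)"

lemma height_pos: "height t (pos z) = z t - z RR"
proof -
  have "(1::4) \<noteq> 2" "(1::4) \<noteq> 3" "(1::4) \<noteq> 4" "(2::4) \<noteq> 3" "(2::4) \<noteq> 4" "(3::4) \<noteq> 4" by simp_all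
  then show ?thesis by (cases t) (simp_all add: pos_def)
qed

text \<open>For a wall \<open>u\<close> through \<open>b\<close>, the function
  \<open>height t - height u\<close> is \<open>1 - s\<close> times its value at \<open>N\<close> on
  the first segment and at least \<open>1 - s'\<close> times that value on the second. Hence
  \<open>s \<le> s'\<close>, and symmetry gives equality.\<close>

lemma cone_same_node:
  assumes N: "\<And>u. u \<noteq> t \<Longrightarrow> height u N < height t N"
    and b: "\<And>u. height u b \<le> height t b" "u \<noteq> t" "height u b = height t b"
    and b': "\<And>u. height u b' \<le> height t b'" "u' \<noteq> t" "height u' b' = height t b'"
    and s: "0 \<le> s" "s \<le> 1" "0 \<le> s'" "s' \<le> 1"
    and eq: "(1 - s) *\<^sub>R N + s *\<^sub>R b = (1 - s') *\<^sub>R N + s' *\<^sub>R b'"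
  shows "s = s' \<and> (s \<noteq> 0 \<longrightarrow> b = b')"
proof -
  have *: "s1 \<le> s2"
    if eq: "(1 - s1) *\<^sub>R N + s1 *\<^sub>R b1 = (1 - s2) *\<^sub>R N + s2 *\<^sub>R b2"
      and b1: "\<And>u. height u b1 \<le> height t b1" "u1 \<noteq> t" "height u1 b1 = height t b1"
      and b2: "\<And>u. height u b2 \<le> height t b2" and s: "0 \<le> s1" "s1 \<le> 1" "0 \<le> s2" "s2 \<le> 1"
    for s1 s2 b1 b2 u1
  proof -
    have "height t ((1 - s1) *\<^sub>R N + s1 *\<^sub>R b1) - height u1 ((1 - s1) *\<^sub>R N + s1 *\<^sub>R b1) =
        height t ((1 - s2) *\<^sub>R N + s2 *\<^sub>R b2) - height u1 ((1 - s2) *\<^sub>R N + s2 *\<^sub>R b2)"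
      by (simp only: eq)
    then have "(1 - s1) * (height t N - height u1 N) =
        (1 - s2) * (height t N - height u1 N) + s2 * (height t b2 - height u1 b2)"
      unfolding height_add height_scale real_scaleR_def b1(3) by (simp add: algebra_simps)
    moreover have "0 \<le> s2 * (height t b2 - height u1 b2)"
      using b2[of u1] s(3) by simp
    ultimately have "(1 - s2) * (height t N - height u1 N) \<le> (1 - s1) * (height t N - height u1 N)" by linarith
    then show "s1 \<le> s2" using N[OF b1(2)] by (simp add: mult_le_cancel_right)
  qed
  have "s = s'"
    using *[OF eq b b'(1) s] *[OF eq[symmetric] b' b(1) s(3,4,1,2)] by simp
  with eq show ?thesis by auto
qed

text \<open>\<open>height t - height t'\<close> is nonnegative on the cone of \<open>t\<close>,
  nonpositive on that of \<open>t'\<close> and nonzero at both nodes. At a common point it is 0,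
  which leaves no weight for the nodes.\<close>

lemma cone_different_region:
  assumes N: "\<And>u. u \<noteq> t \<Longrightarrow> height u N < height t N" and N': "\<And>u. u \<noteq> t' \<Longrightarrow> height u N' < height t' N'"
    and b: "\<And>u. height u b \<le> height t b" and b': "\<And>u. height u b' \<le> height t' b'"
    and t: "t \<noteq> t'" and s: "0 \<le> s" "s \<le> 1" "0 \<le> s'" "s' \<le> 1"
    and eq: "(1 - s) *\<^sub>R N + s *\<^sub>R b = (1 - s') *\<^sub>R N' + s' *\<^sub>R b'"
  shows "s = 1 \<and> s' = 1"
proof -
  have "height t ((1 - s) *\<^sub>R N + s *\<^sub>R b) - height t' ((1 - s) *\<^sub>R N + s *\<^sub>R b) =
      height t ((1 - s') *\<^sub>R N' + s' *\<^sub>R b') - height t' ((1 - s') *\<^sub>R N' + s' *\<^sub>R b')"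
    by (simp only: eq)
  then have "(1 - s) * (height t N - height t' N) + s * (height t b - height t' b) +
      (1 - s') * (height t' N' - height t N') + s' * (height t' b' - height t b') = 0"
    unfolding height_add height_scale real_scaleR_def by (simp add: algebra_simps)
  moreover have "0 \<le> (1 - s) * (height t N - height t' N)" "0 \<le> s * (height t b - height t' b)"
      "0 \<le> (1 - s') * (height t' N' - height t N')" "0 \<le> s' * (height t' b' - height t b')"
    using N[of t'] N'[of t] b[of t'] b'[of t] t s by (auto intro!: mult_nonneg_nonneg)
  ultimately have "(1 - s) * (height t N - height t' N) = 0" "(1 - s') * (height t' N' - height t N') = 0"
    by linarith+
  then show ?thesis using N[of t'] N'[of t] t by simp
qed

text \<open>An affine combination of two points, recorded as its coefficient function. This makes
  combinations on different pairs comparable and forgets an end whose coefficient is 0.\<close>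

definition wt :: "'a \<Rightarrow> 'a \<Rightarrow> real \<Rightarrow> 'a \<Rightarrow> real" where
  "wt \<alpha> \<beta> \<mu> \<kappa> = (if \<kappa> = \<alpha> then 1 - \<mu> else 0) + (if \<kappa> = \<beta> then \<mu> else 0)"

lemma wt_swap: "wt \<alpha> \<beta> \<mu> = wt \<beta> \<alpha> (1 - \<mu>)"
  by (auto simp: wt_def)

text \<open>
  A point \<open>\<delta>\<close> with two regions ranges over a three-dimensional wall, so a generic choice of it is
  affinely independent of any three other points; the points with three regions only range over planes.
\<close>

definition generic :: "('a \<Rightarrow> region set) \<Rightarrow> ('a \<Rightarrow> real ^ 4) \<Rightarrow> 'a set \<Rightarrow> bool" where
  "generic \<tau> g S \<longleftrightarrow> inj_on g S \<and>
     (\<forall>T c \<delta>. T \<subseteq> S \<longrightarrow> card T \<le> 4 \<longrightarrow> sum c T = 0 \<longrightarrow> (\<Sum>\<kappa>\<in>T. c \<kappa> *\<^sub>R g \<kappa>) = 0 \<longrightarrow>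
        \<delta> \<in> T \<longrightarrow> card (\<tau> \<delta>) = 2 \<longrightarrow> c \<delta> = 0)"

lemma genericD:
  assumes "generic \<tau> g S" "T \<subseteq> S" "card T \<le> 4" "sum c T = 0" "(\<Sum>\<kappa>\<in>T. c \<kappa> *\<^sub>R g \<kappa>) = 0"
    "\<delta> \<in> T" "card (\<tau> \<delta>) = 2"
  shows "c \<delta> = 0"
  using assms(1)[unfolded generic_def, THEN conjunct2, rule_format, OF assms(2-7)] .

text \<open>The difference of the coefficient functions is an affine dependency among at most four
  points. It vanishes at a two-region end of either segment, and then on the remaining two points by
  injectivity of \<open>g\<close>.\<close>

lemma generic_edges:
  assumes gen: "generic \<tau> g S" and S: "\<alpha> \<in> S" "\<beta> \<in> S" "\<gamma> \<in> S" "\<delta> \<in> S"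
    and two: "card (\<tau> \<alpha>) = 2 \<or> card (\<tau> \<beta>) = 2" "card (\<tau> \<gamma>) = 2 \<or> card (\<tau> \<delta>) = 2"
    and eq: "(1 - \<mu>) *\<^sub>R g \<alpha> + \<mu> *\<^sub>R g \<beta> = (1 - \<nu>) *\<^sub>R g \<gamma> + \<nu> *\<^sub>R g \<delta>"
  shows "wt \<alpha> \<beta> \<mu> = wt \<gamma> \<delta> \<nu>"
proof -
  \<comment> \<open>The case in which the two-region ends come first; reversing segments gives the
    others.\<close>
  have main: "wt \<alpha> \<beta> \<mu> = wt \<gamma> \<delta> \<nu>"
    if S: "\<alpha> \<in> S" "\<beta> \<in> S" "\<gamma> \<in> S" "\<delta> \<in> S" and two: "card (\<tau> \<alpha>) = 2" "card (\<tau> \<gamma>) = 2"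
      and eq: "(1 - \<mu>) *\<^sub>R g \<alpha> + \<mu> *\<^sub>R g \<beta> = (1 - \<nu>) *\<^sub>R g \<gamma> + \<nu> *\<^sub>R g \<delta>"
    for \<alpha> \<beta> \<gamma> \<delta> \<mu> \<nu>
  proof -
    define c where "c \<kappa> = wt \<alpha> \<beta> \<mu> \<kappa> - wt \<gamma> \<delta> \<nu> \<kappa>" for \<kappa>
    define T where "T = {\<alpha>, \<beta>, \<gamma>, \<delta>}"
    have T: "finite T" "\<alpha> \<in> T" "\<beta> \<in> T" "\<gamma> \<in> T" "\<delta> \<in> T" "T \<subseteq> S" using S by (auto simp: T_def)
    have cT: "card T \<le> 4"
      unfolding T_def by (simp add: card_insert_if)
    have wt1: "(\<Sum>\<kappa>\<in>T. wt a b m \<kappa>) = 1" if "a \<in> T" "b \<in> T" for a b m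
      using that T(1) by (simp add: wt_def sum.distrib sum.delta)
    have wt2: "(\<Sum>\<kappa>\<in>T. wt a b m \<kappa> *\<^sub>R g \<kappa>) = (1 - m) *\<^sub>R g a + m *\<^sub>R g b" if "a \<in> T" "b \<in> T" for a b m
    proof -
      have "wt a b m \<kappa> *\<^sub>R g \<kappa> = (if \<kappa> = a then (1 - m) *\<^sub>R g \<kappa> else 0) + (if \<kappa> = b then m *\<^sub>R g \<kappa> else 0)" for \<kappa>
        by (auto simp: wt_def scaleR_add_left)
      then show ?thesis using that T(1) by (simp add: sum.distrib sum.delta)
    qed
    have s1: "sum c T = 0" unfolding c_def sum_subtractf using T wt1 by simp
    have s2: "(\<Sum>\<kappa>\<in>T. c \<kappa> *\<^sub>R g \<kappa>) = 0"
      unfolding c_def scaleR_diff_left sum_subtractf using T wt2 eq by simp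
    have z: "c \<alpha> = 0" "c \<gamma> = 0"
      using genericD[OF gen T(6) cT s1 s2 T(2) two(1)] genericD[OF gen T(6) cT s1 s2 T(4) two(2)] .
    have T': "{\<beta>, \<delta>} \<subseteq> T" "\<forall>\<kappa>\<in>T - {\<beta>, \<delta>}. c \<kappa> = 0" using z T by (auto simp: T_def)
    have "sum c {\<beta>, \<delta>} = 0" using sum.mono_neutral_right[OF T(1) T'(1), of c] T'(2) s1 by simp
    moreover have "(\<Sum>\<kappa>\<in>{\<beta>, \<delta>}. c \<kappa> *\<^sub>R g \<kappa>) = 0"
      using sum.mono_neutral_right[OF T(1) T'(1), of "\<lambda>\<kappa>. c \<kappa> *\<^sub>R g \<kappa>"] T'(2) s2 by simp
    ultimately have "c \<beta> = 0 \<and> c \<delta> = 0"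
    proof (cases "\<beta> = \<delta>")
      case False
      assume a: "sum c {\<beta>, \<delta>} = 0" "(\<Sum>\<kappa>\<in>{\<beta>, \<delta>}. c \<kappa> *\<^sub>R g \<kappa>) = 0"
      then have cd: "c \<delta> = - c \<beta>" using False by simp
      then have "c \<beta> *\<^sub>R (g \<beta> - g \<delta>) = 0" using a False by (simp add: scaleR_diff_right)
      moreover have "g \<beta> \<noteq> g \<delta>" using gen S False unfolding generic_def by (metis inj_onD)
      ultimately show ?thesis using cd by simp
    qed simp
    then have "c \<kappa> = 0" for \<kappa>
      using z by (cases "\<kappa> \<in> T") (auto simp: T_def, simp add: c_def wt_def)
    then show ?thesis by (auto simp: c_def)
  qed
  have eq': "(1 - (1 - \<mu>)) *\<^sub>R g \<beta> + (1 - \<mu>) *\<^sub>R g \<alpha> = (1 - \<mu>) *\<^sub>R g \<alpha> + \<mu> *\<^sub>R g \<beta>"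
    "(1 - (1 - \<nu>)) *\<^sub>R g \<delta> + (1 - \<nu>) *\<^sub>R g \<gamma> = (1 - \<nu>) *\<^sub>R g \<gamma> + \<nu> *\<^sub>R g \<delta>"
    by (simp_all add: add.commute)
  from two consider "card (\<tau> \<alpha>) = 2" "card (\<tau> \<gamma>) = 2" | "card (\<tau> \<alpha>) = 2" "card (\<tau> \<delta>) = 2"
    | "card (\<tau> \<beta>) = 2" "card (\<tau> \<gamma>) = 2" | "card (\<tau> \<beta>) = 2" "card (\<tau> \<delta>) = 2" by blast
  then show ?thesis
  proof cases
    case 1
    then show ?thesis using main[OF S _ _ eq] by blast
  next
    case 2
    then have "wt \<alpha> \<beta> \<mu> = wt \<delta> \<gamma> (1 - \<nu>)"
      using eq eq' by (intro main S) simp_all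
    then show ?thesis by (simp only: wt_swap[of \<gamma> \<delta>])
  next
    case 3
    then have "wt \<beta> \<alpha> (1 - \<mu>) = wt \<gamma> \<delta> \<nu>"
      using eq eq' by (intro main S) simp_all
    then show ?thesis by (simp only: wt_swap[of \<alpha> \<beta>])
  next
    case 4
    then have "wt \<beta> \<alpha> (1 - \<mu>) = wt \<delta> \<gamma> (1 - \<nu>)"
      using eq eq' by (intro main S) simp_all
    then show ?thesis by (simp only: wt_swap[of \<alpha> \<beta>] wt_swap[of \<gamma> \<delta>])
  qed
qed

text \<open>
  The vectors \<open>v\<close> for which \<open>z\<^sub>0 + v\<close> lies in the affine hull of \<open>B\<close> fill at most a hyperplane, because
  the differences of points of \<open>B\<close> and the axes of \<open>\<tau>\<close> span less than the whole five-space.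
\<close>

lemma avoid_hulls:
  fixes z0 :: "region \<Rightarrow> real" and BB :: "(real ^ 4) set set"
  assumes BB: "finite BB" "\<And>B. B \<in> BB \<Longrightarrow> finite B \<and> card B + card \<tau> \<le> 5"
    and \<tau>3: "card \<tau> \<le> 3" and \<tau>: "t0 \<in> \<tau>" "\<And>t. t \<in> \<tau> \<Longrightarrow> z0 t = 0" and \<epsilon>: "\<epsilon> > 0"
  shows "\<exists>z. (\<forall>t\<in>\<tau>. z t = 0) \<and> (\<forall>t. \<bar>z t - z0 t\<bar> < \<epsilon>) \<and>
    (\<forall>B\<in>BB. \<exists>h c. linear h \<and> (\<forall>p\<in>B. h p = c) \<and> h (pos z) \<noteq> (c::real))"
proof -
  \<comment> \<open>\<open>D\<close> recovers five coordinates, normalized to vanish at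
    \<open>t0\<close>; applied to \<open>pos z\<close> with \<open>z t0 = 0\<close> it returns
    \<open>z\<close>.\<close>
  define D where "D p = (\<chi> u. height u p - height t0 p)" for p
  have linD: "linear D"
    by (rule linearI) (auto simp: D_def vec_eq_iff height_add height_scale algebra_simps)
  define zz where "zz v t = z0 t + (if t \<in> \<tau> then 0 else v $ t)" for v :: "real ^ region" and t
  have ex: "\<exists>n c. n \<noteq> 0 \<and> (\<forall>t\<in>\<tau>. n $ t = 0) \<and> (\<forall>p\<in>B. n \<bullet> D p = c)" if B: "B \<in> BB" for B
  proof (cases "B = {}")
    case True
    obtain t where t: "t \<notin> \<tau>"
    proof (rule ccontr)
      assume "\<not> thesis"
      then have "\<forall>t. t \<in> \<tau>" using that by blast
      then have "\<tau> = UNIV" by blast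
      then show False using \<tau>3 card_region by simp
    qed
    then show ?thesis using True by (intro exI[of _ "axis t 1"]) (auto simp: axis_def vec_eq_iff)
  next
    case False
    then obtain p0 where p0: "p0 \<in> B" by blast
    define W where "W = (\<lambda>p. D p - D p0) ` (B - {p0}) \<union> (\<lambda>t. axis t 1) ` \<tau>"
    have fin: "finite B" "finite \<tau>" using BB(2)[OF B] by (auto simp: finite)
    \<comment> \<open>The \<open>card B - 1\<close> differences and the \<open>card \<tau>\<close>
      axes are at most four vectors in five-space, so a nonzero normal exists.\<close>
    have "card W \<le> card (B - {p0}) + card \<tau>"
      unfolding W_def using fin by (intro order_trans[OF card_Un_le] add_mono card_image_le) auto
    also have "\<dots> < 5" using BB(2)[OF B] p0 fin by (simp add: card_gt_0_iff) (metis One_nat_def Suc_le_eq Suc_pred add_Suc card_gt_0_iff empty_iff)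
    finally have "card W < DIM(real ^ region)" by (simp add: card_region)
    moreover have "finite W" using fin by (simp add: W_def)
    ultimately have "dim W < DIM(real ^ region)" using dim_le_card' le_less_trans by blast
    then obtain n where n: "n \<noteq> 0" "\<And>y. y \<in> span W \<Longrightarrow> orthogonal n y"
      using orthogonal_to_subspace_exists by blast
    have "n $ t = 0" if "t \<in> \<tau>" for t
    proof -
      have "orthogonal n (axis t 1)" using that by (intro n(2) span_base) (auto simp: W_def)
      then show ?thesis by (simp add: orthogonal_def inner_axis)
    qed
    moreover have "n \<bullet> D p = n \<bullet> D p0" if "p \<in> B" for p
    proof (cases "p = p0")
      case False
      then have "orthogonal n (D p - D p0)" using that by (intro n(2) span_base) (auto simp: W_def)
      then show ?thesis by (simp add: orthogonal_def inner_diff_right)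
    qed simp
    ultimately show ?thesis using n(1) by blast
  qed
  obtain n c where nc: "\<And>B. B \<in> BB \<Longrightarrow> n B \<noteq> 0" "\<And>B t. B \<in> BB \<Longrightarrow> t \<in> \<tau> \<Longrightarrow> n B $ t = 0"
    "\<And>B p. B \<in> BB \<Longrightarrow> p \<in> B \<Longrightarrow> n B \<bullet> D p = c B"
    using ex by metis
  \<comment> \<open>The normal \<open>n B\<close> vanishes on the axes of \<open>\<tau>\<close>, so
    it does not see that \<open>zz\<close> clears those coordinates; avoiding \<open>B\<close>
    becomes avoiding one hyperplane of vectors \<open>v\<close>.\<close>
  have Dz: "n B \<bullet> D (pos (zz v)) = n B \<bullet> (\<chi> u. z0 u) + n B \<bullet> v" if "B \<in> BB" for B v
  proof -
    have "n B $ u * (zz v u - zz v t0) = n B $ u * z0 u + n B $ u * v $ u" for u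
      using nc(2)[OF that] \<tau> by (cases "u \<in> \<tau>") (auto simp: zz_def algebra_simps)
    then show ?thesis by (simp add: inner_vec_def D_def height_pos sum.distrib)
  qed
  define U where "U = (\<Union>B\<in>BB. {v. n B \<bullet> v = c B - n B \<bullet> (\<chi> u. z0 u)})"
  have "negligible U" unfolding U_def
    using BB(1) nc(1) by (intro negligible_Union) (auto intro!: negligible_hyperplane)
  moreover have "\<not> negligible (ball (0 :: real ^ region) \<epsilon>)"
    using \<epsilon> by (intro open_not_negligible) auto
  ultimately have "\<not> ball 0 \<epsilon> \<subseteq> U" by (metis negligible_subset)
  then obtain v where "v \<in> ball 0 \<epsilon>" "v \<notin> U" by (meson subsetI)
  then have v: "v \<in> ball 0 \<epsilon>" "\<And>B. B \<in> BB \<Longrightarrow> n B \<bullet> v \<noteq> c B - n B \<bullet> (\<chi> u. z0 u)"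
    unfolding U_def by auto
  have "\<bar>v $ t\<bar> < \<epsilon>" for t using v(1) component_le_norm_cart[of v t] by (simp add: order_le_less_trans)
  moreover have "linear (\<lambda>p. n B \<bullet> D p)" for B
    by (rule linearI) (simp_all add: linear_add[OF linD] linear_scale[OF linD] inner_add_right)
  moreover have "n B \<bullet> D (pos (zz v)) \<noteq> c B" if "B \<in> BB" for B
    using v(2)[OF that] Dz[OF that, of v] by simp
  ultimately have "\<exists>h c. linear h \<and> (\<forall>p\<in>B. h p = c) \<and> h (pos (zz v)) \<noteq> (c::real)" if "B \<in> BB" for B
    using nc(3)[OF that] that by (intro exI[of _ "\<lambda>p. n B \<bullet> D p"] exI[of _ "c B"]) simp
  then show ?thesis
    using \<tau>(2) \<epsilon> \<open>\<And>t. \<bar>v $ t\<bar> < \<epsilon>\<close> by (intro exI[of _ "zz v"]) (auto simp: zz_def)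
qed

text \<open>The points are placed one after the other, those confined to planes first. A point added
  later in a three-dimensional wall can avoid all hulls of three earlier points, whereas a plane may
  be contained in such a hull.\<close>

lemma generic_positions:
  fixes \<tau> :: "'a \<Rightarrow> region set"
  assumes S: "finite S" "\<And>\<alpha>. \<alpha> \<in> S \<Longrightarrow> card (\<tau> \<alpha>) = 2 \<or> card (\<tau> \<alpha>) = 3"
    and z0: "\<And>\<alpha> t. \<alpha> \<in> S \<Longrightarrow> t \<in> \<tau> \<alpha> \<Longrightarrow> z0 \<alpha> t = 0" and \<epsilon>: "\<epsilon> > 0"
  shows "\<exists>z. (\<forall>\<alpha>\<in>S. \<forall>t\<in>\<tau> \<alpha>. z \<alpha> t = 0) \<and> (\<forall>\<alpha>\<in>S. \<forall>t. \<bar>z \<alpha> t - z0 \<alpha> t\<bar> < \<epsilon>) \<and>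
    generic \<tau> (\<lambda>\<alpha>. pos (z \<alpha>)) S"
proof -
  define good where "good z Q \<longleftrightarrow> (\<forall>\<alpha>\<in>Q. \<forall>t\<in>\<tau> \<alpha>. z \<alpha> t = 0) \<and>
    (\<forall>\<alpha>\<in>Q. \<forall>t. \<bar>z \<alpha> t - z0 \<alpha> t\<bar> < \<epsilon>) \<and> generic \<tau> (\<lambda>\<alpha>. pos (z \<alpha>)) Q" for z Q
  have step: "\<exists>z. good z (insert \<delta> Q)"
    if Q: "finite Q" "good z Q" "\<delta> \<notin> Q" "\<delta> \<in> S" "card (\<tau> \<delta>) = 2 \<or> (\<forall>\<kappa>\<in>insert \<delta> Q. card (\<tau> \<kappa>) = 3)"
    for z Q \<delta>
  proof -
    \<comment> \<open>Two regions and three points stay within the bound 5 of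
      \<open>avoid_hulls\<close>. With three regions it is enough to avoid single points: no
      two-region point is present yet, so only injectivity has to be preserved.\<close>
    define k where "k = (if card (\<tau> \<delta>) = 2 then 3 else 1::nat)"
    define BB where "BB = {(\<lambda>\<alpha>. pos (z \<alpha>)) ` T | T. T \<subseteq> Q \<and> card T \<le> k}"
    have "BB \<subseteq> (`) (\<lambda>\<alpha>. pos (z \<alpha>)) ` Pow Q" by (auto simp: BB_def)
    then have finBB: "finite BB" using Q(1) by (meson finite_Pow_iff finite_imageI finite_subset)
    have BB: "finite B \<and> card B + card (\<tau> \<delta>) \<le> 5" if BBB: "B \<in> BB" for B
    proof -
      obtain T where T: "B = (\<lambda>\<alpha>. pos (z \<alpha>)) ` T" "T \<subseteq> Q" "card T \<le> k" using BBB by (auto simp: BB_def)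
      have fT: "finite T" using T(2) Q(1) finite_subset by blast
      have "card B \<le> card T" unfolding T(1) using fT by (rule card_image_le)
      then show ?thesis using T S(2)[OF Q(4)] fT by (auto simp: k_def split: if_splits)
    qed
    obtain t0 where t0: "t0 \<in> \<tau> \<delta>" using S(2)[OF Q(4)] by fastforce
    have c3: "card (\<tau> \<delta>) \<le> 3" using S(2)[OF Q(4)] by auto
    have "\<exists>y. (\<forall>t\<in>\<tau> \<delta>. y t = 0) \<and> (\<forall>t. \<bar>y t - z0 \<delta> t\<bar> < \<epsilon>) \<and>
      (\<forall>B\<in>BB. \<exists>h c. linear h \<and> (\<forall>p\<in>B. h p = c) \<and> h (pos y) \<noteq> (c::real))"
      by (rule avoid_hulls[OF finBB BB c3 t0 z0[OF Q(4)] \<epsilon>])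
    then obtain y where y': "(\<forall>t\<in>\<tau> \<delta>. y t = 0) \<and> (\<forall>t. \<bar>y t - z0 \<delta> t\<bar> < \<epsilon>) \<and>
      (\<forall>B\<in>BB. \<exists>h c. linear h \<and> (\<forall>p\<in>B. h p = c) \<and> h (pos y) \<noteq> (c::real))" ..
    note y = y'[THEN conjunct1] y'[THEN conjunct2, THEN conjunct1] y'[THEN conjunct2, THEN conjunct2]
    define z' where "z' = z(\<delta> := y)"
    have z'Q: "z' \<kappa> = z \<kappa>" if "\<kappa> \<in> Q" for \<kappa> using that Q(3) by (auto simp: z'_def)
    have gQ: "generic \<tau> (\<lambda>\<alpha>. pos (z' \<alpha>)) Q"
    proof -
      have g: "generic \<tau> (\<lambda>\<alpha>. pos (z \<alpha>)) Q" using Q(2) by (simp add: good_def)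
      have "inj_on (\<lambda>\<alpha>. pos (z' \<alpha>)) Q \<longleftrightarrow> inj_on (\<lambda>\<alpha>. pos (z \<alpha>)) Q"
        by (rule inj_on_cong) (simp add: z'Q)
      moreover have "(\<Sum>\<kappa>\<in>T. c \<kappa> *\<^sub>R pos (z' \<kappa>)) = (\<Sum>\<kappa>\<in>T. c \<kappa> *\<^sub>R pos (z \<kappa>))" if "T \<subseteq> Q" for T c
        by (rule sum.cong) (use that z'Q in auto)
      ultimately show ?thesis using g unfolding generic_def by simp
    qed
    have avoid: "c \<delta> = 0" if T: "T \<subseteq> insert \<delta> Q" "\<delta> \<in> T" "card T \<le> Suc k" "sum c T = 0"
        "(\<Sum>\<kappa>\<in>T. c \<kappa> *\<^sub>R pos (z' \<kappa>)) = 0" for T c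
    proof -
      define T' where "T' = T - {\<delta>}"
      have T': "T' \<subseteq> Q" "finite T" "finite T'" "\<delta> \<notin> T'" "T = insert \<delta> T'"
        using T Q(1) finite_subset[of T "insert \<delta> Q"] by (auto simp: T'_def)
      then have "card T' \<le> k" using T(3) by simp
      then have "(\<lambda>\<alpha>. pos (z \<alpha>)) ` T' \<in> BB" using T'(1) by (auto simp: BB_def)
      with y(3) have "\<exists>h c. linear h \<and> (\<forall>p\<in>(\<lambda>\<alpha>. pos (z \<alpha>)) ` T'. h p = c) \<and> h (pos y) \<noteq> (c::real)"
        by (rule bspec)
      then obtain h c0 where "linear h \<and> (\<forall>p\<in>(\<lambda>\<alpha>. pos (z \<alpha>)) ` T'. h p = c0) \<and> h (pos y) \<noteq> (c0::real)"
        by (elim exE)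
      then have h: "linear h" "\<And>\<kappa>. \<kappa> \<in> T' \<Longrightarrow> h (pos (z \<kappa>)) = c0" "h (pos y) \<noteq> (c0::real)"
        by simp_all
      have "0 = h (\<Sum>\<kappa>\<in>T. c \<kappa> *\<^sub>R pos (z' \<kappa>))" using T(5) linear_0[OF h(1)] by simp
      also have "\<dots> = (\<Sum>\<kappa>\<in>T. c \<kappa> * h (pos (z' \<kappa>)))" by (simp add: linear_sum[OF h(1)] linear_scale[OF h(1)])
      also have "\<dots> = c \<delta> * h (pos y) + (\<Sum>\<kappa>\<in>T'. c \<kappa> * h (pos (z' \<kappa>)))"
        using T' by (simp add: z'_def)
      also have "(\<Sum>\<kappa>\<in>T'. c \<kappa> * h (pos (z' \<kappa>))) = (\<Sum>\<kappa>\<in>T'. c \<kappa> * c0)"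
        using T'(1) h(2) z'Q by (intro sum.cong) auto
      also have "\<dots> = - c \<delta> * c0"
        using T(4) T' by (simp add: sum_distrib_right[symmetric] add_eq_0_iff)
      finally have "c \<delta> * (h (pos y) - c0) = 0" by (simp add: right_diff_distrib)
      then show ?thesis using h(3) by simp
    qed
    have "generic \<tau> (\<lambda>\<alpha>. pos (z' \<alpha>)) (insert \<delta> Q)"
      unfolding generic_def
    proof (intro conjI allI impI)
      have "pos (z' \<kappa>) \<noteq> pos (z' \<delta>)" if "\<kappa> \<in> Q" for \<kappa>
      proof
        assume eq: "pos (z' \<kappa>) = pos (z' \<delta>)"
        have ne: "\<kappa> \<noteq> \<delta>" using that Q(3) by auto
        have "(if \<delta> = \<delta> then 1 else -1 :: real) = 0"
          by (rule avoid[of "{\<delta>, \<kappa>}" "\<lambda>x. if x = \<delta> then 1 else -1"])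
             (use that ne eq in \<open>auto simp: k_def\<close>)
        then show False by simp
      qed
      then have "pos (z' \<delta>) \<notin> (\<lambda>\<alpha>. pos (z' \<alpha>)) ` (Q - {\<delta>})" by (metis DiffD1 imageE)
      moreover have "inj_on (\<lambda>\<alpha>. pos (z' \<alpha>)) Q" using gQ unfolding generic_def by (rule conjunct1)
      ultimately show "inj_on (\<lambda>\<alpha>. pos (z' \<alpha>)) (insert \<delta> Q)" by (simp only: inj_on_insert simp_thms)
    next
      fix T c \<kappa>
      assume T: "T \<subseteq> insert \<delta> Q" "card T \<le> 4" "sum c T = 0" "(\<Sum>\<kappa>\<in>T. c \<kappa> *\<^sub>R pos (z' \<kappa>)) = 0"
        "\<kappa> \<in> T" "card (\<tau> \<kappa>) = 2"
      \<comment> \<open>A two-region index in \<open>T\<close> rules out the stage at which all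
        indices have three regions.\<close>
      have k: "k = 3" using T(1,5,6) Q(5) by (auto simp: k_def)
      show "c \<kappa> = 0"
      proof (cases "\<delta> \<in> T")
        case False
        then have "T \<subseteq> Q" using T(1) by auto
        then show ?thesis using genericD[OF gQ _ T(2-6)] by simp
      next
        case True
        then have c0: "c \<delta> = 0" using avoid[OF T(1) True _ T(3,4)] T(2) k by simp
        show ?thesis
        proof (cases "\<kappa> = \<delta>")
          case False
          have fT: "finite T" using T(1) Q(1) finite_subset by blast
          have "sum c (T - {\<delta>}) = 0" "(\<Sum>\<kappa>\<in>T - {\<delta>}. c \<kappa> *\<^sub>R pos (z' \<kappa>)) = 0"
            using T(3,4) c0 by (simp_all add: sum.remove[OF fT True])
          moreover have "T - {\<delta>} \<subseteq> Q" "card (T - {\<delta>}) \<le> 4" "\<kappa> \<in> T - {\<delta>}"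
            using T False card_Diff1_le[of T \<delta>] by auto
          ultimately show ?thesis using genericD[OF gQ, of "T - {\<delta>}" c \<kappa>] T(6) by simp
        qed (use c0 in simp)
      qed
    qed
    moreover have "good z' Q" using Q(2) gQ z'Q by (simp add: good_def)
    ultimately have "good z' (insert \<delta> Q)"
      using y(1,2) by (simp add: good_def z'_def)
    then show ?thesis by blast
  qed
  define S3 where "S3 = {\<alpha> \<in> S. card (\<tau> \<alpha>) = 3}"
  define S2 where "S2 = {\<alpha> \<in> S. card (\<tau> \<alpha>) = 2}"
  have "finite S3" "finite S2" using S(1) by (auto simp: S3_def S2_def)
  have base: "\<exists>z. good z Q" if "finite Q" "Q \<subseteq> S3" for Q
    using that
  proof (induction Q)
    case empty
    then show ?case by (auto simp: good_def generic_def)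
  next
    case (insert \<delta> Q)
    then obtain z where "good z Q" by auto
    then show ?case using insert by (intro step) (auto simp: S3_def)
  qed
  have "\<exists>z. good z (S3 \<union> Q)" if "finite Q" "Q \<subseteq> S2" for Q
    using that
  proof (induction Q)
    case empty
    then show ?case using base[OF \<open>finite S3\<close>] by simp
  next
    case (insert \<delta> Q)
    then obtain z where z: "good z (S3 \<union> Q)" by auto
    have "\<delta> \<in> S" "card (\<tau> \<delta>) = 2" "\<delta> \<notin> S3 \<union> Q" using insert by (auto simp: S2_def S3_def)
    then have "\<exists>z. good z (insert \<delta> (S3 \<union> Q))"
      using insert \<open>finite S3\<close> z by (intro step[of _ z]) auto
    then show ?case by simp
  qed
  from this[OF \<open>finite S2\<close>] have "\<exists>z. good z (S3 \<union> S2)" by simp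
  moreover have "S3 \<union> S2 = S" using S(2) by (auto simp: S3_def S2_def)
  ultimately show ?thesis unfolding good_def by simp
qed

section \<open>Model positions of nodes and link vertices in the five cones\<close>

definition zvec :: "real \<Rightarrow> real \<Rightarrow> real \<Rightarrow> real \<Rightarrow> real \<Rightarrow> region \<Rightarrow> real" where
  "zvec a b c d e t = (case t of RV \<Rightarrow> a | RA \<Rightarrow> b | RW \<Rightarrow> c | RE \<Rightarrow> d | RR \<Rightarrow> e)"

lemma zvec_simps [simp]:
  "zvec a b c d e RV = a" "zvec a b c d e RA = b" "zvec a b c d e RW = c" "zvec a b c d e RE = d"
  "zvec a b c d e RR = e"
  by (simp_all add: zvec_def)

lemma all_region: "(\<forall>t. P t) \<longleftrightarrow> P RV \<and> P RA \<and> P RW \<and> P RE \<and> P RR"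
  by (metis region.exhaust)

lemma ex_region: "(\<exists>t. P t) \<longleftrightarrow> P RV \<or> P RA \<or> P RW \<or> P RE \<or> P RR"
  by (metis region.exhaust)

text \<open>
  Functionals that tell apart the stars of different nodes lying in the same region; the regions
  \<open>RA\<close> and \<open>RW\<close> contain one node each.
\<close>

fun slot :: "region \<Rightarrow> real ^ 4 \<Rightarrow> real" where
  "slot RV p = height RR p - height RV p"
| "slot RE p = height RV p + height RA p + height RW p - 3 * height RE p"
| "slot RR p = height RV p - height RR p"
| "slot _ p = 0"

lemma linear_slot: "linear (slot t)"
  by (cases t) (auto intro!: linearI simp: height_add height_scale algebra_simps)

text \<open>The sets of regions that may meet at a link vertex. None contains both \<open>RV\<close>
  and \<open>RR\<close>: the slot of either is measured by the coordinate of the other, which must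
  remain free.\<close>

definition walls :: "region set set" where
  "walls = {{RV, RE}, {RV, RA}, {RV, RW}, {RA, RE}, {RW, RE}, {RA, RW}, {RA, RR}, {RW, RR}, {RE, RR},
     {RV, RE, RA}, {RV, RE, RW}, {RA, RE, RW}, {RA, RE, RR}, {RW, RE, RR}}"

text \<open>On a wall the largest coordinate is 0, so a slot prescribes one of the other coordinates
  or a sum of them. Over \<open>{RE, RR}\<close> the slots force \<open>z RA + z RW = r - l\<close>;
  this is where \<open>r + 1 \<le> l\<close> and the margin 1/2 come from.\<close>

lemma wall_point:
  assumes "\<tau> \<in> walls" "1 \<le> x" "1 \<le> r" "r + 1 \<le> (l::real)"
  shows "\<exists>z. (\<forall>t. t \<in> \<tau> \<longrightarrow> z t = 0) \<and> (\<forall>t. t \<notin> \<tau> \<longrightarrow> z t \<le> -1/2) \<and>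
     (RV \<in> \<tau> \<longrightarrow> z RR = -x) \<and> (RR \<in> \<tau> \<longrightarrow> z RV = -r) \<and> (RE \<in> \<tau> \<longrightarrow> z RV + z RA + z RW = -l)"
proof -
  define Q where "Q \<tau> z \<longleftrightarrow> (\<forall>t. t \<in> \<tau> \<longrightarrow> z t = 0) \<and> (\<forall>t. t \<notin> \<tau> \<longrightarrow> z t \<le> -1/2) \<and>
     (RV \<in> \<tau> \<longrightarrow> z RR = -x) \<and> (RR \<in> \<tau> \<longrightarrow> z RV = -r) \<and> (RE \<in> \<tau> \<longrightarrow> z RV + z RA + z RW = -l)" for \<tau> z
  have Q: "Q {RV, RE} (zvec 0 (-l/2) (-l/2) 0 (-x))" "Q {RV, RA} (zvec 0 0 (-1) (-1) (-x))"
    "Q {RV, RW} (zvec 0 (-1) 0 (-1) (-x))" "Q {RA, RE} (zvec (-l/2) 0 (-l/2) 0 (-1))"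
    "Q {RW, RE} (zvec (-l/2) (-l/2) 0 0 (-1))" "Q {RA, RW} (zvec (-1) 0 0 (-1) (-1))"
    "Q {RA, RR} (zvec (-r) 0 (-1) (-1) 0)" "Q {RW, RR} (zvec (-r) (-1) 0 (-1) 0)"
    "Q {RE, RR} (zvec (-r) ((r-l)/2) ((r-l)/2) 0 0)" "Q {RV, RE, RA} (zvec 0 0 (-l) 0 (-x))"
    "Q {RV, RE, RW} (zvec 0 (-l) 0 0 (-x))" "Q {RA, RE, RW} (zvec (-l) 0 0 0 (-1))"
    "Q {RA, RE, RR} (zvec (-r) 0 (r-l) 0 0)" "Q {RW, RE, RR} (zvec (-r) (r-l) 0 0 0)"
    using assms(2-4) by (simp_all add: Q_def all_region field_simps)
  have "Q \<tau>' z \<Longrightarrow> \<exists>z. Q \<tau>' z" for \<tau>' z by (rule exI)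
  note ex = Q[THEN this]
  have "\<exists>z. Q \<tau> z"
    using assms(1) unfolding walls_def by (elim insertE) (simp_all only: ex empty_iff)
  then show ?thesis unfolding Q_def .
qed

lemma card_walls: "\<tau> \<in> walls \<Longrightarrow> card \<tau> = 2 \<or> card \<tau> = 3"
  unfolding walls_def by (elim insertE) simp_all

text \<open>Points interior to the cones, with slot exactly \<open>- real k\<close> in
  \<open>RV\<close>, \<open>RE\<close> and \<open>RR\<close>. The thirds reflect that the slot of
  \<open>RE\<close> adds three coordinates.\<close>

fun npos :: "region \<Rightarrow> nat \<Rightarrow> real ^ 4" where
  "npos RV k = pos (zvec 0 (-1) (-1) (-1) (- real k))"
| "npos RA k = pos (zvec (-1) 0 (-1) (-1) (-1))"
| "npos RW k = pos (zvec (-1) (-1) 0 (-1) (-1))"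
| "npos RE k = pos (zvec (- real k / 3) (- real k / 3) (- real k / 3) 0 (-1))"
| "npos RR k = pos (zvec (- real k) (-1) (-1) (-1) 0)"

lemma npos_interior: "1 \<le> k \<Longrightarrow> u \<noteq> t \<Longrightarrow> height u (npos t k) < height t (npos t k)"
  by (cases t; cases u) (simp_all add: height_pos del: height.simps)

text \<open>Distinct indices differ by at least 1, so open intervals of radius 1/2 around the slots
  of the nodes are disjoint.\<close>

definition on_link :: "region \<Rightarrow> nat \<Rightarrow> real ^ 4 \<Rightarrow> bool" where
  "on_link t k b \<longleftrightarrow> (\<forall>u. height u b \<le> height t b) \<and> (\<exists>u. u \<noteq> t \<and> height u b = height t b) \<and>
     (t \<in> {RV, RE, RR} \<longrightarrow> \<bar>slot t b + real k\<bar> < 1 / 2)"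

text \<open>Provides an endpoint for a ray of which only the node is given.\<close>

lemma on_link_ex:
  assumes "1 \<le> k" shows "\<exists>b. on_link t k b"
proof -
  have "on_link RV k (pos (zvec 0 0 (-1) (-1) (- real k)))" "on_link RA k (pos (zvec (-1) 0 0 (-1) (-1)))"
    "on_link RW k (pos (zvec (-1) 0 0 (-1) (-1)))"
    "on_link RE k (pos (zvec (- real k / 2) 0 (- real k / 2) 0 (-1)))"
    "on_link RR k (pos (zvec (- real k) 0 (-1) (-1) 0))"
    using assms by (simp_all add: on_link_def height_pos all_region ex_region del: height.simps)
  note this[THEN exI[where P = "on_link _ k"]]
  then show ?thesis by (cases t) simp_all
qed

lemma slot_npos: "t \<in> {RV, RE, RR} \<Longrightarrow> slot t (npos t k) = - real k"
  by (cases t) (simp_all add: height_pos del: height.simps)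

text \<open>There are three cases: a single node, whose rays to the boundary of a convex cone meet
  only in the node; two nodes in one cone, kept apart by \<open>slot\<close>; and two cones, which
  meet only in walls.\<close>

lemma cone_inj:
  assumes b: "on_link t k b" and b': "on_link t' k' b'" and k: "1 \<le> k" "1 \<le> k'"
    and nodes: "t = t' \<Longrightarrow> k \<noteq> k' \<Longrightarrow> t \<in> {RV, RE, RR}"
    and s: "0 \<le> s" "s \<le> 1" "0 \<le> s'" "s' \<le> 1"
    and eq: "(1 - s) *\<^sub>R npos t k + s *\<^sub>R b = (1 - s') *\<^sub>R npos t' k' + s' *\<^sub>R b'"
  shows "s = s' \<and> (s \<noteq> 1 \<longrightarrow> t = t' \<and> k = k') \<and> (s \<noteq> 0 \<longrightarrow> b = b')"
proof (cases "t = t'")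
  case True
  show ?thesis
  proof (cases "k = k'")
    case kk: True
    obtain u where u: "u \<noteq> t \<and> height u b = height t b" using b unfolding on_link_def by (elim conjE exE) simp
    obtain u' where u': "u' \<noteq> t \<and> height u' b' = height t b'"
      using b' True unfolding on_link_def by (elim conjE exE) simp
    then have "s = s' \<and> (s \<noteq> 0 \<longrightarrow> b = b')"
      using b b' True kk eq k s u u'
      by (intro cone_same_node[of t "npos t k" b u b' u' s s'] npos_interior) (simp_all add: on_link_def)
    then show ?thesis using True kk by simp
  next
    case False
    then have t: "t \<in> {RV, RE, RR}" using nodes True by blast
    have sl: "\<bar>slot t ((1 - r) *\<^sub>R npos t i + r *\<^sub>R a) + real i\<bar> < 1 / 2"
      if "on_link t i a" "0 \<le> r" "r \<le> 1" for a r i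
    proof -
      have "slot t ((1 - r) *\<^sub>R npos t i + r *\<^sub>R a) + real i = r * (slot t a + real i)"
        using slot_npos[OF t, of i]
        unfolding linear_add[OF linear_slot] linear_scale[OF linear_slot] real_scaleR_def by (simp add: algebra_simps)
      moreover have "r * \<bar>slot t a + real i\<bar> \<le> 1 * \<bar>slot t a + real i\<bar>"
        using that by (intro mult_right_mono) auto
      moreover have "\<bar>slot t a + real i\<bar> < 1 / 2" using that(1) t unfolding on_link_def by (elim conjE) (rule mp)
      ultimately show ?thesis using that(2) by (simp add: abs_mult)
    qed
    have "\<bar>real k - real k'\<bar> < 1"
      using sl[OF b s(1,2)] sl[OF b'[folded True] s(3,4)] unfolding eq[folded True] by linarith
    then show ?thesis using False by linarith
  qed
next
  case False
  then have "s = 1 \<and> s' = 1"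
    using b b' k s eq
    by (intro cone_different_region[of t "npos t k" t' "npos t' k'" b b'] npos_interior) (simp_all add: on_link_def)
  with eq show ?thesis by simp
qed

text \<open>\<open>nds \<alpha>\<close> consists of the nodes whose stars contain the link vertex
  \<open>\<alpha>\<close>. That \<open>bound\<close> separates the indices of \<open>RR\<close>
  nodes from those of \<open>RE\<close> nodes yields the inequality \<open>r + 1 \<le> l\<close> of
  \<open>wall_point\<close>.\<close>

locale arrangement =
  fixes S :: "'l set" and nds :: "'l \<Rightarrow> 'n set" and ty :: "'n \<Rightarrow> region" and ix :: "'n \<Rightarrow> nat"
    and nodes :: "'n set" and bound :: nat
  assumes finS: "finite S"
    and nds: "\<And>\<alpha>. \<alpha> \<in> S \<Longrightarrow> nds \<alpha> \<subseteq> nodes" "\<And>\<alpha>. \<alpha> \<in> S \<Longrightarrow> ty ` nds \<alpha> \<in> walls"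
      "\<And>\<alpha>. \<alpha> \<in> S \<Longrightarrow> inj_on ty (nds \<alpha>)"
    and ix: "\<And>N. N \<in> nodes \<Longrightarrow> 1 \<le> ix N" "\<And>N. N \<in> nodes \<Longrightarrow> ty N = RE \<Longrightarrow> bound < ix N"
      "\<And>N. N \<in> nodes \<Longrightarrow> ty N = RR \<Longrightarrow> ix N \<le> bound"
    and bound: "1 \<le> bound"
    and distinct: "\<And>N N'. N \<in> nodes \<Longrightarrow> N' \<in> nodes \<Longrightarrow> N \<noteq> N' \<Longrightarrow> ty N = ty N' \<Longrightarrow>
        ix N \<noteq> ix N' \<and> ty N \<in> {RV, RE, RR}"
begin

lemma card_nds: "\<alpha> \<in> S \<Longrightarrow> card (ty ` nds \<alpha>) = card (nds \<alpha>)"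
  by (rule card_image[OF nds(3)])

definition admissible :: "('l \<Rightarrow> real ^ 4) \<Rightarrow> bool" where
  "admissible g \<longleftrightarrow> generic (\<lambda>\<alpha>. ty ` nds \<alpha>) g S \<and>
     (\<forall>\<alpha>\<in>S. \<forall>N\<in>nds \<alpha>. (\<forall>u. height u (g \<alpha>) \<le> height (ty N) (g \<alpha>)) \<and>
        (ty N \<in> {RV, RE, RR} \<longrightarrow> \<bar>slot (ty N) (g \<alpha>) + real (ix N)\<bar> < 1 / 2))"

text \<open>The model positions of \<open>wall_point\<close> become generic after a perturbation by
  less than 1/8 inside the walls. The slot of \<open>RE\<close> adds three coordinates and thus
  moves by less than 3/8, still below 1/2.\<close>

lemma admissible_ex: "\<exists>g. admissible g"
proof -
  have "\<exists>z. (\<forall>t. t \<in> ty ` nds \<alpha> \<longrightarrow> z t = 0) \<and> (\<forall>t. t \<notin> ty ` nds \<alpha> \<longrightarrow> z t \<le> -1/2) \<and>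
      (\<forall>N\<in>nds \<alpha>. (ty N = RV \<longrightarrow> z RR = - real (ix N)) \<and> (ty N = RR \<longrightarrow> z RV = - real (ix N)) \<and>
        (ty N = RE \<longrightarrow> z RV + z RA + z RW = - real (ix N)))" if \<alpha>: "\<alpha> \<in> S" for \<alpha>
  proof -
    \<comment> \<open>By injectivity of types at most one node of \<open>\<alpha>\<close> has type
      \<open>t\<close>. The number \<open>m\<close> is its index, or the default \<open>d\<close> if
      there is no such node.\<close>
    have ex: "\<exists>m. (\<forall>N\<in>nds \<alpha>. ty N = t \<longrightarrow> m = ix N) \<and> Q m"
      if d: "Q d" and Q: "\<And>N. N \<in> nodes \<Longrightarrow> ty N = t \<Longrightarrow> Q (ix N)" for t d and Q :: "nat \<Rightarrow> bool"
    proof (cases "\<exists>N\<in>nds \<alpha>. ty N = t")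
      case True
      then obtain N where N: "N \<in> nds \<alpha>" "ty N = t" by (elim bexE)
      have "ix N = ix N'" if "N' \<in> nds \<alpha>" "ty N' = t" for N'
        using inj_onD[OF nds(3)[OF \<alpha>], of N N'] N that by simp
      moreover have "Q (ix N)" by (rule Q[OF subsetD[OF nds(1)[OF \<alpha>] N(1)] N(2)])
      ultimately show ?thesis by (intro exI[of _ "ix N"]) simp
    next
      case False
      then show ?thesis using d by (intro exI[of _ d]) simp
    qed
    obtain x where x: "\<forall>N\<in>nds \<alpha>. ty N = RV \<longrightarrow> x = ix N" "1 \<le> x"
      using ex[of "\<lambda>m. 1 \<le> m" 1 RV] ix(1) by auto
    obtain r where r: "\<forall>N\<in>nds \<alpha>. ty N = RR \<longrightarrow> r = ix N" "1 \<le> r \<and> r \<le> bound"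
      using ex[of "\<lambda>m. 1 \<le> m \<and> m \<le> bound" 1 RR] ix(1,3) bound by auto
    obtain l where l: "\<forall>N\<in>nds \<alpha>. ty N = RE \<longrightarrow> l = ix N" "bound < l"
      using ex[of "\<lambda>m. bound < m" "bound + 1" RE] ix(2) by auto
    from x(2) r(2) l(2) have "1 \<le> x" "1 \<le> r" "r \<le> bound" "bound < l" by simp_all
    then have "1 \<le> real x" "1 \<le> real r" "real r + 1 \<le> real l" by linarith+
    from wall_point[OF nds(2)[OF \<alpha>] this] obtain z where
      "(\<forall>t. t \<in> ty ` nds \<alpha> \<longrightarrow> z t = 0) \<and> (\<forall>t. t \<notin> ty ` nds \<alpha> \<longrightarrow> z t \<le> -1/2) \<and>
       (RV \<in> ty ` nds \<alpha> \<longrightarrow> z RR = - real x) \<and> (RR \<in> ty ` nds \<alpha> \<longrightarrow> z RV = - real r) \<and>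
       (RE \<in> ty ` nds \<alpha> \<longrightarrow> z RV + z RA + z RW = - real l)" by (elim exE)
    note z = this
    show ?thesis
    proof (intro exI[of _ z] conjI ballI)
      fix N assume N: "N \<in> nds \<alpha>"
      then have "ty N \<in> ty ` nds \<alpha>" by (rule imageI)
      note w = z[THEN conjunct2, THEN conjunct2] and i = this
      show "ty N = RV \<longrightarrow> z RR = - real (ix N)"
        using w[THEN conjunct1] i bspec[OF x(1) N] by (intro impI) (simp only: simp_thms)
      show "ty N = RR \<longrightarrow> z RV = - real (ix N)"
        using w[THEN conjunct2, THEN conjunct1] i bspec[OF r(1) N] by (intro impI) (simp only: simp_thms)
      show "ty N = RE \<longrightarrow> z RV + z RA + z RW = - real (ix N)"
        using w[THEN conjunct2, THEN conjunct2] i bspec[OF l(1) N] by (intro impI) (simp only: simp_thms)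
    qed (rule z[THEN conjunct1], rule z[THEN conjunct2, THEN conjunct1])
  qed
  then have "\<forall>\<alpha>\<in>S. \<exists>z. (\<forall>t. t \<in> ty ` nds \<alpha> \<longrightarrow> z t = 0) \<and> (\<forall>t. t \<notin> ty ` nds \<alpha> \<longrightarrow> z t \<le> -1/2) \<and>
      (\<forall>N\<in>nds \<alpha>. (ty N = RV \<longrightarrow> z RR = - real (ix N)) \<and> (ty N = RR \<longrightarrow> z RV = - real (ix N)) \<and>
        (ty N = RE \<longrightarrow> z RV + z RA + z RW = - real (ix N)))" ..
  from bchoice[OF this] obtain z0 where z0':
    "\<forall>\<alpha>\<in>S. (\<forall>t. t \<in> ty ` nds \<alpha> \<longrightarrow> z0 \<alpha> t = 0) \<and> (\<forall>t. t \<notin> ty ` nds \<alpha> \<longrightarrow> z0 \<alpha> t \<le> -1/2) \<and>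
      (\<forall>N\<in>nds \<alpha>. (ty N = RV \<longrightarrow> z0 \<alpha> RR = - real (ix N)) \<and> (ty N = RR \<longrightarrow> z0 \<alpha> RV = - real (ix N)) \<and>
        (ty N = RE \<longrightarrow> z0 \<alpha> RV + z0 \<alpha> RA + z0 \<alpha> RW = - real (ix N)))" by (elim exE)
  then have z0: "\<And>\<alpha> t. \<alpha> \<in> S \<Longrightarrow> t \<in> ty ` nds \<alpha> \<Longrightarrow> z0 \<alpha> t = 0"
      "\<And>\<alpha> t. \<alpha> \<in> S \<Longrightarrow> t \<notin> ty ` nds \<alpha> \<Longrightarrow> z0 \<alpha> t \<le> -1/2"
      "\<And>\<alpha> N. \<alpha> \<in> S \<Longrightarrow> N \<in> nds \<alpha> \<Longrightarrow> (ty N = RV \<longrightarrow> z0 \<alpha> RR = - real (ix N)) \<and>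
         (ty N = RR \<longrightarrow> z0 \<alpha> RV = - real (ix N)) \<and> (ty N = RE \<longrightarrow> z0 \<alpha> RV + z0 \<alpha> RA + z0 \<alpha> RW = - real (ix N))"
    by simp_all
  have "\<exists>z. (\<forall>\<alpha>\<in>S. \<forall>t\<in>ty ` nds \<alpha>. z \<alpha> t = 0) \<and> (\<forall>\<alpha>\<in>S. \<forall>t. \<bar>z \<alpha> t - z0 \<alpha> t\<bar> < 1/8) \<and>
      generic (\<lambda>\<alpha>. ty ` nds \<alpha>) (\<lambda>\<alpha>. pos (z \<alpha>)) S"
    using card_walls nds(2) z0(1) by (intro generic_positions finS) auto
  then obtain z where z: "\<forall>\<alpha>\<in>S. \<forall>t\<in>ty ` nds \<alpha>. z \<alpha> t = 0" "\<forall>\<alpha>\<in>S. \<forall>t. \<bar>z \<alpha> t - z0 \<alpha> t\<bar> < 1/8"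
    "generic (\<lambda>\<alpha>. ty ` nds \<alpha>) (\<lambda>\<alpha>. pos (z \<alpha>)) S" by (elim exE conjE)
  have "admissible (\<lambda>\<alpha>. pos (z \<alpha>))"
    unfolding admissible_def
  proof (intro conjI z(3) ballI allI impI)
    fix \<alpha> N assume \<alpha>: "\<alpha> \<in> S" and N: "N \<in> nds \<alpha>"
    have zN: "z \<alpha> (ty N) = 0" using z(1) \<alpha> N by blast
    have "z \<alpha> u \<le> 0" for u
    proof (cases "u \<in> ty ` nds \<alpha>")
      case True
      then show ?thesis using bspec[OF bspec[OF z(1) \<alpha>]] by (metis order_refl)
    next
      case False
      then have "z0 \<alpha> u \<le> -1/2" using z0(2) \<alpha> by blast
      moreover have "\<bar>z \<alpha> u - z0 \<alpha> u\<bar> < 1/8" using z(2) \<alpha> by blast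
      ultimately show ?thesis by linarith
    qed
    then show "height u (pos (z \<alpha>)) \<le> height (ty N) (pos (z \<alpha>))" for u
      using zN by (simp add: height_pos)
    assume t: "ty N \<in> {RV, RE, RR}"
    have d: "\<bar>z \<alpha> u - z0 \<alpha> u\<bar> < 1/8" for u using z(2) \<alpha> by blast
    from t consider "ty N = RV" | "ty N = RE" | "ty N = RR" by blast
    then show "\<bar>slot (ty N) (pos (z \<alpha>)) + real (ix N)\<bar> < 1 / 2"
    proof cases
      case 1
      then show ?thesis using d[of RR] z0(3)[OF \<alpha> N] zN by (simp add: height_pos del: height.simps)
    next
      case 2
      then have "slot (ty N) (pos (z \<alpha>)) = z \<alpha> RV + z \<alpha> RA + z \<alpha> RW"
        using zN by (simp add: height_pos del: height.simps)
      moreover have "z0 \<alpha> RV + z0 \<alpha> RA + z0 \<alpha> RW = - real (ix N)" using z0(3)[OF \<alpha> N] 2 by blast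
      ultimately show ?thesis using d[of RV] d[of RA] d[of RW] by linarith
    next
      case 3
      then show ?thesis using d[of RV] z0(3)[OF \<alpha> N] zN by (simp add: height_pos del: height.simps)
    qed
  qed
  then show ?thesis by blast
qed

text \<open>A second common node puts the whole segment into a wall, that is, into the boundary of
  the cone of \<open>N\<close>; an end with only two nodes makes \<open>generic_edges\<close>
  applicable.\<close>

definition lk :: "'n \<Rightarrow> 'l \<Rightarrow> 'l \<Rightarrow> bool" where
  "lk N \<alpha> \<beta> \<longleftrightarrow> \<alpha> \<in> S \<and> \<beta> \<in> S \<and> N \<in> nds \<alpha> \<inter> nds \<beta> \<and> (\<exists>N'. N' \<noteq> N \<and> N' \<in> nds \<alpha> \<inter> nds \<beta>) \<and>
     (card (nds \<alpha>) = 2 \<or> card (nds \<beta>) = 2)"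

definition cone_pt :: "('l \<Rightarrow> real ^ 4) \<Rightarrow> 'n \<Rightarrow> real \<Rightarrow> 'l \<Rightarrow> 'l \<Rightarrow> real \<Rightarrow> real ^ 4" where
  "cone_pt g N s \<alpha> \<beta> \<mu> = (1 - s) *\<^sub>R npos (ty N) (ix N) + s *\<^sub>R ((1 - \<mu>) *\<^sub>R g \<alpha> + \<mu> *\<^sub>R g \<beta>)"

lemma lk_on_link:
  assumes g: "admissible g" and lk: "lk N \<alpha> \<beta>" and \<mu>: "0 \<le> \<mu>" "\<mu> \<le> 1"
  shows "on_link (ty N) (ix N) ((1 - \<mu>) *\<^sub>R g \<alpha> + \<mu> *\<^sub>R g \<beta>)"
proof -
  have ab: "\<alpha> \<in> S" "\<beta> \<in> S" "N \<in> nds \<alpha>" "N \<in> nds \<beta>" using lk by (auto simp: lk_def)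
  obtain N' where N': "N' \<noteq> N" "N' \<in> nds \<alpha>" "N' \<in> nds \<beta>" using lk by (auto simp: lk_def)
  have t': "ty N' \<noteq> ty N" using N' ab nds(3)[OF ab(1)] by (metis inj_onD)
  have h: "\<And>\<alpha> N u. \<alpha> \<in> S \<Longrightarrow> N \<in> nds \<alpha> \<Longrightarrow> height u (g \<alpha>) \<le> height (ty N) (g \<alpha>)"
    and sl: "\<And>\<alpha> N. \<alpha> \<in> S \<Longrightarrow> N \<in> nds \<alpha> \<Longrightarrow> ty N \<in> {RV, RE, RR} \<Longrightarrow> \<bar>slot (ty N) (g \<alpha>) + real (ix N)\<bar> < 1 / 2"
    using g by (auto simp: admissible_def)
  have eq: "height (ty N') (g \<alpha>) = height (ty N) (g \<alpha>)" "height (ty N') (g \<beta>) = height (ty N) (g \<beta>)"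
    using h ab N' by (meson order_antisym)+
  show ?thesis
    unfolding on_link_def height_add height_scale
  proof (intro conjI allI exI[of _ "ty N'"] impI)
    show "(1 - \<mu>) *\<^sub>R height u (g \<alpha>) + \<mu> *\<^sub>R height u (g \<beta>) \<le> (1 - \<mu>) *\<^sub>R height (ty N) (g \<alpha>) + \<mu> *\<^sub>R height (ty N) (g \<beta>)" for u
      using h ab \<mu> by (intro add_mono scaleR_left_mono) auto
    assume t: "ty N \<in> {RV, RE, RR}"
    have a: "\<bar>slot (ty N) (g \<alpha>) + real (ix N)\<bar> < 1 / 2" "\<bar>slot (ty N) (g \<beta>) + real (ix N)\<bar> < 1 / 2"
      using sl ab t by blast+
    have "slot (ty N) ((1 - \<mu>) *\<^sub>R g \<alpha> + \<mu> *\<^sub>R g \<beta>) + real (ix N) =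
        (1 - \<mu>) * (slot (ty N) (g \<alpha>) + real (ix N)) + \<mu> * (slot (ty N) (g \<beta>) + real (ix N))"
      unfolding linear_add[OF linear_slot] linear_scale[OF linear_slot] real_scaleR_def by (simp add: algebra_simps)
    moreover have "\<bar>(1 - \<mu>) * x + \<mu> * y\<bar> < 1 / 2" if "\<bar>x\<bar> < 1/2" "\<bar>y\<bar> < 1/2" for x y :: real
    proof -
      have "\<bar>(1 - \<mu>) * x + \<mu> * y\<bar> \<le> (1 - \<mu>) * \<bar>x\<bar> + \<mu> * \<bar>y\<bar>"
        using \<mu> abs_triangle_ineq[of "(1 - \<mu>) * x" "\<mu> * y"] by (simp add: abs_mult)
      also have "\<dots> < 1 / 2" using that \<mu> by (intro convex_bound_lt) auto
      finally show ?thesis .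
    qed
    ultimately show "\<bar>slot (ty N) ((1 - \<mu>) *\<^sub>R g \<alpha> + \<mu> *\<^sub>R g \<beta>) + real (ix N)\<bar> < 1 / 2" using a by simp
  qed (use t' eq in simp_all)
qed

text \<open>\<open>cone_inj\<close> separates the rays and \<open>generic_edges\<close> their
  endpoints. At \<open>s = 1\<close> the node is lost because adjacent stars share the wall, at
  \<open>s = 0\<close> the ray is lost.\<close>

theorem cone_pt_inj:
  assumes g: "admissible g"
    and N: "N \<in> nodes" "s = 0 \<or> lk N \<alpha> \<beta>" and \<mu>: "0 \<le> \<mu>" "\<mu> \<le> 1"
    and N': "N' \<in> nodes" "s' = 0 \<or> lk N' \<alpha>' \<beta>'" and \<mu>': "0 \<le> \<mu>'" "\<mu>' \<le> 1"
    and s: "0 \<le> s" "s \<le> 1" "0 \<le> s'" "s' \<le> 1"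
    and eq: "cone_pt g N s \<alpha> \<beta> \<mu> = cone_pt g N' s' \<alpha>' \<beta>' \<mu>'"
  shows "s = s' \<and> (s \<noteq> 1 \<longrightarrow> N = N') \<and> (s \<noteq> 0 \<longrightarrow> wt \<alpha> \<beta> \<mu> = wt \<alpha>' \<beta>' \<mu>')"
proof -
  have ex: "\<exists>b. on_link (ty N) (ix N) b \<and> cone_pt g N s \<alpha> \<beta> \<mu> = (1 - s) *\<^sub>R npos (ty N) (ix N) + s *\<^sub>R b \<and>
      (s \<noteq> 0 \<longrightarrow> b = (1 - \<mu>) *\<^sub>R g \<alpha> + \<mu> *\<^sub>R g \<beta>)"
    if "N \<in> nodes" "s = 0 \<or> lk N \<alpha> \<beta>" "0 \<le> \<mu>" "\<mu> \<le> 1" for N s \<alpha> \<beta> \<mu>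
  proof (cases "s = 0")
    case True
    \<comment> \<open>Here \<open>\<alpha>\<close> and \<open>\<beta>\<close> need not be link
      vertices of \<open>N\<close>; an arbitrary point of its link replaces their
      combination.\<close>
    then show ?thesis using on_link_ex[OF ix(1)[OF that(1)], of "ty N"] by (auto simp: cone_pt_def)
  next
    case False
    then have "lk N \<alpha> \<beta>" using that(2) by simp
    then show ?thesis using lk_on_link[OF g _ that(3,4), of N] unfolding cone_pt_def
      by (intro exI[of _ "(1 - \<mu>) *\<^sub>R g \<alpha> + \<mu> *\<^sub>R g \<beta>"]) simp
  qed
  obtain b where b0: "on_link (ty N) (ix N) b \<and> cone_pt g N s \<alpha> \<beta> \<mu> = (1 - s) *\<^sub>R npos (ty N) (ix N) + s *\<^sub>R b \<and>
      (s \<noteq> 0 \<longrightarrow> b = (1 - \<mu>) *\<^sub>R g \<alpha> + \<mu> *\<^sub>R g \<beta>)" using ex[OF N \<mu>] ..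
  then have b: "on_link (ty N) (ix N) b"
    "cone_pt g N s \<alpha> \<beta> \<mu> = (1 - s) *\<^sub>R npos (ty N) (ix N) + s *\<^sub>R b"
    "s \<noteq> 0 \<Longrightarrow> b = (1 - \<mu>) *\<^sub>R g \<alpha> + \<mu> *\<^sub>R g \<beta>" by simp_all
  obtain b' where b0': "on_link (ty N') (ix N') b' \<and> cone_pt g N' s' \<alpha>' \<beta>' \<mu>' = (1 - s') *\<^sub>R npos (ty N') (ix N') + s' *\<^sub>R b' \<and>
      (s' \<noteq> 0 \<longrightarrow> b' = (1 - \<mu>') *\<^sub>R g \<alpha>' + \<mu>' *\<^sub>R g \<beta>')" using ex[OF N' \<mu>'] ..
  then have b': "on_link (ty N') (ix N') b'"
    "cone_pt g N' s' \<alpha>' \<beta>' \<mu>' = (1 - s') *\<^sub>R npos (ty N') (ix N') + s' *\<^sub>R b'"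
    "s' \<noteq> 0 \<Longrightarrow> b' = (1 - \<mu>') *\<^sub>R g \<alpha>' + \<mu>' *\<^sub>R g \<beta>'" by simp_all
  have nodes: "ty N = ty N' \<Longrightarrow> ix N \<noteq> ix N' \<Longrightarrow> ty N \<in> {RV, RE, RR}"
    using distinct[OF N(1) N'(1)] by (cases "N = N'") simp_all
  have c: "s = s' \<and> (s \<noteq> 1 \<longrightarrow> ty N = ty N' \<and> ix N = ix N') \<and> (s \<noteq> 0 \<longrightarrow> b = b')"
    by (rule cone_inj[OF b(1) b'(1) ix(1)[OF N(1)] ix(1)[OF N'(1)] nodes s])
       (use eq b(2) b'(2) in simp_all)
  have "wt \<alpha> \<beta> \<mu> = wt \<alpha>' \<beta>' \<mu>'" if "s \<noteq> 0"
  proof (rule generic_edges)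
    show "generic (\<lambda>\<alpha>. ty ` nds \<alpha>) g S" using g by (simp add: admissible_def)
    have l: "lk N \<alpha> \<beta>" "lk N' \<alpha>' \<beta>'" using N N' that c by auto
    then show "\<alpha> \<in> S" "\<beta> \<in> S" "\<alpha>' \<in> S" "\<beta>' \<in> S" by (auto simp: lk_def)
    then show "card (ty ` nds \<alpha>) = 2 \<or> card (ty ` nds \<beta>) = 2" "card (ty ` nds \<alpha>') = 2 \<or> card (ty ` nds \<beta>') = 2"
      using l by (auto simp: lk_def card_nds)
    show "(1 - \<mu>) *\<^sub>R g \<alpha> + \<mu> *\<^sub>R g \<beta> = (1 - \<mu>') *\<^sub>R g \<alpha>' + \<mu>' *\<^sub>R g \<beta>'"
      using b(3) b'(3) that c by simp
  qed
  moreover have "N = N'" if "s \<noteq> 1" proof (rule ccontr)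
    assume "N \<noteq> N'"
    with distinct[OF N(1) N'(1)] c that show False by simp
  qed
  ultimately show ?thesis using c by simp
qed

end

section \<open>Nodes and link vertices of a complex\<close>

datatype ('v, 'e, 'c) node = NV 'v | NE 'e | NR 'c nat

text \<open>
  \<open>HE e b\<close> lies on the edge \<open>e\<close>, near its source if \<open>b\<close> and near its target otherwise. The others lie
  inside the 2-cell \<open>c\<close>: \<open>Mid c j\<close> next to the middle of the \<open>j\<close>-th dart, \<open>Cor c j i y\<close> in the column
  over the corner before the \<open>j\<close>-th dart.
\<close>

datatype ('e, 'c) lvert = HE 'e bool | Mid 'c nat | Cor 'c nat nat nat

locale two_apex =
  fixes X :: "('v, 'e, 'c) complex2" and v w :: 'v
  assumes fin: "finite_complex2 X" and vw: "v \<in> verts X" "w \<in> verts X"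
    and inc: "\<And>c. c \<in> cells X \<Longrightarrow> incident X c v \<or> incident X c w"
begin

section \<open>The walk of a 2-cell, rotated to its apex\<close>

definition len :: "'c \<Rightarrow> nat" where "len c = length (walk X c)"

definition apex :: "'c \<Rightarrow> 'v" where "apex c = (if incident X c v then v else w)"

definition off :: "'c \<Rightarrow> nat" where
  "off c = (SOME j. j < len c \<and> dart_tail X (walk X c ! j) = apex c)"

text \<open>The walk of \<open>c\<close>, rotated so that it starts at the apex.\<close>

definition dt :: "'c \<Rightarrow> nat \<Rightarrow> 'e \<times> bool" where "dt c j = walk X c ! ((off c + j) mod len c)"

definition vx :: "'c \<Rightarrow> nat \<Rightarrow> 'v" where "vx c j = dart_tail X (dt c j)"

abbreviation ed :: "'c \<Rightarrow> nat \<Rightarrow> 'e" where "ed c j \<equiv> fst (dt c j)"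

definition st :: "'c \<Rightarrow> nat \<Rightarrow> ('e, 'c) lvert" where "st c j = HE (ed c j) (snd (dt c j))"
definition en :: "'c \<Rightarrow> nat \<Rightarrow> ('e, 'c) lvert" where "en c j = HE (ed c j) (\<not> snd (dt c j))"

lemma apex_cases: "apex c = v \<or> apex c = w"
  by (simp add: apex_def)

lemma apex_verts: "apex c \<in> verts X"
  using vw by (simp add: apex_def)

lemma apex_incident: "c \<in> cells X \<Longrightarrow> incident X c (apex c)"
  using inc by (auto simp: apex_def)

lemma is_walk_heads:
  "is_walk X u ds u' \<Longrightarrow> i < length ds \<Longrightarrow>
     dart_head X (ds ! i) = (if Suc i < length ds then dart_tail X (ds ! Suc i) else u')"
proof (induction ds arbitrary: u i)
  case (Cons d ds)
  show ?case
  proof (cases i)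
    case 0
    then show ?thesis using Cons.prems by (cases ds) auto
  next
    case (Suc k)
    then show ?thesis using Cons.IH[of "dart_head X d" k] Cons.prems by auto
  qed
qed simp

lemma is_walk_base: "is_walk X u ds u' \<Longrightarrow> ds \<noteq> [] \<Longrightarrow> dart_tail X (ds ! 0) = u"
  by (cases ds) auto

lemma walk_head:
  assumes "c \<in> cells X" "i < len c"
  shows "dart_head X (walk X c ! i) = dart_tail X (walk X c ! (Suc i mod len c))"
proof -
  have W: "is_walk X (base X c) (walk X c) (base X c)" using fin assms(1) by (simp add: finite_complex2_def)
  have ne: "walk X c \<noteq> []" using assms(2) by (auto simp: len_def)
  show ?thesis
  proof (cases "Suc i < len c")
    case True
    then show ?thesis using is_walk_heads[OF W, of i] assms(2) by (simp add: len_def)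
  next
    case False
    then have "Suc i = len c" using assms(2) by simp
    then show ?thesis using is_walk_heads[OF W, of i] is_walk_base[OF W ne] by (simp add: len_def)
  qed
qed

text \<open>An incident vertex is the base point or the head of a dart, hence the tail of the
  cyclically next dart.\<close>

lemma off:
  assumes c: "c \<in> cells X" and n: "0 < len c"
  shows "off c < len c" "dart_tail X (walk X c ! off c) = apex c"
proof -
  have W: "is_walk X (base X c) (walk X c) (base X c)" using fin c by (simp add: finite_complex2_def)
  have ne: "walk X c \<noteq> []" using n by (auto simp: len_def)
  have "\<exists>j. j < len c \<and> dart_tail X (walk X c ! j) = apex c"
  proof (cases "apex c = base X c")
    case True
    then show ?thesis using is_walk_base[OF W ne] n by (intro exI[of _ 0]) simp
  next
    case False
    then obtain d where "d \<in> set (walk X c)" "apex c = dart_head X d"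
      using apex_incident[OF c] by (auto simp: incident_def)
    then obtain i where "i < len c" "apex c = dart_head X (walk X c ! i)"
      by (auto simp: in_set_conv_nth len_def)
    then show ?thesis using walk_head[OF c, of i] n by (intro exI[of _ "Suc i mod len c"]) simp
  qed
  then have "off c < len c \<and> dart_tail X (walk X c ! off c) = apex c"
    unfolding off_def by (rule someI_ex)
  then show "off c < len c" "dart_tail X (walk X c ! off c) = apex c" by simp_all
qed

lemma vx_0: "c \<in> cells X \<Longrightarrow> 0 < len c \<Longrightarrow> vx c 0 = apex c"
  using off by (simp add: vx_def dt_def)

lemma vx_len: "c \<in> cells X \<Longrightarrow> 0 < len c \<Longrightarrow> vx c (len c) = apex c"
  using off by (simp add: vx_def dt_def)

lemma head_dt:
  assumes "c \<in> cells X" "0 < len c"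
  shows "dart_head X (dt c j) = vx c (Suc j)"
  using walk_head[OF assms(1), of "(off c + j) mod len c"] assms(2)
  by (simp add: dt_def vx_def mod_Suc_eq)

lemma ed_edges:
  assumes "c \<in> cells X" "0 < len c"
  shows "ed c j \<in> edges X"
proof -
  have W: "is_walk X (base X c) (walk X c) (base X c)" using fin assms(1) by (simp add: finite_complex2_def)
  have "dt c j \<in> set (walk X c)" using assms(2) by (simp add: dt_def len_def)
  then show ?thesis using is_walk_edges[OF W] by blast
qed

lemma dart_tail_verts: "e \<in> edges X \<Longrightarrow> dart_tail X (e, b) \<in> verts X"
  using fin by (simp add: finite_complex2_def dart_tail_def)

lemma vx_verts: "c \<in> cells X \<Longrightarrow> 0 < len c \<Longrightarrow> vx c j \<in> verts X"
  using dart_tail_verts[OF ed_edges, of c j "snd (dt c j)"] by (simp add: vx_def)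

section \<open>Types, indices and incidences of the nodes\<close>

fun nty :: "('v, 'e, 'c) node \<Rightarrow> region" where
  "nty (NV x) = (if x = v then RA else if x = w then RW else RV)"
| "nty (NE e) = RE"
| "nty (NR c j) = RR"

definition corner_edge :: "'c \<Rightarrow> nat \<Rightarrow> nat \<Rightarrow> 'e" where
  "corner_edge c j i = (if i = 0 then ed c (j - 1) else ed c j)"

text \<open>Lists the stars that meet at the vertex. If \<open>len c = 0\<close>, the
  \<open>Cor\<close> vertices form the equator of a sphere with poles at the apex and at
  \<open>NR c 0\<close>. Otherwise \<open>i = 1\<close> is the midpoint of a horizontal side, and at
  a return to the apex \<open>y = 2\<close> is the midpoint of a vertical side of the auxiliary
  disk.\<close>

fun nds :: "('e, 'c) lvert \<Rightarrow> ('v, 'e, 'c) node set" where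
  "nds (HE e b) = {NV (dart_tail X (e, b)), NE e}"
| "nds (Mid c j) = {NV (apex c), NE (ed c j)}"
| "nds (Cor c j i y) =
     (if len c = 0 then {NV (apex c), NR c 0}
      else if vx c j = apex c then
        (if i = 1 then {NV (apex c), NR c j}
         else if y = 2 then {NE (corner_edge c j i), NR c j}
         else {NV (apex c), NE (corner_edge c j i), NR c j})
      else
        (if i = 1 then {NV (vx c j), NV (apex c)}
         else if y = 3 then {NV (vx c j), NE (corner_edge c j i), NV (apex c)}
         else {NV (vx c j), NE (corner_edge c j i)}))"

definition LV :: "('e, 'c) lvert set" where
  "LV = (\<lambda>(e, b). HE e b) ` (edges X \<times> UNIV) \<union> (\<lambda>(c, j). Mid c j) ` (SIGMA c:cells X. {..<len c})
     \<union> (\<lambda>(c, j, i, y). Cor c j i y) ` (SIGMA c:cells X. {..len c} \<times> {..3} \<times> {..3})"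

definition corners :: "('c \<times> nat) set" where
  "corners = (SIGMA c:cells X. {..len c})"

definition nodes :: "('v, 'e, 'c) node set" where
  "nodes = NV ` verts X \<union> NE ` edges X \<union> (\<lambda>(c, j). NR c j) ` corners"

text \<open>The shift puts the indices of \<open>NE\<close> nodes above
  \<open>Suc (card corners)\<close>, which serves as \<open>bound\<close>; those of
  \<open>NR\<close> nodes do not exceed it.\<close>

fun nix :: "('v, 'e, 'c) node \<Rightarrow> nat" where
  "nix (NV x) = Suc (to_nat_on (verts X) x)"
| "nix (NE e) = Suc (Suc (card corners) + to_nat_on (edges X) e)"
| "nix (NR c j) = Suc (to_nat_on corners (c, j))"

lemma finite_sets: "finite (verts X)" "finite (edges X)" "finite (cells X)" "finite corners" "finite LV"
  using fin by (auto simp: finite_complex2_def corners_def LV_def)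

lemma in_LV [simp]:
  "HE e b \<in> LV \<longleftrightarrow> e \<in> edges X"
  "Mid c j \<in> LV \<longleftrightarrow> c \<in> cells X \<and> j < len c"
  "Cor c j i y \<in> LV \<longleftrightarrow> c \<in> cells X \<and> j \<le> len c \<and> i \<le> 3 \<and> y \<le> 3"
  by (auto simp: LV_def image_iff)

lemma in_nodes [simp]:
  "NV x \<in> nodes \<longleftrightarrow> x \<in> verts X" "NE e \<in> nodes \<longleftrightarrow> e \<in> edges X"
  "NR c j \<in> nodes \<longleftrightarrow> c \<in> cells X \<and> j \<le> len c"
  by (auto simp: nodes_def corners_def image_iff)

lemma nty_apex: "nty (NV (apex c)) = RA \<or> nty (NV (apex c)) = RW"
  using apex_cases[of c] by auto

lemma nty_NV: "nty (NV x) = RV \<or> nty (NV x) = RA \<or> nty (NV x) = RW"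
  by simp

lemma nty_apex_neq: "x \<noteq> apex c \<Longrightarrow> nty (NV x) \<noteq> nty (NV (apex c))"
  using apex_cases[of c] by auto

lemma nty_NV_RE: "nty (NV x) \<noteq> RE" "nty (NV x) \<noteq> RR"
  by simp_all

lemma walls_intro:
  "t = RV \<or> t = RA \<or> t = RW \<Longrightarrow> {t, RE} \<in> walls"
  "a = RA \<or> a = RW \<Longrightarrow> {a, RR} \<in> walls"
  "{RE, RR} \<in> walls"
  "a = RA \<or> a = RW \<Longrightarrow> {a, RE, RR} \<in> walls"
  "a = RA \<or> a = RW \<Longrightarrow> t = RV \<or> t = RA \<or> t = RW \<Longrightarrow> t \<noteq> a \<Longrightarrow> {t, a} \<in> walls"
  "a = RA \<or> a = RW \<Longrightarrow> t = RV \<or> t = RA \<or> t = RW \<Longrightarrow> t \<noteq> a \<Longrightarrow> {t, RE, a} \<in> walls"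
  by ((elim disjE)?; simp add: walls_def insert_commute)+

lemmas walls_NV = walls_intro(1)[OF nty_NV] walls_intro(2)[OF nty_apex] walls_intro(3)
  walls_intro(4)[OF nty_apex] walls_intro(5,6)[OF nty_apex nty_NV nty_apex_neq]

text \<open>\<open>v\<close> and \<open>w\<close> have types of their own, so two vertices of the
  same type are of type \<open>RV\<close>; within a type the enumerations are injective.\<close>

lemma nodes_distinct:
  assumes "N \<in> nodes" "N' \<in> nodes" "N \<noteq> N'" "nty N = nty N'"
  shows "nix N \<noteq> nix N' \<and> nty N \<in> {RV, RE, RR}"
proof -
  have inj: "inj_on (to_nat_on (verts X)) (verts X)" "inj_on (to_nat_on (edges X)) (edges X)"
      "inj_on (to_nat_on corners) corners"
    using finite_sets by (auto intro!: inj_on_to_nat_on countable_finite)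
  note d = inj_onD[OF inj(1)] inj_onD[OF inj(2)] inj_onD[OF inj(3)]
  show ?thesis
  proof (cases N)
    case (NV x)
    then obtain x' where x': "N' = NV x'" using assms(4) by (cases N') (simp_all split: if_splits)
    have "to_nat_on (verts X) x \<noteq> to_nat_on (verts X) x'" using assms(1-3) d(1)[of x x'] NV x' by auto
    moreover have "nty N = RV" using assms(3,4) NV x' by (simp split: if_splits)
    ultimately show ?thesis using NV x' by simp
  next
    case (NE e)
    then obtain e' where e': "N' = NE e'" using assms(4) by (cases N') (simp_all split: if_splits)
    have "to_nat_on (edges X) e \<noteq> to_nat_on (edges X) e'" using assms(1-3) d(2)[of e e'] NE e' by auto
    then show ?thesis using NE e' by simp
  next
    case (NR c j)
    then obtain c' j' where c': "N' = NR c' j'" using assms(4) by (cases N') (simp_all split: if_splits)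
    have "to_nat_on corners (c, j) \<noteq> to_nat_on corners (c', j')"
      using assms(1-3) d(3)[of "(c, j)" "(c', j')"] NR c' by (auto simp: corners_def)
    then show ?thesis using NR c' by simp
  qed
qed

sublocale arrangement LV nds nty nix nodes "Suc (card corners)"
proof
  show "finite LV" by (rule finite_sets)
  show "nds \<alpha> \<subseteq> nodes" if \<alpha>: "\<alpha> \<in> LV" for \<alpha>
    using \<alpha> by (cases \<alpha>) (auto simp: dart_tail_verts apex_verts ed_edges vx_verts corner_edge_def)
  show "nty ` nds \<alpha> \<in> walls" if \<alpha>: "\<alpha> \<in> LV" for \<alpha>
    using walls_NV by (cases \<alpha>) (simp_all del: nty.simps(1))
  show "inj_on nty (nds \<alpha>)" if \<alpha>: "\<alpha> \<in> LV" for \<alpha>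
  proof -
    note n = nty_NV_RE nty_NV_RE[symmetric] nty_apex_neq nty_apex_neq[symmetric]
    show ?thesis by (cases \<alpha>) (simp_all add: inj_on_insert n del: nty.simps(1))
  qed
  show "1 \<le> nix N" if "N \<in> nodes" for N by (cases N) auto
  show "Suc (card corners) < nix N" if "N \<in> nodes" "nty N = RE" for N
    using that by (cases N) (auto split: if_splits)
  show "nix N \<le> Suc (card corners)" if N: "N \<in> nodes" "nty N = RR" for N
  proof -
    obtain c j where cj: "N = NR c j" "(c, j) \<in> corners"
      using N by (cases N) (auto simp: corners_def split: if_splits)
    have "bij_betw (to_nat_on corners) corners {..<card corners}"
      using finite_sets(4) by (rule to_nat_on_finite)
    then have "to_nat_on corners (c, j) < card corners" using cj(2) bij_betwE by blast
    then show ?thesis using cj by simp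
  qed
  show "nix N \<noteq> nix N' \<and> nty N \<in> {RV, RE, RR}"
    if "N \<in> nodes" "N' \<in> nodes" "N \<noteq> N'" "nty N = nty N'" for N N'
    using nodes_distinct that .
qed simp

section \<open>The decomposition of a 2-cell\<close>

definition at_apex :: "'c \<Rightarrow> nat \<Rightarrow> bool" where "at_apex c j \<longleftrightarrow> vx c j = apex c"

text \<open>The height of the corner star. At a return to the apex it ends at 1 and leaves the
  heights from 1 to 3 to the auxiliary disk; elsewhere it reaches the apex star.\<close>

definition ht :: "'c \<Rightarrow> nat \<Rightarrow> nat" where "ht c j = (if at_apex c j then 1 else 3)"

end

text \<open>
  The regions of a 2-cell whose walk has length \<open>n > 0\<close>, drawn in the pentagon with vertices
  \<open>(2,0)\<close>, \<open>(4n-2,0)\<close>, \<open>(4n-1,3)\<close>, \<open>(2n,6)\<close>, \<open>(1,3)\<close>: \<open>GE j\<close> along the \<open>j\<close>-th dart, \<open>GC j\<close> at the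
  \<open>j\<close>-th corner, \<open>GM\<close> above height 3 with the apex at the top, and \<open>GR j\<close> between \<open>GC j\<close> and \<open>GM\<close> where
  the walk returns to the apex. Each is a cone with its node over lattice segments of four kinds.
\<close>

datatype reg = GE nat | GC nat | GR nat | GM
text \<open>\<open>TL j\<close> and \<open>TR j\<close> are the left and right half of the top of an
  edge star. \<open>SD j i y\<close> goes up, and \<open>HZ j y i\<close> to the right, from the
  lattice point that belongs to \<open>Cor c j i y\<close>.\<close>

datatype seg = TL nat | TR nat | SD nat nat nat | HZ nat nat nat

fun p0 :: "seg \<Rightarrow> real \<times> real" where
  "p0 (TL j) = (4 * real j + 1, 3)"
| "p0 (TR j) = (4 * real j + 2, 3)"
| "p0 (SD j i y) = (4 * real j - 1 + real i, real y)"
| "p0 (HZ j y i) = (4 * real j - 1 + real i, real y)"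

fun p1 :: "seg \<Rightarrow> real \<times> real" where
  "p1 (TL j) = (4 * real j + 2, 3)"
| "p1 (TR j) = (4 * real j + 3, 3)"
| "p1 (SD j i y) = (4 * real j - 1 + real i, real y + 1)"
| "p1 (HZ j y i) = (4 * real j + real i, real y)"

context two_apex
begin

text \<open>At the two outer ends of the walk \<open>GM\<close> itself is the corner star, so it
  meets the edge star in the link vertex on the edge.\<close>

definition top_left :: "'c \<Rightarrow> nat \<Rightarrow> ('e, 'c) lvert" where
  "top_left c j = (if j = 0 then st c 0 else Cor c j 2 3)"
definition top_right :: "'c \<Rightarrow> nat \<Rightarrow> ('e, 'c) lvert" where
  "top_right c j = (if Suc j = len c then en c j else Cor c (Suc j) 0 3)"
definition side :: "'c \<Rightarrow> nat \<Rightarrow> nat \<Rightarrow> nat \<Rightarrow> ('e, 'c) lvert" where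
  "side c j i y = (if y = 0 then if i = 0 then en c (j - 1) else st c j else Cor c j i y)"

fun e0 :: "'c \<Rightarrow> seg \<Rightarrow> ('e, 'c) lvert" where
  "e0 c (TL j) = top_left c j"
| "e0 c (TR j) = Mid c j"
| "e0 c (SD j i y) = side c j i y"
| "e0 c (HZ j y i) = Cor c j i y"

fun e1 :: "'c \<Rightarrow> seg \<Rightarrow> ('e, 'c) lvert" where
  "e1 c (TL j) = Mid c j"
| "e1 c (TR j) = top_right c j"
| "e1 c (SD j i y) = side c j i (Suc y)"
| "e1 c (HZ j y i) = Cor c j (Suc i) y"

fun rim :: "'c \<Rightarrow> reg \<Rightarrow> seg set" where
  "rim c (GE j) = (if j < len c then {TL j, TR j} \<union> (if 1 \<le> j then {SD j 2 0, SD j 2 1, SD j 2 2} else {})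
     \<union> (if Suc j < len c then {SD (Suc j) 0 0, SD (Suc j) 0 1, SD (Suc j) 0 2} else {}) else {})"
| "rim c (GC j) = (if 1 \<le> j \<and> j < len c then
      (if at_apex c j then {SD j 0 0, SD j 2 0, HZ j 1 0, HZ j 1 1}
       else {SD j 0 0, SD j 0 1, SD j 0 2, SD j 2 0, SD j 2 1, SD j 2 2, HZ j 3 0, HZ j 3 1}) else {})"
| "rim c (GR j) = (if 1 \<le> j \<and> j < len c \<and> at_apex c j then
      {SD j 0 1, SD j 0 2, SD j 2 1, SD j 2 2, HZ j 1 0, HZ j 1 1, HZ j 3 0, HZ j 3 1} else {})"
| "rim c GM = TL ` {..<len c} \<union> TR ` {..<len c} \<union> (\<lambda>(j, i). HZ j 3 i) ` ({1..<len c} \<times> {0, 1})"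

fun lab :: "'c \<Rightarrow> reg \<Rightarrow> ('v, 'e, 'c) node" where
  "lab c (GE j) = NE (ed c j)"
| "lab c (GC j) = NV (vx c j)"
| "lab c (GR j) = NR c j"
| "lab c GM = NV (apex c)"

fun ctr :: "'c \<Rightarrow> reg \<Rightarrow> real \<times> real" where
  "ctr c (GE j) = (4 * real j + 2, 0)"
| "ctr c (GC j) = (4 * real j, 0)"
| "ctr c (GR j) = (4 * real j, 2)"
| "ctr c GM = (2 * real (len c), 6)"

lemma nds_st [simp]: "nds (st c j) = {NV (vx c j), NE (ed c j)}"
  by (simp add: st_def vx_def)

lemma dart_tail_flip: "dart_tail X (fst d, \<not> snd d) = dart_head X d"
  by (simp add: dart_tail_def dart_head_def)

lemma nds_en: "c \<in> cells X \<Longrightarrow> 0 < len c \<Longrightarrow> nds (en c j) = {NV (vx c (Suc j)), NE (ed c j)}"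
  using head_dt[of c j] by (simp add: en_def dart_tail_flip)

lemma lk_intro:
  assumes "\<alpha> \<in> LV" "\<beta> \<in> LV" "N \<in> nds \<alpha>" "N \<in> nds \<beta>" "N' \<in> nds \<alpha>" "N' \<in> nds \<beta>" "N' \<noteq> N"
    "card (nds \<alpha>) = 2 \<or> card (nds \<beta>) = 2"
  shows "lk N \<alpha> \<beta>"
  unfolding lk_def using assms by (intro conjI IntI exI[of _ N']) simp_all

lemma finite_rim: "finite (rim c k)"
  by (cases k) simp_all

lemma lab_nodes:
  assumes "c \<in> cells X" "rim c k \<noteq> {}"
  shows "lab c k \<in> nodes"
  using assms by (cases k) (auto simp: apex_verts intro!: ed_edges vx_verts split: if_splits)

text \<open>The second common node is that of the region on the other side of the segment, and the
  midpoints of the sides ensure that one end has only two nodes.\<close>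

lemma lk_rim:
  assumes c: "c \<in> cells X" and n: "0 < len c" and s: "s \<in> rim c k"
  shows "lk (lab c k) (e0 c s) (e1 c s)"
proof -
  note en = nds_en[OF c n]
  have LVs: "st c j \<in> LV" "en c j \<in> LV" for j using ed_edges[OF c n] by (simp_all add: st_def en_def)
  note d = top_left_def top_right_def side_def corner_edge_def ht_def at_apex_def LVs c n vx_0[OF c n] vx_len[OF c n] en
  show ?thesis
  proof (cases k)
    case (GE j)
    then have j: "j < len c" using s by (auto split: if_splits)
    consider "s = TL j" | "s = TR j" | y where "1 \<le> j" "s = SD j 2 y" "y \<in> {0,1,2}"
      | y where "Suc j < len c" "s = SD (Suc j) 0 y" "y \<in> {0,1,2}"
      using s GE j by (auto split: if_splits)
    then show ?thesis
    proof cases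
      case 1
      show ?thesis unfolding 1 GE using j by (intro lk_intro[where N' = "NV (apex c)"]) (simp_all add: d)
    next
      case 2
      show ?thesis unfolding 2 GE using j
        by (intro lk_intro[where N' = "NV (apex c)"]) (auto simp add: d)
    next
      case 3
      have "at_apex c j \<Longrightarrow> y \<noteq> 0 \<Longrightarrow> lk (lab c k) (e0 c s) (e1 c s)"
        unfolding 3 GE using j 3(3) by (intro lk_intro[where N' = "NR c j"]) (auto simp add: d)
      moreover have "\<not> at_apex c j \<or> y = 0 \<Longrightarrow> lk (lab c k) (e0 c s) (e1 c s)"
        unfolding 3 GE using j 3(1,3) by (intro lk_intro[where N' = "NV (vx c j)"]) (auto simp add: d)
      ultimately show ?thesis by blast
    next
      case 4
      have "at_apex c (Suc j) \<Longrightarrow> y \<noteq> 0 \<Longrightarrow> lk (lab c k) (e0 c s) (e1 c s)"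
        unfolding 4 GE using j 4(3) by (intro lk_intro[where N' = "NR c (Suc j)"]) (auto simp add: d)
      moreover have "\<not> at_apex c (Suc j) \<or> y = 0 \<Longrightarrow> lk (lab c k) (e0 c s) (e1 c s)"
        unfolding 4 GE using j 4(1,3) by (intro lk_intro[where N' = "NV (vx c (Suc j))"]) (auto simp add: d)
      ultimately show ?thesis by blast
    qed
  next
    case (GC j)
    then have j: "1 \<le> j" "j < len c" using s by (auto split: if_splits)
    consider i y where "s = SD j i y" "i \<in> {0, 2}" "y < 3" "at_apex c j \<longrightarrow> y = 0"
      | i where "s = HZ j (ht c j) i" "i \<in> {0, 1}"
      using s GC j by (auto simp: ht_def split: if_splits)
    then show ?thesis
    proof cases
      case 1
      show ?thesis unfolding 1 GC using j 1(2-4)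
        by (intro lk_intro[where N' = "NE (corner_edge c j i)"]) (auto simp add: d)
    next
      case 2
      have "at_apex c j \<Longrightarrow> lk (lab c k) (e0 c s) (e1 c s)"
        unfolding 2 GC using j 2(2) by (intro lk_intro[where N' = "NR c j"]) (auto simp add: d)
      moreover have "\<not> at_apex c j \<Longrightarrow> lk (lab c k) (e0 c s) (e1 c s)"
        unfolding 2 GC using j 2(2) by (intro lk_intro[where N' = "NV (apex c)"]) (auto simp add: d)
      ultimately show ?thesis by blast
    qed
  next
    case (GR j)
    then have j: "1 \<le> j" "j < len c" "at_apex c j" using s by (auto split: if_splits)
    consider i y where "s = SD j i y" "i \<in> {0, 2}" "y \<in> {1, 2}"
      | y i where "s = HZ j y i" "i \<in> {0, 1}" "y \<in> {1, 3}"
      using s GR j by auto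
    then show ?thesis
    proof cases
      case 1
      show ?thesis unfolding 1 GR using 1(2-3) j
        by (elim insertE emptyE; intro lk_intro[where N' = "NE (corner_edge c j i)"]; simp add: d)
    next
      case 2
      show ?thesis unfolding 2 GR using 2(2-3) j
        by (elim insertE emptyE; intro lk_intro[where N' = "NV (apex c)"]; simp add: d)
    qed
  next
    case GM
    then consider j where "s = TL j" "j < len c" | j where "s = TR j" "j < len c"
      | j i where "s = HZ j 3 i" "i \<in> {0, 1}" "1 \<le> j" "j < len c"
      using s by auto
    then show ?thesis
    proof cases
      case (1 j)
      show ?thesis unfolding 1 GM using 1(2)
        by (intro lk_intro[where N' = "NE (ed c j)"]) (simp_all add: d)
    next
      case (2 j)
      show ?thesis unfolding 2 GM using 2(2)
        by (intro lk_intro[where N' = "NE (ed c j)"]) (auto simp add: d)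
    next
      case (3 j i)
      have "at_apex c j \<Longrightarrow> lk (lab c k) (e0 c s) (e1 c s)"
        unfolding 3 GM using 3(2-4)
        by (elim insertE emptyE; intro lk_intro[where N' = "NR c j"]; simp add: d)
      moreover have "\<not> at_apex c j \<Longrightarrow> lk (lab c k) (e0 c s) (e1 c s)"
        unfolding 3 GM using 3(2-4)
        by (elim insertE emptyE; intro lk_intro[where N' = "NV (vx c j)"]; simp add: d)
      ultimately show ?thesis by blast
    qed
  qed
qed

end

definition bd :: "seg \<Rightarrow> real \<Rightarrow> real \<times> real" where
  "bd s \<mu> = (1 - \<mu>) *\<^sub>R p0 s + \<mu> *\<^sub>R p1 s"

lemma bd_simps [simp]:
  "bd (TL j) \<mu> = (4 * real j + 1 + \<mu>, 3)"
  "bd (TR j) \<mu> = (4 * real j + 2 + \<mu>, 3)"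
  "bd (SD j i y) \<mu> = (4 * real j - 1 + real i, real y + \<mu>)"
  "bd (HZ j y i) \<mu> = (4 * real j - 1 + real i + \<mu>, real y)"
  by (simp_all add: bd_def algebra_simps)

lemma nat_sep: "j \<noteq> j' \<Longrightarrow> real j + 1 \<le> real j' \<or> real j' + 1 \<le> real j"
  by linarith

lemma max_scale: "0 \<le> r \<Longrightarrow> max (r * a) (r * b) = r * max a (b::real)"
  by (simp add: max_mult_distrib_left)

fun is_HE :: "('e, 'c) lvert \<Rightarrow> bool" where
  "is_HE (HE e b) = True" | "is_HE _ = False"

text \<open>Vertices on edges receive a dummy value: an edge may be traversed repeatedly, so they
  have no single position in the pentagon.\<close>

fun plane :: "('e, 'c) lvert \<Rightarrow> real \<times> real" where
  "plane (Mid c j) = (4 * real j + 2, 3)"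
| "plane (Cor c j i y) = (4 * real j - 1 + real i, real y)"
| "plane (HE e b) = (0, 0)"

context two_apex
begin

text \<open>Minkowski functionals centred at the nodes and equal to 1 on the rims; they read the ray
  parameter off a point.\<close>

fun gauge :: "'c \<Rightarrow> reg \<Rightarrow> real \<times> real \<Rightarrow> real" where
  "gauge c (GE j) d = max \<bar>fst d\<bar> (\<bar>snd d\<bar> / 3)"
| "gauge c (GC j) d = max \<bar>fst d\<bar> (\<bar>snd d\<bar> / ht c j)"
| "gauge c (GR j) d = max \<bar>fst d\<bar> \<bar>snd d\<bar>"
| "gauge c GM d = - snd d / 3"

fun zone :: "'c \<Rightarrow> reg \<Rightarrow> real \<times> real \<Rightarrow> bool" where
  "zone c (GE j) q \<longleftrightarrow> \<bar>fst q - (4 * j + 2)\<bar> \<le> 1 \<and> 0 \<le> snd q \<and> snd q \<le> 3"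
| "zone c (GC j) q \<longleftrightarrow> \<bar>fst q - 4 * j\<bar> \<le> 1 \<and> 0 \<le> snd q \<and> snd q \<le> ht c j"
| "zone c (GR j) q \<longleftrightarrow> \<bar>fst q - 4 * j\<bar> \<le> 1 \<and> 1 \<le> snd q \<and> snd q \<le> 3 \<and> at_apex c j"
| "zone c GM q \<longleftrightarrow> 3 \<le> snd q \<and> snd q \<le> 6"

definition rep :: "'c \<Rightarrow> real \<times> real \<Rightarrow> reg \<Rightarrow> seg \<Rightarrow> real \<Rightarrow> real \<Rightarrow> bool" where
  "rep c q k s r \<mu> \<longleftrightarrow> s \<in> rim c k \<and> 0 \<le> r \<and> r \<le> 1 \<and> 0 \<le> \<mu> \<and> \<mu> \<le> 1 \<and>
     q = ctr c k + r *\<^sub>R (bd s \<mu> - ctr c k)"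

section \<open>Uniqueness of the representation by a region and a ray\<close>

lemma rim_cases:
  assumes "s \<in> rim c k"
  obtains (TL) j where "s = TL j" "j < len c" "k = GE j \<or> k = GM"
  | (TR) j where "s = TR j" "j < len c" "k = GE j \<or> k = GM"
  | (SD) j i y where "s = SD j i y" "1 \<le> j" "j < len c" "i = 0 \<or> i = 2" "y = 0 \<or> y = 1 \<or> y = 2"
      "i = 0 \<and> k = GE (j - 1) \<or> i = 2 \<and> k = GE j \<or> k = GC j \<and> y < ht c j \<or> k = GR j \<and> 1 \<le> y \<and> at_apex c j"
  | (HZ) j y i where "s = HZ j y i" "1 \<le> j" "j < len c" "i = 0 \<or> i = 1"
      "y = 3 \<and> k = GM \<or> y = ht c j \<and> k = GC j \<or> (y = 1 \<or> y = 3) \<and> k = GR j \<and> at_apex c j"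
proof (cases k)
  case (GE j)
  show ?thesis using assms SD[of j 2] SD[of "Suc j" 0] TL TR unfolding GE by (auto split: if_splits)
next
  case (GC j)
  show ?thesis using assms SD HZ unfolding GC by (auto simp: ht_def split: if_splits)
next
  case (GR j)
  show ?thesis using assms SD HZ unfolding GR by (auto split: if_splits)
next
  case GM
  show ?thesis using assms TL TR HZ unfolding GM by auto
qed

lemma ht_cases: "ht c j = 1 \<and> at_apex c j \<or> ht c j = 3 \<and> \<not> at_apex c j"
  by (simp add: ht_def)

lemma gauge_rim:
  assumes s: "s \<in> rim c k" and \<mu>: "0 \<le> \<mu>" "\<mu> \<le> 1"
  shows "gauge c k (bd s \<mu> - ctr c k) = 1"
  using s
proof (cases rule: rim_cases)
  case (TL j)
  then show ?thesis using \<mu> by auto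
next
  case (TR j)
  then show ?thesis using \<mu> by auto
next
  case (SD j i y)
  have "real (j - 1) = real j - 1" using SD(2) by simp
  then show ?thesis using \<mu> SD ht_cases[of c j] by (elim disjE conjE) (simp_all add: max_def)
next
  case (HZ j y i)
  then show ?thesis using \<mu> ht_cases[of c j] by (elim disjE conjE) (simp_all add: max_def)
qed

lemma zone_rim:
  assumes s: "s \<in> rim c k" and \<mu>: "0 \<le> \<mu>" "\<mu> \<le> 1"
  shows "zone c k (bd s \<mu>)" "zone c k (ctr c k)"
proof -
  show "zone c k (bd s \<mu>)"
    using s
  proof (cases rule: rim_cases)
    case (TL j)
    then show ?thesis using \<mu> by auto
  next
    case (TR j)
    then show ?thesis using \<mu> by auto
  next
    case (SD j i y)
    have "real (j - 1) = real j - 1" using SD(2) by simp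
    then show ?thesis using \<mu> SD ht_cases[of c j] by (elim disjE conjE) simp_all
  next
    case (HZ j y i)
    then show ?thesis using \<mu> ht_cases[of c j] by (elim disjE conjE) simp_all
  qed
  show "zone c k (ctr c k)"
    using s by (cases k) (simp_all split: if_splits)
qed

lemma zone_convex:
  assumes "zone c k a" "zone c k b" "0 \<le> r" "r \<le> 1"
  shows "zone c k (a + r *\<^sub>R (b - a))"
proof -
  have le: "x + r * (y - x) \<le> m" if "x \<le> m" "y \<le> m" for x y m :: real
    using convex_bound_le[of x m y "1 - r" r] that assms(3,4) by (simp add: algebra_simps)
  have ge: "m \<le> x + r * (y - x)" if "m \<le> x" "m \<le> y" for x y m :: real
    using le[of "-x" "-m" "-y"] that by (simp add: algebra_simps)
  have ab: "\<bar>x + r * (y - x) - m\<bar> \<le> l" if "\<bar>x - m\<bar> \<le> l" "\<bar>y - m\<bar> \<le> l" for x y m l :: real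
    using le[of x "m + l" y] ge[of "m - l" x y] that by linarith
  show ?thesis
    using assms(1,2) by (cases k) (simp_all add: ab le ge)
qed

lemma gauge_scale: "0 \<le> r \<Longrightarrow> gauge c k (r *\<^sub>R d) = r * gauge c k d"
  by (cases k) (simp_all add: abs_mult max_scale[symmetric])

lemma gauge_rep: "rep c q k s r \<mu> \<Longrightarrow> gauge c k (q - ctr c k) = r"
  by (simp add: rep_def gauge_scale gauge_rim)

lemma zone_rep: "rep c q k s r \<mu> \<Longrightarrow> zone c k q"
  unfolding rep_def by (elim conjE, hypsubst, rule zone_convex) (simp_all add: zone_rim)

lemma nat_sep2: "real i + 1 \<le> real j \<or> real j \<le> real i"
  by (cases "i < j") auto

text \<open>Zones of different columns meet only along vertical sides, stacked ones only along a
  horizontal line, and there the gauge has reached 1.\<close>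

lemma zones_overlap:
  assumes "zone c k q" "zone c k' q" "k \<noteq> k'" shows "1 \<le> gauge c k (q - ctr c k)"
proof -
  obtain x y where q: "q = (x, y)" by (cases q)
  show ?thesis
  proof (cases k)
    case (GE i)
    then have i: "\<bar>x - (4 * real i + 2)\<bar> \<le> 1" using assms(1) by (simp add: q add.commute)
    have "1 \<le> \<bar>x - (4 * real i + 2)\<bar> \<or> 3 \<le> y"
    proof (cases k')
      case (GE j)
      then show ?thesis using assms(2,3) \<open>k = GE i\<close> i nat_sep[of i j] by (simp add: q) linarith
    next
      case (GC j)
      then show ?thesis using assms(2) i nat_sep2[of i j] by (simp add: q) linarith
    next
      case (GR j)
      then show ?thesis using assms(2) i nat_sep2[of i j] by (simp add: q) linarith
    qed (use assms(2) in \<open>simp add: q\<close>)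
    then show ?thesis unfolding GE by (auto simp: q le_max_iff_disj)
  next
    case (GC i)
    then have i: "\<bar>x - 4 * real i\<bar> \<le> 1" "y \<le> ht c i" using assms(1) by (simp_all add: q)
    have "1 \<le> \<bar>x - 4 * real i\<bar> \<or> ht c i \<le> y"
    proof (cases k')
      case (GE j)
      then show ?thesis using assms(2) i(1) nat_sep2[of j i] by (simp add: q) linarith
    next
      case (GC j)
      then show ?thesis using assms(2,3) \<open>k = GC i\<close> i(1) nat_sep[of i j] by (simp add: q) linarith
    next
      case (GR j)
      then have j: "\<bar>x - 4 * real j\<bar> \<le> 1" "1 \<le> y" "at_apex c j" using assms(2) by (simp_all add: q)
      show ?thesis
      proof (cases "i = j")
        case True
        then show ?thesis using j by (simp add: ht_def)
      next
        case False
        then show ?thesis using j(1) i(1) nat_sep[of i j] by linarith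
      qed
    next
      case GM
      then show ?thesis using assms(2) ht_cases[of c i] by (auto simp: q)
    qed
    then show ?thesis unfolding GC using ht_cases[of c i] by (auto simp: q le_max_iff_disj)
  next
    case (GR i)
    then have i: "\<bar>x - 4 * real i\<bar> \<le> 1" "1 \<le> y" "at_apex c i" using assms(1) by (simp_all add: q)
    have "1 \<le> \<bar>x - 4 * real i\<bar> \<or> y \<le> 1 \<or> 3 \<le> y"
    proof (cases k')
      case (GE j)
      then show ?thesis using assms(2) i(1) nat_sep2[of j i] by (simp add: q) linarith
    next
      case (GR j)
      then show ?thesis using assms(2,3) \<open>k = GR i\<close> i(1) nat_sep[of i j] by (simp add: q) linarith
    next
      case (GC j)
      then have j: "\<bar>x - 4 * real j\<bar> \<le> 1" "y \<le> ht c j" using assms(2) by (simp_all add: q)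
      show ?thesis
      proof (cases "i = j")
        case True
        then show ?thesis using j i(3) by (simp add: ht_def)
      next
        case False
        then show ?thesis using j(1) i(1) nat_sep[of i j] by linarith
      qed
    next
      case GM
      then show ?thesis using assms(2) by (simp add: q)
    qed
    then show ?thesis unfolding GR by (auto simp: q le_max_iff_disj)
  next
    case GM
    then have y: "3 \<le> y" using assms(1) by (simp add: q)
    have "y \<le> 3"
    proof (cases k')
      case (GC j)
      then show ?thesis using assms(2) ht_cases[of c j] by (auto simp: q)
    qed (use assms(2,3) GM in \<open>simp_all add: q\<close>)
    then show ?thesis unfolding GM by (simp add: q)
  qed
qed

text \<open>The critical case is a corner at the apex against \<open>GM\<close>: its star ends at
  height 1, below the auxiliary disk. Other coincidences of nodes come from a vertex or an edge
  repeated along the walk, whose columns are disjoint.\<close>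

lemma zones_lab:
  assumes "zone c k q" "zone c k' q" "k \<noteq> k'" shows "lab c k \<noteq> lab c k'"
proof
  assume eq: "lab c k = lab c k'"
  obtain x y where q: "q = (x, y)" by (cases q)
  have GM: "\<not> (zone c (GC i) q \<and> zone c GM q \<and> vx c i = apex c)" for i
    by (simp add: q ht_def at_apex_def)
  have GC: "\<not> (zone c (GC i) q \<and> zone c (GC j) q)" "\<not> (zone c (GE i) q \<and> zone c (GE j) q)" if "i \<noteq> j" for i j
    using nat_sep[OF that] by (simp_all add: q) linarith+
  from eq assms(3) consider i j where "k = GE i" "k' = GE j" "i \<noteq> j" | i j where "k = GC i" "k' = GC j" "i \<noteq> j"
    | i where "k = GC i" "k' = GM" "vx c i = apex c" | i where "k' = GC i" "k = GM" "vx c i = apex c"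
    by (cases k; cases k') simp_all
  then show False
  proof cases
    case 1
    then show ?thesis using assms(1,2) GC by blast
  next
    case 2
    then show ?thesis using assms(1,2) GC by blast
  qed (use assms(1,2) GM in blast)+
qed

lemma rep_unique:
  assumes "rep c q k s r \<mu>" "rep c q k' s' r' \<mu>'"
  shows "r = r' \<and> (r \<noteq> 1 \<longrightarrow> k = k') \<and> (r \<noteq> 0 \<longrightarrow> bd s \<mu> = bd s' \<mu>')"
proof (cases "k = k'")
  case True
  then have "r = r'" using gauge_rep assms by metis
  moreover have "r *\<^sub>R (bd s \<mu> - ctr c k) = r' *\<^sub>R (bd s' \<mu>' - ctr c k)"
    using assms True by (simp add: rep_def)
  ultimately show ?thesis using True by auto
next
  case False
  then have "1 \<le> r" "1 \<le> r'"
    using zones_overlap[OF zone_rep[OF assms(1)] zone_rep[OF assms(2)] False] gauge_rep[OF assms(1)]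
      zones_overlap[OF zone_rep[OF assms(2)] zone_rep[OF assms(1)] False[symmetric]] gauge_rep[OF assms(2)]
    by simp_all
  then have "r = 1" "r' = 1" using assms by (simp_all add: rep_def)
  then show ?thesis using assms by (simp add: rep_def)
qed

text \<open>The link vertex at the lattice point \<open>(a, b)\<close>. With
  \<open>a + 1 = 4 * j + i\<close>, the values 0, 1, 2 of \<open>i\<close> are the columns over
  corner \<open>j\<close> and 3 is the middle of dart \<open>j\<close>.\<close>

definition lat :: "'c \<Rightarrow> nat \<Rightarrow> nat \<Rightarrow> ('e, 'c) lvert" where
  "lat c a b = (let j = (a + 1) div 4; i = (a + 1) mod 4 in
     if i = 3 then Mid c (a div 4)
     else if b = 0 then (if i = 0 then en c (j - 1) else st c j)
     else if b = 3 \<and> j = 0 then st c 0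
     else if b = 3 \<and> j = len c then en c (j - 1)
     else Cor c j i b)"

lemma lat_simps:
  "j < len c \<Longrightarrow> lat c (4 * j + 1) 3 = top_left c j"
  "lat c (4 * j + 2) b = Mid c j"
  "j < len c \<Longrightarrow> lat c (4 * j + 3) 3 = top_right c j"
  "1 \<le> j \<Longrightarrow> j < len c \<Longrightarrow> i = 0 \<or> i = 2 \<Longrightarrow> lat c (4 * j - 1 + i) b = side c j i b"
  "1 \<le> j \<Longrightarrow> j < len c \<Longrightarrow> i \<le> 2 \<Longrightarrow> 1 \<le> b \<Longrightarrow> lat c (4 * j - 1 + i) b = Cor c j i b"
proof -
  have dm: "(4 * j + i) div 4 = j" "(4 * j + i) mod 4 = i" if "i < 4" for i j :: nat
    using that by simp_all
  have dm3: "(4 * j + 4) div 4 = Suc j" "(4 * j + 4) mod 4 = 0" for j :: nat by simp_all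
  show "j < len c \<Longrightarrow> lat c (4 * j + 1) 3 = top_left c j"
    using dm[of 2 j] by (auto simp: lat_def top_left_def)
  show "lat c (4 * j + 2) b = Mid c j"
    using dm[of 3 j] dm[of 2 j] by (simp add: lat_def)
  show "j < len c \<Longrightarrow> lat c (4 * j + 3) 3 = top_right c j"
  proof -
    have s: "4 * j + 3 + 1 = 4 * j + 4" by simp
    show ?thesis
    proof (cases "Suc j = len c")
      case True
      show ?thesis unfolding lat_def s dm3 Let_def top_right_def by (simp add: True[symmetric])
    next
      case False
      then show ?thesis unfolding lat_def s dm3 Let_def top_right_def by simp
    qed
  qed
  assume j: "1 \<le> j" "j < len c"
  have s: "4 * j - 1 + i + 1 = 4 * j + i" for i using j by simp
  show "i = 0 \<or> i = 2 \<Longrightarrow> lat c (4 * j - 1 + i) b = side c j i b"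
    unfolding lat_def s using dm[of i j] j by (auto simp: side_def)
  show "i \<le> 2 \<Longrightarrow> 1 \<le> b \<Longrightarrow> lat c (4 * j - 1 + i) b = Cor c j i b"
    unfolding lat_def s using dm[of i j] j by auto
qed

text \<open>
  The coordinates of a point of the 1-skeleton in terms of link vertices, read off from the point
  alone: they do not depend on the segment that contains it.
\<close>

definition weight :: "'c \<Rightarrow> real \<times> real \<Rightarrow> ('e, 'c) lvert \<Rightarrow> real" where
  "weight c q \<kappa> = (let x = nat \<lfloor>fst q\<rfloor>; y = nat \<lfloor>snd q\<rfloor>; a = frac (fst q); b = frac (snd q) in
     (1 - a) * (1 - b) * of_bool (\<kappa> = lat c x y) + a * (1 - b) * of_bool (\<kappa> = lat c (x + 1) y)
       + (1 - a) * b * of_bool (\<kappa> = lat c x (y + 1)))"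

lemma floor_frac_add:
  assumes "0 \<le> \<mu>" "\<mu> < 1"
  shows "nat \<lfloor>real a + \<mu>\<rfloor> = a" "frac (real a + \<mu>) = \<mu>"
proof -
  have "\<lfloor>real a + \<mu>\<rfloor> = int a" using assms by (simp add: floor_eq_iff)
  then show "nat \<lfloor>real a + \<mu>\<rfloor> = a" "frac (real a + \<mu>) = \<mu>" by (simp_all add: frac_def)
qed

lemma frac_real: "frac (real b) = 0"
  by (simp add: frac_def)

lemma weight_lattice: "weight c (real a, real b) \<kappa> = of_bool (\<kappa> = lat c a b)"
  by (simp add: weight_def Let_def frac_real)

lemma weight_h:
  assumes "0 \<le> \<mu>" "\<mu> \<le> 1"
  shows "weight c (real a + \<mu>, real b) = wt (lat c a b) (lat c (a + 1) b) \<mu>"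
proof (cases "\<mu> = 1")
  case True
  have "real a + \<mu> = real (a + 1)" using True by simp
  then show ?thesis using True weight_lattice[of c "a + 1" b] by (simp only: fun_eq_iff wt_def) simp
next
  case False
  then have m: "0 \<le> \<mu>" "\<mu> < 1" using assms by simp_all
  show ?thesis unfolding weight_def fst_conv snd_conv floor_frac_add[OF m] Let_def frac_real
    by (simp add: fun_eq_iff wt_def)
qed

lemma weight_v:
  assumes "0 \<le> \<mu>" "\<mu> \<le> 1"
  shows "weight c (real a, real b + \<mu>) = wt (lat c a b) (lat c a (b + 1)) \<mu>"
proof (cases "\<mu> = 1")
  case True
  have "real b + \<mu> = real (b + 1)" using True by simp
  then show ?thesis using True weight_lattice[of c a "b + 1"] by (simp only: fun_eq_iff wt_def) simp
next
  case False
  then have m: "0 \<le> \<mu>" "\<mu> < 1" using assms by simp_all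
  show ?thesis unfolding weight_def fst_conv snd_conv floor_frac_add[OF m] Let_def frac_real
    by (simp add: fun_eq_iff wt_def)
qed

lemma weight_bd:
  assumes s: "s \<in> rim c k" and \<mu>: "0 \<le> \<mu>" "\<mu> \<le> 1"
  shows "weight c (bd s \<mu>) = wt (e0 c s) (e1 c s) \<mu>"
  using s
proof (cases rule: rim_cases)
  case (TL j)
  have "bd s \<mu> = (real (4 * j + 1) + \<mu>, real 3)" and s: "4 * j + 1 + 1 = 4 * j + 2" using TL(1) by simp_all
  then show ?thesis
    by (simp only: weight_h[OF \<mu>] s lat_simps(1)[OF TL(2)] lat_simps(2) TL(1) e0.simps e1.simps)
next
  case (TR j)
  have "bd s \<mu> = (real (4 * j + 2) + \<mu>, real 3)" and s: "4 * j + 2 + 1 = 4 * j + 3" using TR(1) by simp_all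
  then show ?thesis
    by (simp only: weight_h[OF \<mu>] s lat_simps(3)[OF TR(2)] lat_simps(2) TR(1) e0.simps e1.simps)
next
  case (SD j i y)
  have "bd s \<mu> = (real (4 * j - 1 + i), real y + \<mu>)" using SD(1,2) by (simp add: of_nat_diff)
  then show ?thesis
    by (simp only: weight_v[OF \<mu>] lat_simps(4)[OF SD(2,3,4)] SD(1) e0.simps e1.simps Suc_eq_plus1)
next
  case (HZ j y i)
  have y: "1 \<le> y" using HZ(5) ht_cases[of c j] by auto
  have i: "i \<le> 2" "Suc i \<le> 2" using HZ(4) by auto
  have "bd s \<mu> = (real (4 * j - 1 + i) + \<mu>, real y)" using HZ(1,2) by (simp add: of_nat_diff)
  moreover have "4 * j - 1 + i + 1 = 4 * j - 1 + Suc i" by simp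
  ultimately show ?thesis using weight_h[OF \<mu>, of c "4 * j - 1 + i" y] HZ(1)
    lat_simps(5)[OF HZ(2,3) i(1) y] lat_simps(5)[OF HZ(2,3) i(2) y]
    by (simp only: e0.simps e1.simps)
qed

section \<open>Recovering a rim point from its coordinates\<close>

lemma st_neq_en [simp]: "st c j \<noteq> en c j" "en c j \<noteq> st c j"
  by (auto simp: st_def en_def)

lemma is_HE_st_en [simp]: "is_HE (st c j)" "is_HE (en c j)"
  by (simp_all add: st_def en_def)

lemma HE_neq [simp]:
  "st c j \<noteq> Mid c' a" "en c j \<noteq> Mid c' a" "Mid c' a \<noteq> st c j" "Mid c' a \<noteq> en c j"
  "st c j \<noteq> Cor c' a i y" "en c j \<noteq> Cor c' a i y" "Cor c' a i y \<noteq> st c j" "Cor c' a i y \<noteq> en c j"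
  by (simp_all add: st_def en_def)

lemma plane_ends:
  assumes "s \<in> rim c k"
  shows "\<not> is_HE (e0 c s) \<Longrightarrow> p0 s = plane (e0 c s)" "\<not> is_HE (e1 c s) \<Longrightarrow> p1 s = plane (e1 c s)"
  using assms
  by (cases rule: rim_cases; auto simp: top_left_def top_right_def side_def split: if_splits)+

lemma ends_neq:
  assumes "s \<in> rim c k"
  shows "e0 c s \<noteq> e1 c s" "\<not> (is_HE (e0 c s) \<and> is_HE (e1 c s))"
  using assms
  by (cases rule: rim_cases; auto simp: top_left_def top_right_def side_def split: if_splits)+

lemma rim_forms:
  assumes "s \<in> rim c k"
  shows "(\<exists>j. s = TL j \<and> e0 c s = top_left c j \<and> e1 c s = Mid c j) \<or>
    (\<exists>j. s = TR j \<and> e0 c s = Mid c j \<and> e1 c s = top_right c j) \<or>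
    (\<exists>j i y. s = SD j i y \<and> e0 c s = side c j i y \<and> e1 c s = Cor c j i (Suc y)) \<or>
    (\<exists>j y i. s = HZ j y i \<and> e0 c s = Cor c j i y \<and> e1 c s = Cor c j (Suc i) y)"
  using assms by (cases rule: rim_cases) (simp_all add: side_def)

text \<open>Every segment has an end inside its cell, which carries cell and position; together with
  the other end it determines kind and orientation.\<close>

lemma seg_unique:
  assumes "s \<in> rim c k" "s' \<in> rim c' k'"
    and eq: "e0 c s = e0 c' s' \<and> e1 c s = e1 c' s' \<or> e0 c s = e1 c' s' \<and> e1 c s = e0 c' s'"
  shows "s = s' \<and> e0 c s = e0 c' s' \<and> e1 c s = e1 c' s'"
proof -
  note defs = top_left_def top_right_def side_def
  show ?thesis
    using rim_forms[OF assms(1)] rim_forms[OF assms(2)] eq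
    by (elim disjE exE conjE; simp add: defs split: if_splits)
qed

lemma wt_0: "\<kappa> \<noteq> \<alpha> \<Longrightarrow> \<kappa> \<noteq> \<beta> \<Longrightarrow> wt \<alpha> \<beta> \<mu> \<kappa> = 0"
  by (simp add: wt_def)

text \<open>If a vertex inside the cell has weight 1, the point is that vertex; if its weight is
  another nonzero number, both ends are known and \<open>seg_unique\<close> yields the segment.
  Vertices on edges alone would not do, since the walk may repeat an edge.\<close>

lemma bd_decode:
  assumes s: "s \<in> rim c k" "s' \<in> rim c k'"
    and eq: "wt (e0 c s) (e1 c s) \<mu> = wt (e0 c s') (e1 c s') \<mu>'"
    and \<kappa>: "\<not> is_HE \<kappa>" "wt (e0 c s) (e1 c s) \<mu> \<kappa> \<noteq> 0"
  shows "bd s \<mu> = bd s' \<mu>'"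
proof -
  have ends: "\<kappa> = e0 c s \<or> \<kappa> = e1 c s" "\<kappa> = e0 c s' \<or> \<kappa> = e1 c s'"
    using \<kappa>(2) eq by (metis wt_0)+
  have one: "bd t \<nu> = plane \<kappa>"
    if t: "t \<in> rim c m" "\<kappa> = e0 c t \<or> \<kappa> = e1 c t" "wt (e0 c t) (e1 c t) \<nu> \<kappa> = 1" for t m \<nu>
  proof (cases "\<kappa> = e0 c t")
    case True
    then have "\<nu> = 0" using ends_neq(1)[OF t(1)] t(3) by (simp add: wt_def)
    then show ?thesis using plane_ends(1)[OF t(1)] True \<kappa>(1) by (simp add: bd_def)
  next
    case False
    then have 1: "\<kappa> = e1 c t" using t(2) by simp
    then have "\<nu> = 1" using False t(3) by (simp add: wt_def)
    then show ?thesis using plane_ends(2)[OF t(1)] 1 \<kappa>(1) by (simp add: bd_def)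
  qed
  show ?thesis
  proof (cases "wt (e0 c s) (e1 c s) \<mu> \<kappa> = 1")
    case True
    then show ?thesis using one[OF s(1) ends(1)] one[OF s(2) ends(2)] eq by simp
  next
    case False
    obtain \<rho> where l: "\<rho> \<noteq> \<kappa>" "wt (e0 c s) (e1 c s) \<mu> \<rho> \<noteq> 0" "\<rho> = e0 c s \<or> \<rho> = e1 c s"
    proof (cases "\<kappa> = e0 c s")
      case True
      with False ends_neq(1)[OF s(1)] show ?thesis by (intro that[of "e1 c s"]) (auto simp: wt_def)
    next
      case 2: False
      with ends have "\<kappa> = e1 c s" by simp
      with False ends_neq(1)[OF s(1)] show ?thesis by (intro that[of "e0 c s"]) (auto simp: wt_def)
    qed
    have l': "\<rho> = e0 c s' \<or> \<rho> = e1 c s'" using l(2) eq by (metis wt_0)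
    have "e0 c s = e0 c s' \<and> e1 c s = e1 c s' \<or> e0 c s = e1 c s' \<and> e1 c s = e0 c s'"
      using ends l(1,3) l' by metis
    from seg_unique[OF s this] have ss: "s = s'" by simp
    have "wt (e0 c s) (e1 c s) \<mu> (e1 c s) = \<mu>" "wt (e0 c s) (e1 c s) \<mu>' (e1 c s) = \<mu>'"
      using ends_neq(1)[OF s(1)] by (simp_all add: wt_def)
    then show ?thesis using eq ss by metis
  qed
qed

text \<open>The gauge of the pentagon with respect to its interior point \<open>mid c\<close>.\<close>

definition pent :: "'c \<Rightarrow> real \<times> real \<Rightarrow> real" where
  "pent c d = max (- snd d / 3) (max ((\<bar>fst d\<bar> - snd d / 3) / (2 * real (len c) - 1)) (snd d / 3 + \<bar>fst d\<bar> / (2 * real (len c) - 1)))"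

definition mid :: "'c \<Rightarrow> real \<times> real" where "mid c = (2 * len c, 3)"

lemma pent_scale: "0 \<le> r \<Longrightarrow> pent c (r *\<^sub>R d) = r * pent c d"
proof -
  assume r: "0 \<le> r"
  have "\<bar>fst (r *\<^sub>R d)\<bar> = r * \<bar>fst d\<bar>" using r by (simp add: abs_mult)
  moreover have "r * max a (max b e) = max (r * a) (max (r * b) (r * e))" for a b e
    using max_scale[OF r] by metis
  ultimately show ?thesis by (simp add: pent_def right_diff_distrib distrib_left add_divide_distrib diff_divide_distrib)
qed

lemma pent_lessD:
  assumes n: "0 < len c" and h: "pent c ((x, y) - mid c) < 1"
  shows "0 < y" "\<bar>x - 2 * len c\<bar> < 2 * real (len c) - 2 + y / 3"
    "\<bar>x - 2 * len c\<bar> < (2 * real (len c) - 1) * (6 - y) / 3"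
proof -
  have D: "0 < 2 * real (len c) - 1" using n by linarith
  show "0 < y" using h by (simp add: pent_def mid_def)
  have "(\<bar>x - 2 * len c\<bar> - (y - 3) / 3) / (2 * real (len c) - 1) < 1" using h by (simp add: pent_def mid_def)
  then show "\<bar>x - 2 * len c\<bar> < 2 * real (len c) - 2 + y / 3" using D by (simp add: divide_less_eq field_simps)
  have "(y - 3) / 3 + \<bar>x - 2 * len c\<bar> / (2 * real (len c) - 1) < 1" using h by (simp add: pent_def mid_def)
  moreover have "(y - 3) / 3 + A < 1 \<Longrightarrow> A < (6 - y) / 3" for A by (simp add: field_simps)
  ultimately have "\<bar>x - 2 * len c\<bar> / (2 * real (len c) - 1) < (6 - y) / 3" by blast
  then show "\<bar>x - 2 * len c\<bar> < (2 * real (len c) - 1) * (6 - y) / 3" using D by (simp add: divide_less_eq mult.commute)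
qed

lemma pent_leD:
  assumes n: "0 < len c" and h: "pent c ((x, y) - mid c) \<le> 1"
  shows "0 \<le> y" "\<bar>x - 2 * len c\<bar> \<le> 2 * real (len c) - 2 + y / 3"
    "\<bar>x - 2 * len c\<bar> \<le> (2 * real (len c) - 1) * ((6 - y) / 3)"
proof -
  have D: "0 < 2 * real (len c) - 1" using n by linarith
  show "0 \<le> y" using h by (simp add: pent_def mid_def)
  have "(\<bar>x - 2 * len c\<bar> - (y - 3) / 3) / (2 * real (len c) - 1) \<le> 1" using h by (simp add: pent_def mid_def)
  then show "\<bar>x - 2 * len c\<bar> \<le> 2 * real (len c) - 2 + y / 3" using D by (simp add: divide_le_eq field_simps)
  have "(y - 3) / 3 + \<bar>x - 2 * len c\<bar> / (2 * real (len c) - 1) \<le> 1" using h by (simp add: pent_def mid_def)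
  moreover have "(y - 3) / 3 + A \<le> 1 \<Longrightarrow> A \<le> (6 - y) / 3" for A by (simp add: field_simps)
  ultimately have "\<bar>x - 2 * len c\<bar> / (2 * real (len c) - 1) \<le> (6 - y) / 3" by blast
  then show "\<bar>x - 2 * len c\<bar> \<le> (2 * real (len c) - 1) * ((6 - y) / 3)" using D by (simp only: divide_le_eq mult.commute if_True)
qed

text \<open>A point in the open pentagon is not on the boundary graph of the 2-cell.\<close>

lemma interior_rep:
  assumes n: "0 < len c" and h: "pent c (q - mid c) < 1" and rep: "rep c q k s r \<mu>"
  shows "r = 0 \<Longrightarrow> \<exists>j. k = GR j"
    and "r \<noteq> 0 \<Longrightarrow> \<exists>\<kappa>. \<not> is_HE \<kappa> \<and> wt (e0 c s) (e1 c s) \<mu> \<kappa> \<noteq> 0"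
proof -
  obtain x y where q: "q = (x, y)" by (cases q)
  note H = pent_lessD[OF n h[unfolded q]]
  have s: "s \<in> rim c k" and eq: "q = ctr c k + r *\<^sub>R (bd s \<mu> - ctr c k)" using rep by (simp_all add: rep_def)
  show "\<exists>j. k = GR j" if "r = 0"
    using eq H that by (cases k) (simp_all add: q)
  show "\<exists>\<kappa>. \<not> is_HE \<kappa> \<and> wt (e0 c s) (e1 c s) \<mu> \<kappa> \<noteq> 0" if r: "r \<noteq> 0"
  proof (rule ccontr)
    assume "\<nexists>\<kappa>. \<not> is_HE \<kappa> \<and> wt (e0 c s) (e1 c s) \<mu> \<kappa> \<noteq> 0"
    then have z: "\<not> is_HE \<kappa> \<Longrightarrow> wt (e0 c s) (e1 c s) \<mu> \<kappa> = 0" for \<kappa> by blast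
    have w: "wt (e0 c s) (e1 c s) \<mu> (e0 c s) = 1 - \<mu>" "wt (e0 c s) (e1 c s) \<mu> (e1 c s) = \<mu>"
      using ends_neq(1)[OF s] by (simp_all add: wt_def)
    \<comment> \<open>With only edge vertices in the support, \<open>bd s \<mu>\<close> is an end
      lying on the boundary of the pentagon, and then so does \<open>q\<close>.\<close>
    have e: "is_HE (e0 c s) \<or> \<mu> = 1" "is_HE (e1 c s) \<or> \<mu> = 0"
      using z[of "e0 c s"] z[of "e1 c s"] w by auto
    show False
      using s
    proof (cases rule: rim_cases)
      case (TL j)
      then have m: "\<mu> = 0" "j = 0" using e by (auto simp: top_left_def split: if_splits)
      from TL(3) show False
      proof
        assume k: "k = GE j"
        have "x = 2 - r" "y = 3 * r" using eq m unfolding TL(1) k by (simp_all add: q)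
        then show False using H by linarith
      next
        assume k: "k = GM"
        have "x = 2 * len c + r * (1 - 2 * real (len c))" "y = 6 - 3 * r" using eq m unfolding TL(1) k by (simp_all add: q)
        then have d: "\<bar>x - 2 * real (len c)\<bar> = \<bar>r * (2 * real (len c) - 1)\<bar>" "(6 - y) / 3 = r"
          by (simp_all add: abs_if algebra_simps)
        have "\<bar>x - 2 * len c\<bar> = r * (2 * real (len c) - 1)"
          using n rep d(1) by (simp add: abs_mult rep_def)
        then show False using H(3) d(2) by (simp add: mult.commute)
      qed
    next
      case (TR j)
      then have m: "\<mu> = 1" "Suc j = len c" using e by (auto simp: top_right_def split: if_splits)
      then have j: "real j = real (len c) - 1" by linarith
      from TR(3) show False
      proof
        assume k: "k = GE j"
        have "x = 4 * len c - 2 + r" "y = 3 * r" using eq m j unfolding TR(1) k by (simp_all add: q)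
        then show False using H by linarith
      next
        assume k: "k = GM"
        have "x = 2 * len c + r * (2 * real (len c) - 1)" "y = 6 - 3 * r" using eq m j unfolding TR(1) k by (simp_all add: q)
        then have d: "\<bar>x - 2 * real (len c)\<bar> = \<bar>r * (2 * real (len c) - 1)\<bar>" "(6 - y) / 3 = r"
          by (simp_all add: abs_if algebra_simps)
        have "\<bar>x - 2 * len c\<bar> = r * (2 * real (len c) - 1)"
          using n rep d(1) by (simp add: abs_mult rep_def)
        then show False using H(3) d(2) by (simp add: mult.commute)
      qed
    next
      case (SD j i y')
      then have "\<mu> = 0" "y' = 0" using e by (auto simp: side_def split: if_splits)
      then have "snd q = 0" using eq SD by auto
      then show False using H(1) by (simp add: q)
    next
      case (HZ j y' i)
      then show False using e by auto
    qed
  qed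
qed

section \<open>The stars cover the pentagon\<close>

lemma repI:
  assumes "s \<in> rim c k" "0 \<le> \<mu>" "\<mu> \<le> 1" "bd s \<mu> = b" "0 \<le> r" "r \<le> 1" "q = ctr c k + r *\<^sub>R (b - ctr c k)"
  shows "\<exists>k s r \<mu>. rep c q k s r \<mu>"
  using assms unfolding rep_def by blast

lemma top_cover:
  assumes n: "0 < len c" and x: "1 \<le> x" "x \<le> 4 * real (len c) - 1"
  shows "\<exists>s\<in>rim c GM. \<exists>\<mu>. 0 \<le> \<mu> \<and> \<mu> \<le> 1 \<and> bd s \<mu> = (x, 3)"
proof -
  \<comment> \<open>\<open>x\<close> lies in the block from \<open>4 * j - 1\<close> to
    \<open>4 * j + 3\<close>, formed by corner \<open>j\<close> and dart \<open>j\<close>.\<close>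
  define j where "j = nat \<lfloor>(x + 1) / 4\<rfloor>"
  have "0 \<le> \<lfloor>(x + 1) / 4\<rfloor>" using x(1) by simp
  then have "real j = of_int \<lfloor>(x + 1) / 4\<rfloor>" by (simp add: j_def)
  then have "real j \<le> (x + 1) / 4" "(x + 1) / 4 < real j + 1" by linarith+
  then have j: "4 * real j \<le> x + 1" "x < 4 * real j + 3" by (simp_all add: field_simps)
  show ?thesis
  proof (cases "x < 4 * real j + 1")
    case True
    then have j1: "1 \<le> j" using x(1) by (cases j) auto
    have "real j < real (len c) + 1" using j x(2) by linarith
    then have jn: "j \<le> len c" by linarith
    show ?thesis
    proof (cases "j = len c")
      case True
      then have "x = 4 * real j - 1" using j x by linarith
      moreover have "real (j - 1) = real j - 1" using j1 by simp
      ultimately show ?thesis using True n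
        by (intro bexI[of _ "TR (j - 1)"] exI[of _ 1]) auto
    next
      case False
      show ?thesis
      proof (cases "x \<le> 4 * real j")
        case True
        then show ?thesis using j j1 jn False
          by (intro bexI[of _ "HZ j 3 0"] exI[of _ "x - (4 * real j - 1)"]) auto
      next
        case 2: False
        then show ?thesis using j j1 jn False \<open>x < 4 * real j + 1\<close>
          by (intro bexI[of _ "HZ j 3 1"] exI[of _ "x - 4 * real j"]) auto
      qed
    qed
  next
    case False
    have "real j < real (len c)" using False x(2) by linarith
    then have jn: "j < len c" by linarith
    show ?thesis
    proof (cases "x \<le> 4 * real j + 2")
      case True
      then show ?thesis using False jn
        by (intro bexI[of _ "TL j"] exI[of _ "x - (4 * real j + 1)"]) auto
    next
      case 2: False
      then show ?thesis using jn j
        by (intro bexI[of _ "TR j"] exI[of _ "x - (4 * real j + 2)"]) auto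
    qed
  qed
qed

lemma unit_cover:
  assumes "0 \<le> y" "y < (3::real)"
  obtains a :: nat where "a = 0 \<or> a = 1 \<or> a = 2" "real a \<le> y" "y \<le> real a + 1"
proof -
  consider "y \<le> 1" | "1 < y" "y \<le> 2" | "2 < y" by linarith
  then show thesis
  proof cases
    case 1 then show ?thesis using that[of 0] assms by simp
  next
    case 2 then show ?thesis using that[of 1] assms by simp
  next
    case 3 then show ?thesis using that[of 2] assms by simp
  qed
qed

text \<open>
  The boundary point of a box of half-width 1 on the ray from its node through \<open>(dx, dy)\<close> lies on a
  vertical side or on a horizontal one.
\<close>

lemma ray:
  fixes dx dy h :: real
  assumes h: "0 < h" "\<bar>dx\<bar> \<le> 1" "\<bar>dy\<bar> \<le> h" "(dx, dy) \<noteq> (0, 0)"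
  obtains (side) r b where "0 < r" "r \<le> 1" "\<bar>b\<bar> < h" "dx = r * sgn dx" "dy = r * b" "dx \<noteq> 0" "\<bar>dy\<bar> < h * \<bar>dx\<bar>"
      "0 \<le> dy \<Longrightarrow> 0 \<le> b"
  | (top) r a where "0 < r" "r \<le> 1" "\<bar>a\<bar> \<le> 1" "dx = r * a" "dy = r * (h * sgn dy)" "dy \<noteq> 0"
proof (cases "\<bar>dy\<bar> < h * \<bar>dx\<bar>")
  case True
  then have d: "dx \<noteq> 0" by auto
  have "\<bar>dy / \<bar>dx\<bar>\<bar> < h" using True d by (simp add: abs_divide divide_less_eq)
  then show thesis using True d h
    by (intro side[of "\<bar>dx\<bar>" "dy / \<bar>dx\<bar>"]) (simp_all add: abs_mult_sgn)
next
  case False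
  have dy: "dy \<noteq> 0" using False h(1,4) by (auto simp: not_less mult_le_0_iff)
  then have r: "0 < \<bar>dy\<bar> / h" "\<bar>dy\<bar> / h \<le> 1" using h by simp_all
  have "\<bar>dx / (\<bar>dy\<bar> / h)\<bar> \<le> 1" using False dy h(1) by (simp add: abs_mult abs_divide divide_le_eq mult.commute)
  then show thesis using dy h(1) r
    by (intro top[of "\<bar>dy\<bar> / h" "dx / (\<bar>dy\<bar> / h)"]) (simp_all add: abs_mult_sgn)
qed

text \<open>The ray from the node through the point leaves the box through a vertical or a
  horizontal side. \<open>side\<close> and \<open>top\<close> are required only for exits that can
  occur: nodes of \<open>GE\<close> and \<open>GC\<close> sit on the bottom of their boxes, and the
  outermost edge stars lack a vertical side.\<close>

lemma box_cover:
  assumes k: "ctr c k = (x0, y0)" and h: "0 < h"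
    and d: "\<bar>x - x0\<bar> \<le> 1" "\<bar>y - y0\<bar> \<le> h"
    and side: "\<And>e b. e = -1 \<or> e = 1 \<Longrightarrow> \<bar>b\<bar> < h \<Longrightarrow> (y0 \<le> y \<Longrightarrow> 0 \<le> b) \<Longrightarrow> sgn (x - x0) = e \<Longrightarrow>
        \<bar>y - y0\<bar> < h * \<bar>x - x0\<bar> \<Longrightarrow>
        \<exists>s\<in>rim c k. \<exists>\<mu>. 0 \<le> \<mu> \<and> \<mu> \<le> 1 \<and> bd s \<mu> = (x0 + e, y0 + b)"
    and top: "\<And>a e. e = -1 \<or> e = 1 \<Longrightarrow> \<bar>a\<bar> \<le> 1 \<Longrightarrow> sgn (y - y0) = e \<or> y = y0 \<Longrightarrow> (y0 \<le> y \<Longrightarrow> e = 1) \<Longrightarrow>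
        \<exists>s\<in>rim c k. \<exists>\<mu>. 0 \<le> \<mu> \<and> \<mu> \<le> 1 \<and> bd s \<mu> = (x0 + a, y0 + h * e)"
  shows "\<exists>k s r \<mu>. rep c (x, y) k s r \<mu>"
proof (cases "(x - x0, y - y0) = (0, 0)")
  case True
  then have "y = y0" by simp
  \<comment> \<open>The point is the node itself, so any segment will do; \<open>top\<close>
    supplies one.\<close>
  then have "\<exists>s\<in>rim c k. \<exists>\<mu>. 0 \<le> \<mu> \<and> \<mu> \<le> 1 \<and> bd s \<mu> = (x0 + 0, y0 + h * 1)"
    by (intro top) simp_all
  then obtain s and \<mu> :: real where "s \<in> rim c k" "0 \<le> \<mu>" "\<mu> \<le> 1" by (elim bexE exE conjE)
  then show ?thesis using True k by (intro repI[of s c k \<mu> _ 0]) auto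
next
  case False
  show ?thesis
  proof (rule ray[OF h d False])
    fix r b
    assume r: "0 < r" "r \<le> 1" "\<bar>b\<bar> < h" "x - x0 = r * sgn (x - x0)" "y - y0 = r * b" "x - x0 \<noteq> 0"
      "\<bar>y - y0\<bar> < h * \<bar>x - x0\<bar>" "0 \<le> y - y0 \<Longrightarrow> 0 \<le> b"
    define e where "e = sgn (x - x0)"
    have e: "e = -1 \<or> e = 1" using r(6) by (auto simp: e_def sgn_if)
    have "y0 \<le> y \<Longrightarrow> 0 \<le> b" using r(8) by simp
    then obtain s \<mu> where s: "s \<in> rim c k" "0 \<le> \<mu>" "\<mu> \<le> 1" "bd s \<mu> = (x0 + e, y0 + b)"
      using side[OF e r(3) _ e_def[symmetric] r(7)] by auto
    have "x = x0 + r * e" "y = y0 + r * b" using r(4,5) unfolding e_def by linarith+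
    then show ?thesis using s r(1,2) k by (intro repI[of s c k \<mu> "(x0 + e, y0 + b)" r]) simp_all
  next
    fix r a
    assume r: "0 < r" "r \<le> 1" "\<bar>a\<bar> \<le> 1" "x - x0 = r * a" "y - y0 = r * (h * sgn (y - y0))" "y - y0 \<noteq> 0"
    define e where "e = sgn (y - y0)"
    have e: "e = -1 \<or> e = 1" "y0 \<le> y \<Longrightarrow> e = 1" using r(6) by (auto simp: e_def sgn_if)
    then obtain s \<mu> where s: "s \<in> rim c k" "0 \<le> \<mu>" "\<mu> \<le> 1" "bd s \<mu> = (x0 + a, y0 + h * e)"
      using top[OF e(1) r(3)] e_def by auto
    have "x = x0 + r * a" "y = y0 + r * (h * e)" using r(4,5) unfolding e_def by linarith+
    then show ?thesis using s r(1,2) k by (intro repI[of s c k \<mu> "(x0 + a, y0 + h * e)" r]) simp_all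
  qed
qed

lemma pent_cover:
  assumes n: "0 < len c" and h: "pent c (q - mid c) \<le> 1"
  shows "\<exists>k s r \<mu>. rep c q k s r \<mu>"
proof -
  obtain x y where q: "q = (x, y)" by (cases q)
  have n1: "1 \<le> real (len c)" using n by simp
  from pent_leD[OF n h[unfolded q]] have H: "0 \<le> y" "\<bar>x - 2 * real (len c)\<bar> \<le> 2 * real (len c) - 2 + y / 3"
    "\<bar>x - 2 * real (len c)\<bar> \<le> (2 * real (len c) - 1) * ((6 - y) / 3)" by simp_all
  show ?thesis
  proof (cases "3 \<le> y")
    case True
    define r where "r = (6 - y) / 3"
    have "0 \<le> (2 * real (len c) - 1) * r" using H(3) unfolding r_def by linarith
    then have r: "0 \<le> r" "r \<le> 1" using n1 True by (simp_all add: zero_le_mult_iff r_def)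
    show ?thesis
    proof (cases "r = 0")
      case True
      then have "y = 6" "x = 2 * real (len c)" using H(3) by (simp_all add: r_def)
      then show ?thesis using n by (intro repI[of "TL 0" c GM 0 "(1, 3)" 0]) (simp_all add: q)
    next
      case False
      define t where "t = (x - 2 * real (len c)) / r"
      define bx where "bx = 2 * real (len c) + t"
      have rp: "0 < r" using r False by simp
      have "\<bar>t\<bar> \<le> 2 * real (len c) - 1"
        using H(3) rp by (simp add: t_def abs_divide divide_le_eq r_def[symmetric])
      then have "1 \<le> bx" "bx \<le> 4 * real (len c) - 1" unfolding bx_def by linarith+
      from top_cover[OF n this] obtain s \<mu> where s: "s \<in> rim c GM" "0 \<le> \<mu>" "\<mu> \<le> 1" "bd s \<mu> = (bx, 3)" by blast
      have "x = 2 * real (len c) + r * (bx - 2 * real (len c))" using rp by (simp add: bx_def t_def)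
      moreover have "y = 6 + r * (3 - 6)" unfolding r_def by (simp add: field_simps)
      ultimately show ?thesis using s r by (intro repI[of s c GM \<mu> "(bx, 3)" r]) (simp_all add: q)
    qed
  next
    case False
    define j where "j = nat \<lfloor>(x + 1) / 4\<rfloor>"
    have x: "1 < x" "x < 4 * real (len c) - 1"  using H(2) False by linarith+
    have "0 \<le> \<lfloor>(x + 1) / 4\<rfloor>" using x(1) by simp
    then have "real j = of_int \<lfloor>(x + 1) / 4\<rfloor>" by (simp add: j_def)
    then have "real j \<le> (x + 1) / 4" "(x + 1) / 4 < real j + 1" by linarith+
    then have j: "4 * real j \<le> x + 1" "x < 4 * real j + 3" by (simp_all add: field_simps)
    show ?thesis
    proof (cases "4 * real j + 1 \<le> x")
      case True
      have "real j < real (len c)" using True x(2) by linarith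
      then have jn: "j < len c" by linarith
      show ?thesis unfolding q
      proof (rule box_cover[of c "GE j" "4 * real j + 2" 0 3])
        fix e b :: real assume e: "e = -1 \<or> e = 1" and b: "\<bar>b\<bar> < 3" "0 \<le> y \<Longrightarrow> 0 \<le> b"
          and sg: "sgn (x - (4 * real j + 2)) = e" and lt: "\<bar>y - 0\<bar> < 3 * \<bar>x - (4 * real j + 2)\<bar>"
        obtain a where a: "a = 0 \<or> a = 1 \<or> a = 2" "real a \<le> b" "b \<le> real a + 1"
          using unit_cover[of b] b H(1) by auto
        from e show "\<exists>s\<in>rim c (GE j). \<exists>\<mu>. 0 \<le> \<mu> \<and> \<mu> \<le> 1 \<and> bd s \<mu> = (4 * real j + 2 + e, 0 + b)"
        proof
          assume "e = -1"
          then have neg: "x < 4 * real j + 2" using sg by (simp add: sgn_if split: if_splits)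
          \<comment> \<open>To the left of the first edge node, the slanted side of the pentagon
            gives \<open>y \<ge> 3 * (2 - x)\<close>, so the ray leaves through the top, contrary to
            \<open>lt\<close>. The last edge star is the mirror image.\<close>
          have "j \<noteq> 0"
          proof
            assume "j = 0"
            then show False using H(1,2) neg lt by (simp add: abs_if split: if_splits)
          qed
          then show ?thesis using a jn \<open>e = -1\<close>
            by (intro bexI[of _ "SD j 2 a"] exI[of _ "b - real a"]) auto
        next
          assume "e = 1"
          then have ps: "4 * real j + 2 < x" using sg by (simp add: sgn_if split: if_splits)
          have "Suc j \<noteq> len c"
          proof
            assume "Suc j = len c"
            then have "real (len c) = real j + 1" by linarith
            then show False using H(1,2) ps lt by (simp add: abs_if split: if_splits)
          qed
          then show ?thesis using a jn \<open>e = 1\<close>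
            by (intro bexI[of _ "SD (Suc j) 0 a"] exI[of _ "b - real a"]) auto
        qed
      next
        fix a e :: real assume a: "\<bar>a\<bar> \<le> 1" and "0 \<le> y \<Longrightarrow> e = 1"
        then have "e = 1" using H(1) by simp
        show "\<exists>s\<in>rim c (GE j). \<exists>\<mu>. 0 \<le> \<mu> \<and> \<mu> \<le> 1 \<and> bd s \<mu> = (4 * real j + 2 + a, 0 + 3 * e)"
        proof (cases "a \<le> 0")
          case True
          then show ?thesis using a jn \<open>e = 1\<close> by (intro bexI[of _ "TL j"] exI[of _ "1 + a"]) auto
        next
          case 2: False
          then show ?thesis using a jn \<open>e = 1\<close> by (intro bexI[of _ "TR j"] exI[of _ a]) auto
        qed
      qed (use True j H(1) False in auto)
    next
      case xj: False
      have j1: "1 \<le> j" using x(1) xj by (cases j) auto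
      have "real j < real (len c)" using j x(2) by linarith
      then have jn: "j < len c" by linarith
      have dx: "\<bar>x - 4 * real j\<bar> \<le> 1" using j xj by linarith
      consider "at_apex c j \<longrightarrow> y \<le> 1" | "at_apex c j" "1 < y" by linarith
      then show ?thesis
      proof cases
        case 1
        note ht = ht_cases[of c j]
        show ?thesis unfolding q
        proof (rule box_cover[of c "GC j" "4 * real j" 0 "ht c j"])
          fix e b :: real assume e: "e = -1 \<or> e = 1" and b: "\<bar>b\<bar> < ht c j" "0 \<le> y \<Longrightarrow> 0 \<le> b"
          then have b0: "0 \<le> b" "b < ht c j" using H(1) by auto
          have b3: "b < 3" using b0(2) ht by auto
          obtain a where a: "a = 0 \<or> a = 1 \<or> a = 2" "real a \<le> b" "b \<le> real a + 1"
            by (rule unit_cover[OF b0(1) b3])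
          have "at_apex c j \<Longrightarrow> a = 0" using a(1,2) b0 by (auto simp: ht_def)
          then show "\<exists>s\<in>rim c (GC j). \<exists>\<mu>. 0 \<le> \<mu> \<and> \<mu> \<le> 1 \<and> bd s \<mu> = (4 * real j + e, 0 + b)"
            using a e j1 jn
            by (intro bexI[of _ "SD j (if e = -1 then 0 else 2) a"] exI[of _ "b - real a"]) auto
        next
          fix a e :: real assume a: "\<bar>a\<bar> \<le> 1" and "0 \<le> y \<Longrightarrow> e = 1"
          then have e: "e = 1" using H(1) by simp
          show "\<exists>s\<in>rim c (GC j). \<exists>\<mu>. 0 \<le> \<mu> \<and> \<mu> \<le> 1 \<and> bd s \<mu> = (4 * real j + a, 0 + ht c j * e)"
          proof (cases "a \<le> 0")
            case True
            then show ?thesis using a j1 jn ht e by (intro bexI[of _ "HZ j (ht c j) 0"] exI[of _ "1 + a"]) auto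
          next
            case 2: False
            then show ?thesis using a j1 jn ht e by (intro bexI[of _ "HZ j (ht c j) 1"] exI[of _ a]) auto
          qed
        qed (use dx H(1) False 1 ht in auto)
      next
        case 2
        show ?thesis unfolding q
        proof (rule box_cover[of c "GR j" "4 * real j" 2 1])
          fix e b :: real assume e: "e = -1 \<or> e = 1" and b: "\<bar>b\<bar> < 1"
          show "\<exists>s\<in>rim c (GR j). \<exists>\<mu>. 0 \<le> \<mu> \<and> \<mu> \<le> 1 \<and> bd s \<mu> = (4 * real j + e, 2 + b)"
          proof (cases "b \<le> 0")
            case True
            then show ?thesis using b e j1 jn 2(1)
              by (intro bexI[of _ "SD j (if e = -1 then 0 else 2) 1"] exI[of _ "1 + b"]) auto
          next
            case False
            then show ?thesis using b e j1 jn 2(1)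
              by (intro bexI[of _ "SD j (if e = -1 then 0 else 2) 2"] exI[of _ b]) auto
          qed
        next
          fix a e :: real assume a: "\<bar>a\<bar> \<le> 1" and e: "e = -1 \<or> e = 1"
          define y' :: nat where "y' = (if e = 1 then 3 else 1)"
          have y': "y' = 1 \<or> y' = 3" "2 + 1 * e = real y'" using e by (auto simp: y'_def)
          show "\<exists>s\<in>rim c (GR j). \<exists>\<mu>. 0 \<le> \<mu> \<and> \<mu> \<le> 1 \<and> bd s \<mu> = (4 * real j + a, 2 + 1 * e)"
          proof (cases "a \<le> 0")
            case True
            then show ?thesis using a j1 jn 2(1) y'
              by (intro bexI[of _ "HZ j y' 0"] exI[of _ "1 + a"]) auto
          next
            case f: False
            then show ?thesis using a j1 jn 2(1) y'
              by (intro bexI[of _ "HZ j y' 1"] exI[of _ a]) auto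
          qed
        qed (use dx H(1) False 2 in auto)
      qed
    qed
  qed
qed

end

section \<open>The boundary of the pentagon\<close>

text \<open>
  Parametrizes the boundary of the pentagon by \<open>[0,n]\<close>, starting at the top \<open>(2n,6)\<close>; the \<open>j\<close>-th dart
  runs during \<open>[j,j+1]\<close>.
\<close>

definition perim :: "real \<Rightarrow> real \<Rightarrow> real \<times> real" where
  "perim n t = ((if t \<le> 1/4 then 2 * n + 4 * t * (1 - 2 * n)
      else if n - 1/4 \<le> t then 2 * n - 4 * (n - t) * (1 - 2 * n) else 4 * t),
    max 0 (max (6 - 12 * t) (6 - 12 * (n - t))))"

text \<open>On the first dart the time 1/4 is the corner \<open>(1, 3)\<close>, a link vertex, and
  1/2 is the node \<open>(2, 0)\<close> of the edge, in step with the parametrization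
  \<open>half\<close> of the edges.\<close>

lemma perim_pieces:
  assumes "1 \<le> n"
  shows "0 \<le> t \<Longrightarrow> t \<le> 1/4 \<Longrightarrow> perim n t = (2 * n + 4 * t * (1 - 2 * n), 6 - 12 * t)"
    "1/4 \<le> t \<Longrightarrow> t \<le> 1/2 \<Longrightarrow> perim n t = (4 * t, 6 - 12 * t)"
    "1/2 \<le> t \<Longrightarrow> t \<le> n - 1/2 \<Longrightarrow> perim n t = (4 * t, 0)"
    "n - 1/2 \<le> t \<Longrightarrow> t \<le> n - 1/4 \<Longrightarrow> perim n t = (4 * t, 6 - 12 * (n - t))"
    "n - 1/4 \<le> t \<Longrightarrow> t \<le> n \<Longrightarrow> perim n t = (2 * n - 4 * (n - t) * (1 - 2 * n), 6 - 12 * (n - t))"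
proof -
  have q: "2 * n + 4 * (1/4) * (1 - 2 * n) = 4 * (1/4 :: real)" "2 * n - 4 * (n - (n - 1/4)) * (1 - 2 * n) = 4 * (n - 1/4)"
    by (simp_all add: algebra_simps)
  show "0 \<le> t \<Longrightarrow> t \<le> 1/4 \<Longrightarrow> perim n t = (2 * n + 4 * t * (1 - 2 * n), 6 - 12 * t)"
    using assms by (simp add: perim_def max_def)
  show "1/4 \<le> t \<Longrightarrow> t \<le> 1/2 \<Longrightarrow> perim n t = (4 * t, 6 - 12 * t)"
    using assms q(1) by (cases "t = 1/4") (simp_all add: perim_def max_def algebra_simps)
  show "1/2 \<le> t \<Longrightarrow> t \<le> n - 1/2 \<Longrightarrow> perim n t = (4 * t, 0)"
    using assms by (simp add: perim_def max_def)
  show "n - 1/2 \<le> t \<Longrightarrow> t \<le> n - 1/4 \<Longrightarrow> perim n t = (4 * t, 6 - 12 * (n - t))"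
    using assms q(2) by (cases "t = n - 1/4") (simp_all add: perim_def max_def)
  show "n - 1/4 \<le> t \<Longrightarrow> t \<le> n \<Longrightarrow> perim n t = (2 * n - 4 * (n - t) * (1 - 2 * n), 6 - 12 * (n - t))"
    using assms by (simp add: perim_def max_def)
qed

lemma perim_ends: "1 \<le> n \<Longrightarrow> perim n 0 = (2 * n, 6)" "1 \<le> n \<Longrightarrow> perim n n = (2 * n, 6)"
  using perim_pieces(1)[of n 0] perim_pieces(5)[of n n] by simp_all

lemma pl_on_perim:
  assumes n: "1 \<le> n"
  shows "pl_on {0..n} (perim n)"
proof -
  have 1: "pl_on {0..1/4} (perim n)"
    by (rule pl_on_interval_affine[where u = "(4 * (1 - 2 * n), -12)" and w = "(2 * n, 6)"])
       (simp add: perim_pieces(1)[OF n])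
  have 2: "pl_on {1/4..1/2} (perim n)"
    by (rule pl_on_interval_affine[where u = "(4, -12)" and w = "(0, 6)"])
       (simp add: perim_pieces(2)[OF n])
  have 3: "pl_on {1/2..n - 1/2} (perim n)"
    by (rule pl_on_interval_affine[where u = "(4, 0)" and w = "(0, 0)"])
       (simp add: perim_pieces(3)[OF n])
  have 4: "pl_on {n - 1/2..n - 1/4} (perim n)"
    by (rule pl_on_interval_affine[where u = "(4, 12)" and w = "(0, 6 - 12 * n)"])
       (simp add: perim_pieces(4)[OF n])
  have 5: "pl_on {n - 1/4..n} (perim n)"
    by (rule pl_on_interval_affine[where u = "(4 * (1 - 2 * n), 12)" and w = "(2 * n - 4 * n * (1 - 2 * n), 6 - 12 * n)"])
       (simp add: perim_pieces(5)[OF n] algebra_simps)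
  have a: "pl_on {0..1/2} (perim n)" by (rule pl_on_interval_split[OF 1 2]) simp_all
  have b: "pl_on {0..n - 1/2} (perim n)" by (rule pl_on_interval_split[OF a 3]) (use n in simp_all)
  have c: "pl_on {0..n - 1/4} (perim n)" by (rule pl_on_interval_split[OF b 4]) (use n in simp_all)
  show ?thesis by (rule pl_on_interval_split[OF c 5]) (use n in simp_all)
qed

lemma perim_left:
  assumes n: "1 \<le> n" and t: "0 \<le> t" "t \<le> 1/2"
  shows "fst (perim n t) \<le> 2 * n" "snd (perim n t) = 6 - 12 * t" "fst (perim n t) = 2 * n \<Longrightarrow> t = 0 \<or> t = 1/2"
proof -
  consider "t \<le> 1/4" | "1/4 \<le> t" by linarith
  then have "fst (perim n t) \<le> 2 * n \<and> snd (perim n t) = 6 - 12 * t \<and> (fst (perim n t) = 2 * n \<longrightarrow> t = 0 \<or> t = 1/2)"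
  proof cases
    case 1
    have "0 \<le> 4 * t * (2 * n - 1)" using t n by simp
    then have "4 * t * (1 - 2 * n) \<le> 0" by (simp add: algebra_simps)
    then show ?thesis using perim_pieces(1)[OF n t(1) 1] n by simp
  next
    case 2
    then show ?thesis using perim_pieces(2)[OF n 2 t(2)] n t by simp
  qed
  then show "fst (perim n t) \<le> 2 * n" "snd (perim n t) = 6 - 12 * t" "fst (perim n t) = 2 * n \<Longrightarrow> t = 0 \<or> t = 1/2"
    by simp_all
qed

lemma perim_sym:
  assumes n: "1 \<le> n" and t: "0 \<le> t" "t \<le> n"
  shows "perim n (n - t) = (4 * n - fst (perim n t), snd (perim n t))"
proof -
  consider "t \<le> 1/4" | "1/4 \<le> t" "t \<le> 1/2" | "1/2 \<le> t" "t \<le> n - 1/2" | "n - 1/2 \<le> t" "t \<le> n - 1/4" | "n - 1/4 \<le> t"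
    by linarith
  then show ?thesis
  proof cases
    case 1
    then show ?thesis using perim_pieces(1)[OF n, of t] perim_pieces(5)[OF n, of "n - t"] t by simp
  next
    case 2
    then show ?thesis using perim_pieces(2)[OF n, of t] perim_pieces(4)[OF n, of "n - t"] by simp
  next
    case 3
    then show ?thesis using perim_pieces(3)[OF n, of t] perim_pieces(3)[OF n, of "n - t"] by simp
  next
    case 4
    then show ?thesis using perim_pieces(4)[OF n, of t] perim_pieces(2)[OF n, of "n - t"] by simp
  next
    case 5
    then show ?thesis using perim_pieces(5)[OF n, of t] perim_pieces(1)[OF n, of "n - t"] t by simp
  qed
qed

lemma perim_right:
  assumes n: "1 \<le> n" and t: "n - 1/2 \<le> t" "t \<le> n"
  shows "2 * n \<le> fst (perim n t)" "snd (perim n t) = 6 - 12 * (n - t)"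
    "fst (perim n t) = 2 * n \<Longrightarrow> t = n \<or> t = n - 1/2"
proof -
  have u: "0 \<le> n - t" "n - t \<le> 1/2" "n - t \<le> n" using n t by simp_all
  have "perim n t = (4 * n - fst (perim n (n - t)), snd (perim n (n - t)))"
    using perim_sym[OF n u(1,3)] by simp
  then show "2 * n \<le> fst (perim n t)" "snd (perim n t) = 6 - 12 * (n - t)"
    "fst (perim n t) = 2 * n \<Longrightarrow> t = n \<or> t = n - 1/2"
    using perim_left[OF n u(1,2)] by auto
qed

text \<open>Positive height distinguishes the flanks from the bottom, and the side of the line
  \<open>x = 2 * n\<close> one flank from the other. On a flank the height is injective, on the
  bottom the first coordinate.\<close>

lemma perim_inj:
  assumes n: "1 \<le> n" and t: "0 \<le> t" "t < n" "0 \<le> t'" "t' < n" and eq: "perim n t = perim n t'"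
  shows "t = t'"
proof -
  have fs: "fst (perim n t) = fst (perim n t')" "snd (perim n t) = snd (perim n t')"
    using eq by simp_all
  have *: "\<not> (s < 1/2 \<and> n - 1/2 < s' \<and> fst (perim n s) = fst (perim n s') \<and> snd (perim n s) = snd (perim n s'))"
    if "0 \<le> s" "s' < n" for s s'
  proof
    assume *: "s < 1/2 \<and> n - 1/2 < s' \<and> fst (perim n s) = fst (perim n s') \<and> snd (perim n s) = snd (perim n s')"
    then have "s \<le> 1/2" "n - 1/2 \<le> s'" "s' \<le> n" using that by simp_all
    note L = perim_left[OF n that(1) this(1)] and R = perim_right[OF n this(2,3)]
    have "fst (perim n s) = 2 * n" "fst (perim n s') = 2 * n" using L(1) R(1) * by linarith+
    then have "s = 0" "s' = n" using L(3) R(3) * by linarith+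
    then show False using that by simp
  qed
  have out: "0 < snd (perim n s) \<longleftrightarrow> s < 1/2 \<or> n - 1/2 < s" for s
    unfolding perim_def snd_conv less_max_iff_disj by auto
  then have d: "t < 1/2 \<or> n - 1/2 < t \<longleftrightarrow> t' < 1/2 \<or> n - 1/2 < t'" unfolding out[symmetric] fs(2) ..
  have e: "\<not> (t < 1/2 \<and> n - 1/2 < t')" "\<not> (t' < 1/2 \<and> n - 1/2 < t)"
    using *[OF t(1,4)] *[OF t(3,2)] fs by simp_all
  consider "t < 1/2" "t' < 1/2" | "n - 1/2 < t" "n - 1/2 < t'" | "1/2 \<le> t" "t \<le> n - 1/2" "1/2 \<le> t'" "t' \<le> n - 1/2"
    using d e by linarith
  then show ?thesis
  proof cases
    case 1
    show ?thesis
      using perim_left(2)[OF n t(1) less_imp_le[OF 1(1)]] perim_left(2)[OF n t(3) less_imp_le[OF 1(2)]] fs(2)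
      by linarith
  next
    case 2
    note le = less_imp_le[OF 2(1)] less_imp_le[OF 2(2)] less_imp_le[OF t(2)] less_imp_le[OF t(4)]
    have "12 * (n - t) = 12 * (n - t')"
      using perim_right(2)[OF n le(1,3)] perim_right(2)[OF n le(2,4)] fs(2) by linarith
    then show ?thesis unfolding mult_cancel_left by (elim disjE; linarith)
  next
    case 3
    then show ?thesis using perim_pieces(3)[OF n 3(1,2)] perim_pieces(3)[OF n 3(3,4)] fs(1) by simp
  qed
qed

lemma max3:
  fixes a b c :: real
  assumes "a \<le> m" "b \<le> m" "c \<le> m" "a = m \<or> b = m \<or> c = m"
  shows "max a (max b c) = m"
  using assms by (auto simp: max_def)

context two_apex
begin

lemma pent_perim_left:
  assumes n: "0 < len c" and t: "0 \<le> t" "t \<le> real (len c) / 2"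
  shows "pent c (perim (len c) t - mid c) = 1"
proof -
  define N where "N = real (len c)"
  have N: "1 \<le> N" using n by (simp add: N_def)
  then have D: "0 < 2 * N - 1" and nz: "2 * N - 1 \<noteq> 0" by linarith+
  have I: "pent c (x - 2 * N, y - 3) = 1"
    if "(3 - y) / 3 \<le> 1" "\<bar>x - 2 * N\<bar> - (y - 3) / 3 \<le> 2 * N - 1" "(y - 3) / 3 * (2 * N - 1) + \<bar>x - 2 * N\<bar> \<le> 2 * N - 1"
      "(3 - y) / 3 = 1 \<or> \<bar>x - 2 * N\<bar> - (y - 3) / 3 = 2 * N - 1 \<or> (y - 3) / 3 * (2 * N - 1) + \<bar>x - 2 * N\<bar> = 2 * N - 1" for x y
  proof -
    have e: "(y - 3) / 3 + \<bar>x - 2 * N\<bar> / (2 * N - 1) = ((y - 3) / 3 * (2 * N - 1) + \<bar>x - 2 * N\<bar>) / (2 * N - 1)"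
      by (simp only: add_divide_distrib nonzero_mult_div_cancel_right[OF nz])
    have h: "pent c (x - 2 * N, y - 3) = max ((3 - y) / 3) (max ((\<bar>x - 2 * N\<bar> - (y - 3) / 3) / (2 * N - 1))
       (((y - 3) / 3 * (2 * N - 1) + \<bar>x - 2 * N\<bar>) / (2 * N - 1)))"
      unfolding pent_def N_def[symmetric] fst_conv snd_conv e by simp
    have A: "A / (2 * N - 1) \<le> 1 \<longleftrightarrow> A \<le> 2 * N - 1" "A / (2 * N - 1) = 1 \<longleftrightarrow> A = 2 * N - 1" for A
      using D by (simp_all add: divide_le_eq divide_eq_eq)
    show ?thesis unfolding h by (rule max3) (use that in \<open>simp_all only: A\<close>)
  qed
  have m: "perim (len c) t - mid c = (fst (perim N t) - 2 * N, snd (perim N t) - 3)"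
    by (simp add: mid_def N_def prod_eq_iff)
  have t': "t \<le> N / 2" using t(2) by (simp add: N_def)
  consider "t \<le> 1/4" | "1/4 \<le> t" "t \<le> 1/2" | "1/2 \<le> t" "t \<le> N - 1/2" using t' N by linarith
  then show ?thesis unfolding m
  proof cases
    case 1
    have a: "0 \<le> (1 - 4 * t) * (2 * N)" "0 \<le> 4 * t * (2 * N - 1)" using 1 N t by auto
    have e: "2 * N + 4 * t * (1 - 2 * N) - 2 * N = - (4 * t * (2 * N - 1))" by (simp add: algebra_simps)
    have x: "\<bar>2 * N + 4 * t * (1 - 2 * N) - 2 * N\<bar> = 4 * t * (2 * N - 1)"
      unfolding e using a(2) by simp
    have y: "(3 - (6 - 12 * t)) / 3 = 4 * t - 1" "(6 - 12 * t - 3) / 3 = 1 - 4 * t" by (simp_all add: field_simps)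
    have z: "4 * t * (2 * N - 1) - (1 - 4 * t) \<le> 2 * N - 1" "(1 - 4 * t) * (2 * N - 1) + 4 * t * (2 * N - 1) = 2 * N - 1"
      using a(1) by (simp_all add: algebra_simps)
    show "pent c (fst (perim N t) - 2 * N, snd (perim N t) - 3) = 1"
      unfolding perim_pieces(1)[OF N t(1) 1] fst_conv snd_conv
      by (rule I; unfold x y) (use 1 z in simp_all)
  next
    case 2
    have a: "0 \<le> (4 * t - 1) * (2 * N)" using 2 N by simp
    have x: "\<bar>4 * t - 2 * N\<bar> = 2 * N - 4 * t" using 2 N by simp
    have y: "(3 - (6 - 12 * t)) / 3 = 4 * t - 1" "(6 - 12 * t - 3) / 3 = 1 - 4 * t" by (simp_all add: field_simps)
    have z: "(1 - 4 * t) * (2 * N - 1) + (2 * N - 4 * t) \<le> 2 * N - 1"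
      using a by (simp add: algebra_simps)
    show "pent c (fst (perim N t) - 2 * N, snd (perim N t) - 3) = 1"
      unfolding perim_pieces(2)[OF N 2] fst_conv snd_conv
      by (rule I; unfold x y) (use 2 z in simp_all)
  next
    case 3
    have x: "\<bar>4 * t - 2 * N\<bar> = 2 * N - 4 * t" using t' by simp
    show "pent c (fst (perim N t) - 2 * N, snd (perim N t) - 3) = 1"
      unfolding perim_pieces(3)[OF N 3] fst_conv snd_conv
      by (rule I; (unfold x)?) (use 3 N in simp_all)
  qed
qed

lemma pent_perim:
  assumes n: "0 < len c" and t: "0 \<le> t" "t \<le> real (len c)"
  shows "pent c (perim (len c) t - mid c) = 1"
proof (cases "t \<le> real (len c) / 2")
  case True
  then show ?thesis using pent_perim_left n t by blast
next
  case False
  define u where "u = real (len c) - t"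
  have u: "0 \<le> u" "u \<le> real (len c) / 2" "u \<le> real (len c)" "t = real (len c) - u" using t False by (simp_all add: u_def)
  have "perim (len c) t = (4 * len c - fst (perim (len c) u), snd (perim (len c) u))"
    unfolding u(4) using perim_sym[of "real (len c)" u] n u by simp
  then have "fst (perim (len c) t - mid c) = - fst (perim (len c) u - mid c)"
    "snd (perim (len c) t - mid c) = snd (perim (len c) u - mid c)"
    by (simp_all add: mid_def)
  then have "pent c (perim (len c) t - mid c) = pent c (perim (len c) u - mid c)"
    by (simp only: pent_def abs_minus_cancel)
  then show ?thesis using pent_perim_left[OF n u(1,2)] by simp
qed

text \<open>Undoes the rotation of the walk: the boundary of the disk starts at the base point,
  \<open>perim\<close> at the apex.\<close>

definition loop :: "'c \<Rightarrow> real \<Rightarrow> real \<times> real" where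
  "loop c \<theta> = (let t = real (len c) * \<theta> in
     perim (len c) (if t < real (off c) then t - real (off c) + real (len c) else t - real (off c)))"

definition chart :: "'c \<Rightarrow> real \<times> real \<Rightarrow> real \<times> real" where
  "chart c = radial (mid c) (loop c)"

lemma pl_on_loop:
  assumes c: "c \<in> cells X" and n: "0 < len c"
  shows "pl_on {0..1} (loop c)" "loop c 0 = loop c 1"
proof -
  define N where "N = real (len c)"
  define a where "a = real (off c)"
  have N: "1 \<le> N" using n by (simp add: N_def)
  have a: "0 \<le> a" "a < N" using off(1)[OF c n] by (simp_all add: a_def N_def)
  have l: "loop c \<theta> = perim N (if N * \<theta> < a then N * \<theta> - a + N else N * \<theta> - a)" for \<theta>
    by (simp add: loop_def N_def a_def Let_def)
  have P: "pl_on {0..N} (perim N)" by (rule pl_on_perim[OF N])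
  have "pl_on {0..a / N} (\<lambda>\<theta>. perim N (N * \<theta> - a + N))"
  proof (rule pl_on_compose[OF _ P])
    show "pl_on {0..a / N} (\<lambda>\<theta>. N * \<theta> - a + N)"
      by (rule pl_on_interval_affine[where u = N and w = "N - a"]) simp
    show "(\<lambda>\<theta>. N * \<theta> - a + N) ` {0..a / N} \<subseteq> {0..N}"
    proof (rule image_subsetI)
      fix \<theta> assume "\<theta> \<in> {0..a / N}"
      then have "0 \<le> N * \<theta>" "N * \<theta> \<le> a" using N by (simp_all add: le_divide_eq mult.commute)
      then show "N * \<theta> - a + N \<in> {0..N}" using a by simp
    qed
  qed
  moreover have "perim N (N * \<theta> - a + N) = loop c \<theta>" if "\<theta> \<in> {0..a / N}" for \<theta>
  proof (cases "N * \<theta> < a")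
    case False
    \<comment> \<open>At the seam both formulas give the top of the pentagon.\<close>
    then have "N * \<theta> = a" using that N by (simp add: field_simps)
    then show ?thesis unfolding l using perim_ends[OF N] by simp
  qed (simp add: l)
  ultimately have 1: "pl_on {0..a / N} (loop c)" by (rule pl_on_cong)
  have "pl_on {a / N..1} (\<lambda>\<theta>. perim N (N * \<theta> - a))"
  proof (rule pl_on_compose[OF _ P])
    show "pl_on {a / N..1} (\<lambda>\<theta>. N * \<theta> - a)"
      by (rule pl_on_interval_affine[where u = N and w = "- a"]) simp
    show "(\<lambda>\<theta>. N * \<theta> - a) ` {a / N..1} \<subseteq> {0..N}"
    proof (rule image_subsetI)
      fix \<theta> assume "\<theta> \<in> {a / N..1}"
      then have "a \<le> N * \<theta>" "N * \<theta> \<le> N" using N by (simp_all add: divide_le_eq mult.commute)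
      then have "0 \<le> N * \<theta> - a" "N * \<theta> - a \<le> N" using a by linarith+
      then show "N * \<theta> - a \<in> {0..N}" by simp
    qed
  qed
  moreover have "perim N (N * \<theta> - a) = loop c \<theta>" if "\<theta> \<in> {a / N..1}" for \<theta>
    using that N by (simp add: l divide_le_eq mult.commute)
  ultimately have 2: "pl_on {a / N..1} (loop c)" by (rule pl_on_cong)
  show "pl_on {0..1} (loop c)"
    by (rule pl_on_interval_split[OF 1 2]) (use a N in simp_all)
  show "loop c 0 = loop c 1"
    using a N perim_ends[OF N] unfolding l by (cases "a = 0") simp_all
qed

lemma loop_time:
  assumes c: "c \<in> cells X" and n: "0 < len c" and \<theta>: "0 \<le> \<theta>" "\<theta> < 1"
  obtains t where "0 \<le> t" "t < real (len c)" "loop c \<theta> = perim (len c) t"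
    "t = real (len c) * \<theta> - real (off c) \<and> real (off c) \<le> real (len c) * \<theta> \<or>
     t = real (len c) * \<theta> - real (off c) + real (len c) \<and> real (len c) * \<theta> < real (off c)"
proof -
  have N: "0 < real (len c)" using n by simp
  have b: "real (len c) * \<theta> < real (len c)" "0 \<le> real (len c) * \<theta>" using \<theta> N by simp_all
  have o: "real (off c) < real (len c)" using off(1)[OF c n] by simp
  have h: "real (len c) * \<theta> - real (off c) < real (len c)" "0 \<le> real (len c) * \<theta> - real (off c) + real (len c)"
    using b o by linarith+
  show thesis
  proof (cases "real (len c) * \<theta> < real (off c)")
    case True
    show ?thesis
      by (rule that[of "real (len c) * \<theta> - real (off c) + real (len c)"])
         (use True b h in \<open>simp_all add: loop_def Let_def\<close>)
  next
    case False
    show ?thesis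
      by (rule that[of "real (len c) * \<theta> - real (off c)"])
         (use False b h in \<open>simp_all add: loop_def Let_def\<close>)
  qed
qed

text \<open>\<open>l1\<close> and \<open>pent\<close> are both homogeneous along rays and equal to 1
  on the respective boundary, so the chart preserves levels.\<close>

lemma pent_chart:
  assumes c: "c \<in> cells X" and n: "0 < len c"
  shows "pent c (chart c p - mid c) = l1 p"
proof (cases "p = 0")
  case True
  then show ?thesis by (simp add: chart_def radial_def pent_def l1_def)
next
  case False
  define \<theta> where "\<theta> = circ ((1 / l1 p) *\<^sub>R p)"
  have \<theta>: "0 \<le> \<theta>" "\<theta> < 1" using circ_range[OF False] by (simp_all add: \<theta>_def)
  obtain t where t: "0 \<le> t" "t < real (len c)" "loop c \<theta> = perim (len c) t"
    using loop_time[OF c n \<theta>] by metis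
  have "chart c p - mid c = l1 p *\<^sub>R (perim (len c) t - mid c)"
    unfolding t(3)[symmetric] \<theta>_def by (simp add: chart_def radial_def)
  then show ?thesis
    using pent_perim[OF n t(1) less_imp_le[OF t(2)]] by (simp only: pent_scale[OF l1_nonneg] mult_1_right)
qed

lemma chart_inj:
  assumes c: "c \<in> cells X" and n: "0 < len c" and eq: "chart c p = chart c p'"
  shows "p = p'"
proof -
  have l: "l1 p = l1 p'" using pent_chart[OF c n] eq by metis
  show ?thesis
  proof (cases "p = 0 \<or> p' = 0")
    case True
    then show ?thesis using l l1_eq_0 by metis
  next
    case False
    then have lp: "l1 p \<noteq> 0" using l1_eq_0 by auto
    define a where "a = (1 / l1 p) *\<^sub>R p"
    define a' where "a' = (1 / l1 p') *\<^sub>R p'"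
    have ca: "0 \<le> circ a" "circ a < 1" "0 \<le> circ a'" "circ a' < 1"
      using circ_range[of p] circ_range[of p'] False by (simp_all add: a_def a'_def)
    have "l1 p *\<^sub>R (loop c (circ a) - mid c) = l1 p *\<^sub>R (loop c (circ a') - mid c)"
      using eq l by (simp add: chart_def radial_def a_def a'_def)
    then have lo: "loop c (circ a) = loop c (circ a')" using lp by simp
    obtain t where t: "0 \<le> t" "t < real (len c)" "loop c (circ a) = perim (len c) t"
      "t = real (len c) * circ a - real (off c) \<and> real (off c) \<le> real (len c) * circ a \<or> t = real (len c) * circ a - real (off c) + real (len c) \<and> real (len c) * circ a < real (off c)"
      by (rule loop_time[OF c n ca(1,2)])
    obtain t' where t': "0 \<le> t'" "t' < real (len c)" "loop c (circ a') = perim (len c) t'"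
      "t' = real (len c) * circ a' - real (off c) \<and> real (off c) \<le> real (len c) * circ a' \<or> t' = real (len c) * circ a' - real (off c) + real (len c) \<and> real (len c) * circ a' < real (off c)"
      by (rule loop_time[OF c n ca(3,4)])
    have "t = t'" using perim_inj[of "real (len c)" t t'] t t' lo n by simp
    then have "real (len c) * circ a < real (len c)" "real (len c) * circ a' < real (len c)" "0 \<le> real (len c) * circ a" "0 \<le> real (len c) * circ a'"
      using ca n by simp_all
    then have "real (len c) * circ a = real (len c) * circ a'" using \<open>t = t'\<close> t(4) t'(4) by linarith
    then have "circ a = circ a'" using n by simp
    moreover have "l1 a = 1" "l1 a' = 1" using False l1_eq_0 l1_nonneg[of p] l1_nonneg[of p']
      by (simp_all add: a_def a'_def l1_scale)
    ultimately have "a = a'" by (rule circ_inj[rotated 2])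
    then show ?thesis using lp l by (simp add: a_def a'_def)
  qed
qed

end

section \<open>Drawing the edges and the 2-cells\<close>

lemma sum_wt:
  fixes h :: "'a \<Rightarrow> 'b::real_vector"
  assumes "finite T" "\<alpha> \<in> T" "\<beta> \<in> T"
  shows "(\<Sum>\<kappa>\<in>T. wt \<alpha> \<beta> \<mu> \<kappa> *\<^sub>R h \<kappa>) = (1 - \<mu>) *\<^sub>R h \<alpha> + \<mu> *\<^sub>R h \<beta>"
proof -
  have "wt \<alpha> \<beta> \<mu> \<kappa> *\<^sub>R h \<kappa> = (if \<kappa> = \<alpha> then (1 - \<mu>) *\<^sub>R h \<kappa> else 0) + (if \<kappa> = \<beta> then \<mu> *\<^sub>R h \<kappa> else 0)" for \<kappa>
    by (auto simp: wt_def scaleR_left_distrib[symmetric])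
  then show ?thesis using assms by (simp add: sum.distrib)
qed

lemma wt_point:
  fixes h :: "'a \<Rightarrow> 'b::real_vector"
  assumes "wt \<alpha> \<beta> \<mu> = wt \<alpha>' \<beta>' \<mu>'"
  shows "(1 - \<mu>) *\<^sub>R h \<alpha> + \<mu> *\<^sub>R h \<beta> = (1 - \<mu>') *\<^sub>R h \<alpha>' + \<mu>' *\<^sub>R h \<beta>'"
  using sum_wt[of "{\<alpha>, \<beta>, \<alpha>', \<beta>'}" \<alpha> \<beta> \<mu> h] sum_wt[of "{\<alpha>, \<beta>, \<alpha>', \<beta>'}" \<alpha>' \<beta>' \<mu>' h] assms by simp

locale two_apex_drawing = two_apex X v w for X :: "('v, 'e, 'c) complex2" and v w :: 'v +
  fixes g :: "('e, 'c) lvert \<Rightarrow> real ^ 4"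
  assumes g: "admissible g"
begin

definition nd :: "('v, 'e, 'c) node \<Rightarrow> real ^ 4" where "nd N = npos (nty N) (nix N)"

lemma cone_pt_nd: "cone_pt g N s \<alpha> \<beta> \<mu> = (1 - s) *\<^sub>R nd N + s *\<^sub>R ((1 - \<mu>) *\<^sub>R g \<alpha> + \<mu> *\<^sub>R g \<beta>)"
  by (simp only: cone_pt_def nd_def)

lemma cone_pt_0: "cone_pt g N 0 \<alpha> \<beta> \<mu> = nd N"
  by (simp add: cone_pt_nd)

text \<open>The choice is harmless: \<open>rep_cone_pt\<close> shows that all representations give
  the same value.\<close>

definition cell_draw :: "'c \<Rightarrow> real \<times> real \<Rightarrow> real ^ 4" where
  "cell_draw c q = (SOME z. \<exists>k s r \<mu>. rep c q k s r \<mu> \<and> z = cone_pt g (lab c k) r (e0 c s) (e1 c s) \<mu>)"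

text \<open>At \<open>r = 1\<close> the node drops out, at \<open>r = 0\<close> the segment does,
  and in between the region is unique. The link coordinates agree because \<open>weight\<close> sees
  only the point.\<close>

lemma rep_cone_pt:
  assumes "rep c q k s r \<mu>" "rep c q k' s' r' \<mu>'"
  shows "cone_pt g (lab c k) r (e0 c s) (e1 c s) \<mu> = cone_pt g (lab c k') r' (e0 c s') (e1 c s') \<mu>'"
proof -
  have u: "r = r'" "r \<noteq> 1 \<Longrightarrow> k = k'" "r \<noteq> 0 \<Longrightarrow> bd s \<mu> = bd s' \<mu>'" using rep_unique[OF assms] by simp_all
  have s: "s \<in> rim c k" "0 \<le> \<mu>" "\<mu> \<le> 1" "s' \<in> rim c k'" "0 \<le> \<mu>'" "\<mu>' \<le> 1" using assms by (simp_all add: rep_def)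
  have "(1 - \<mu>) *\<^sub>R g (e0 c s) + \<mu> *\<^sub>R g (e1 c s) = (1 - \<mu>') *\<^sub>R g (e0 c s') + \<mu>' *\<^sub>R g (e1 c s')" if "r \<noteq> 0"
    by (rule wt_point) (use u(3)[OF that] weight_bd[OF s(1-3)] weight_bd[OF s(4-6)] in simp)
  then show ?thesis using u(1,2) by (cases "r = 0"; cases "r = 1") (simp_all add: cone_pt_nd)
qed

lemma cell_draw_rep:
  assumes "rep c q k s r \<mu>"
  shows "cell_draw c q = cone_pt g (lab c k) r (e0 c s) (e1 c s) \<mu>"
proof -
  have "\<exists>k s r \<mu>. rep c q k s r \<mu> \<and> cell_draw c q = cone_pt g (lab c k) r (e0 c s) (e1 c s) \<mu>"
    unfolding cell_draw_def by (rule someI_ex) (intro exI conjI, rule assms, rule refl)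
  then obtain k' s' r' \<mu>' where "rep c q k' s' r' \<mu>'"
    "cell_draw c q = cone_pt g (lab c k') r' (e0 c s') (e1 c s') \<mu>'" by (elim exE conjE)
  then show ?thesis using rep_cone_pt[OF _ assms] by simp
qed

text \<open>\<open>cone_pt\<close> is not affine in \<open>(r, \<mu>)\<close>, but it is in the
  barycentric coordinates \<open>a = r * (1 - \<mu>)\<close> and \<open>b = r * \<mu>\<close>; this
  makes the drawing affine on each triangle.\<close>

lemma rep_sum:
  assumes s: "s \<in> rim c k" and ab: "0 \<le> a" "0 \<le> b" "a + b \<le> 1"
  obtains r \<mu> where "rep c (ctr c k + a *\<^sub>R (p0 s - ctr c k) + b *\<^sub>R (p1 s - ctr c k)) k s r \<mu>"
    "r * (1 - \<mu>) = a" "r * \<mu> = b" "r = a + b"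
proof -
  define r where "r = a + b"
  define \<mu> where "\<mu> = (if r = 0 then 0 else b / r)"
  have e: "r * \<mu> = b" "r * (1 - \<mu>) = a" using ab by (simp_all add: \<mu>_def r_def right_diff_distrib)
  have m: "0 \<le> \<mu>" "\<mu> \<le> 1" using ab by (simp_all add: \<mu>_def r_def divide_le_eq)
  have "r *\<^sub>R (bd s \<mu> - ctr c k) = (r * (1 - \<mu>)) *\<^sub>R p0 s + (r * \<mu>) *\<^sub>R p1 s - r *\<^sub>R ctr c k"
    unfolding bd_def by (simp only: scaleR_right_diff_distrib scaleR_add_right scaleR_scaleR)
  also have "\<dots> = a *\<^sub>R (p0 s - ctr c k) + b *\<^sub>R (p1 s - ctr c k)"
    unfolding e by (simp add: r_def scaleR_right_diff_distrib scaleR_add_left)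
  finally have "rep c (ctr c k + a *\<^sub>R (p0 s - ctr c k) + b *\<^sub>R (p1 s - ctr c k)) k s r \<mu>"
    using s ab m by (simp add: rep_def r_def add.assoc)
  then show thesis using that e r_def by metis
qed

lemma rim_det:
  assumes "s \<in> rim c k"
  shows "fst (p0 s - ctr c k) * snd (p1 s - ctr c k) \<noteq> snd (p0 s - ctr c k) * fst (p1 s - ctr c k)"
  using assms
  by (cases rule: rim_cases) (auto simp: of_nat_diff algebra_simps ht_def split: if_splits)

lemma pl_on_piece:
  assumes s: "s \<in> rim c k"
  shows "pl_on (convex hull {ctr c k, p0 s, p1 s}) (cell_draw c)"
proof -
  have "pl_on (convex hull {ctr c k, ctr c k + (p0 s - ctr c k), ctr c k + (p1 s - ctr c k)}) (cell_draw c)"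
  proof (rule pl_on_triangle[OF rim_det[OF s],
      where z = "nd (lab c k)" and x = "g (e0 c s) - nd (lab c k)" and y = "g (e1 c s) - nd (lab c k)"])
    fix a b :: real assume "0 \<le> a" "0 \<le> b" "a + b \<le> 1"
    then obtain r \<mu> where r: "rep c (ctr c k + a *\<^sub>R (p0 s - ctr c k) + b *\<^sub>R (p1 s - ctr c k)) k s r \<mu>"
      "r * (1 - \<mu>) = a" "r * \<mu> = b" "r = a + b" by (rule rep_sum[OF s])
    have r1: "1 - r = 1 - a - b" using r(4) by simp
    have "cone_pt g (lab c k) r (e0 c s) (e1 c s) \<mu>
      = (1 - r) *\<^sub>R nd (lab c k) + (r * (1 - \<mu>)) *\<^sub>R g (e0 c s) + (r * \<mu>) *\<^sub>R g (e1 c s)"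
      by (simp add: cone_pt_nd scaleR_add_right)
    also have "\<dots> = nd (lab c k) + a *\<^sub>R (g (e0 c s) - nd (lab c k)) + b *\<^sub>R (g (e1 c s) - nd (lab c k))"
      unfolding r(2,3) r1 by (simp add: algebra_simps)
    finally show "cell_draw c (ctr c k + a *\<^sub>R (p0 s - ctr c k) + b *\<^sub>R (p1 s - ctr c k))
      = nd (lab c k) + a *\<^sub>R (g (e0 c s) - nd (lab c k)) + b *\<^sub>R (g (e1 c s) - nd (lab c k))"
      unfolding cell_draw_rep[OF r(1)] .
  qed
  then show ?thesis by simp
qed

definition pieces :: "'c \<Rightarrow> (reg \<times> seg) set" where
  "pieces c = (SIGMA k:insert GM (GE ` {..<len c} \<union> GC ` {..<len c} \<union> GR ` {..<len c}). rim c k)"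

lemma in_pieces:
  assumes "s \<in> rim c k" shows "(k, s) \<in> pieces c"
proof -
  have "k \<in> insert GM (GE ` {..<len c} \<union> GC ` {..<len c} \<union> GR ` {..<len c})"
    using assms by (cases k) (auto split: if_splits)
  then show ?thesis using assms by (simp add: pieces_def)
qed

lemma pl_on_cell_draw:
  "pl_on (\<Union>(k, s)\<in>pieces c. convex hull {ctr c k, p0 s, p1 s}) (cell_draw c)"
proof (rule pl_on_UN)
  show "finite (pieces c)" unfolding pieces_def by (intro finite_SigmaI finite_rim) simp
  show "pl_on (case i of (k, s) \<Rightarrow> convex hull {ctr c k, p0 s, p1 s}) (cell_draw c)" if "i \<in> pieces c" for i
    using that by (cases i) (simp add: pieces_def pl_on_piece)
qed

lemma pl_on_cell:
  assumes c: "c \<in> cells X" and n: "0 < len c"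
  shows "pl_on disk (\<lambda>p. cell_draw c (chart c p))"
proof (rule pl_on_compose[OF _ pl_on_cell_draw[of c]])
  show "pl_on disk (chart c)"
    unfolding chart_def by (rule pl_on_radial[OF pl_on_loop[OF c n]])
  show "chart c ` disk \<subseteq> (\<Union>(k, s)\<in>pieces c. convex hull {ctr c k, p0 s, p1 s})"
  proof (rule image_subsetI)
    fix p assume "p \<in> disk"
    then have "pent c (chart c p - mid c) \<le> 1" using pent_chart[OF c n] by (simp add: disk_def)
    then obtain k s r \<mu> where r: "rep c (chart c p) k s r \<mu>" using pent_cover[OF n] by metis
    have rr: "s \<in> rim c k" "0 \<le> r" "r \<le> 1" "0 \<le> \<mu>" "\<mu> \<le> 1"
      "chart c p = ctr c k + r *\<^sub>R (bd s \<mu> - ctr c k)" using r by (simp_all add: rep_def)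
    have e: "chart c p = (1 - r) *\<^sub>R ctr c k + (r * (1 - \<mu>)) *\<^sub>R p0 s + (r * \<mu>) *\<^sub>R p1 s"
      unfolding rr(6) bd_def
      by (simp only: scaleR_right_diff_distrib scaleR_add_right scaleR_scaleR scaleR_left_diff_distrib scaleR_one) (simp add: algebra_simps)
    have "chart c p \<in> convex hull {ctr c k, p0 s, p1 s}"
      unfolding convex_hull_3 mem_Collect_eq
      by (rule exI[of _ "1 - r"], rule exI[of _ "r * (1 - \<mu>)"], rule exI[of _ "r * \<mu>"])
         (use rr(2-5) e mult_left_le[OF rr(5,2)] in \<open>simp add: right_diff_distrib\<close>)
    then show "chart c p \<in> (\<Union>(k, s)\<in>pieces c. convex hull {ctr c k, p0 s, p1 s})"
      using in_pieces[OF rr(1)] by (intro UN_I[of "(k, s)"]) simp_all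
  qed
qed

text \<open>
  An edge goes from the node of its source to the link vertex \<open>HE e True\<close>, the node of the edge, the
  link vertex \<open>HE e False\<close> and the node of its target, a quarter of the time each.
\<close>

definition half :: "'e \<Rightarrow> bool \<Rightarrow> real \<Rightarrow> real ^ 4" where
  "half e b t = (if t \<le> 1/4 then cone_pt g (NV (dart_tail X (e, b))) (4 * t) (HE e b) (HE e b) 0
     else cone_pt g (NE e) (2 - 4 * t) (HE e b) (HE e b) 0)"

definition draw :: "'e \<Rightarrow> real \<Rightarrow> real ^ 4" where
  "draw e t = (if t \<le> 1/2 then half e True t else half e False (1 - t))"

lemma half_pieces:
  "t \<le> 1/4 \<Longrightarrow> half e b t = cone_pt g (NV (dart_tail X (e, b))) (4 * t) (HE e b) (HE e b) 0"
  "1/4 \<le> t \<Longrightarrow> half e b t = cone_pt g (NE e) (2 - 4 * t) (HE e b) (HE e b) 0"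
proof -
  show "t \<le> 1/4 \<Longrightarrow> half e b t = cone_pt g (NV (dart_tail X (e, b))) (4 * t) (HE e b) (HE e b) 0"
    by (simp add: half_def)
  show "half e b t = cone_pt g (NE e) (2 - 4 * t) (HE e b) (HE e b) 0" if "1/4 \<le> t"
  proof (cases "t = 1/4")
    case True
    show ?thesis unfolding True by (simp add: half_def cone_pt_nd)
  qed (use that in \<open>simp add: half_def\<close>)
qed

lemma half_mid: "half e b (1/2) = nd (NE e)"
  using half_pieces(2)[of "1/2"] by (simp add: cone_pt_0)

lemma draw_pieces:
  "t \<le> 1/2 \<Longrightarrow> draw e t = half e True t" "1/2 \<le> t \<Longrightarrow> draw e t = half e False (1 - t)"
proof -
  show "t \<le> 1/2 \<Longrightarrow> draw e t = half e True t" by (simp add: draw_def)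
  show "draw e t = half e False (1 - t)" if "1/2 \<le> t"
  proof (cases "t = 1/2")
    case True
    show ?thesis unfolding True by (simp add: draw_def half_mid)
  qed (use that in \<open>simp add: draw_def\<close>)
qed

lemma draw_ends: "draw e 0 = nd (NV (src X e))" "draw e 1 = nd (NV (tgt X e))"
  by (simp_all add: draw_def half_def cone_pt_0 dart_tail_def)

lemma draw_dart:
  assumes "0 \<le> t" "t \<le> 1"
  shows "draw e (if b then t else 1 - t) = (if t \<le> 1/2 then half e b t else half e (\<not> b) (1 - t))"
proof (cases "t = 1/2")
  case True
  show ?thesis unfolding True by (simp add: draw_def half_mid)
qed (use draw_pieces[of t e] draw_pieces[of "1 - t" e] in \<open>cases b; simp\<close>)

lemma pl_on_draw: "pl_on {0..1} (draw e)"
proof -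
  let ?H = "\<lambda>b. g (HE e b)" and ?E = "nd (NE e)" and ?V = "\<lambda>b. nd (NV (dart_tail X (e, b)))"
  have V: "half e b t = (4 * t) *\<^sub>R ?H b + (1 - 4 * t) *\<^sub>R ?V b" if "t \<le> 1/4" for b t
    unfolding half_pieces(1)[OF that] by (simp add: cone_pt_nd)
  have E: "half e b t = (2 - 4 * t) *\<^sub>R ?H b + (4 * t - 1) *\<^sub>R ?E" if "1/4 \<le> t" for b t
    unfolding half_pieces(2)[OF that] by (simp add: cone_pt_nd)
  have 1: "pl_on {0..1/4} (draw e)"
  proof (rule pl_on_interval_affine[where u = "4 *\<^sub>R ?H True - 4 *\<^sub>R ?V True" and w = "?V True"])
    fix t :: real assume "0 \<le> t" "t \<le> 1/4"
    then show "draw e t = t *\<^sub>R (4 *\<^sub>R ?H True - 4 *\<^sub>R ?V True) + ?V True"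
      by (simp add: draw_pieces(1) V algebra_simps)
  qed
  have 2: "pl_on {1/4..1/2} (draw e)"
  proof (rule pl_on_interval_affine[where u = "4 *\<^sub>R ?E - 4 *\<^sub>R ?H True" and w = "2 *\<^sub>R ?H True - ?E"])
    fix t :: real assume "1/4 \<le> t" "t \<le> 1/2"
    then show "draw e t = t *\<^sub>R (4 *\<^sub>R ?E - 4 *\<^sub>R ?H True) + (2 *\<^sub>R ?H True - ?E)"
      by (simp add: draw_pieces(1) E algebra_simps)
  qed
  have 3: "pl_on {1/2..3/4} (draw e)"
  proof (rule pl_on_interval_affine[where u = "4 *\<^sub>R ?H False - 4 *\<^sub>R ?E" and w = "3 *\<^sub>R ?E - 2 *\<^sub>R ?H False"])
    fix t :: real assume t: "1/2 \<le> t" "t \<le> 3/4"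
    have e: "2 - 4 * (1 - t) = 4 * t - 2" "4 * (1 - t) - 1 = 3 - 4 * t" by simp_all
    have "draw e t = (4 * t - 2) *\<^sub>R ?H False + (3 - 4 * t) *\<^sub>R ?E"
      using E[of "1 - t" False, unfolded e] t by (simp add: draw_pieces(2))
    then show "draw e t = t *\<^sub>R (4 *\<^sub>R ?H False - 4 *\<^sub>R ?E) + (3 *\<^sub>R ?E - 2 *\<^sub>R ?H False)"
      by (simp add: algebra_simps)
  qed
  have 4: "pl_on {3/4..1} (draw e)"
  proof (rule pl_on_interval_affine[where u = "4 *\<^sub>R ?V False - 4 *\<^sub>R ?H False" and w = "4 *\<^sub>R ?H False - 3 *\<^sub>R ?V False"])
    fix t :: real assume t: "3/4 \<le> t" "t \<le> 1"
    have e: "4 * (1 - t) = 4 - 4 * t" "1 - (4 - 4 * t) = 4 * t - 3" by simp_all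
    have "draw e t = (4 - 4 * t) *\<^sub>R ?H False + (4 * t - 3) *\<^sub>R ?V False"
      using V[of "1 - t" False, unfolded e] t by (simp add: draw_pieces(2))
    then show "draw e t = t *\<^sub>R (4 *\<^sub>R ?V False - 4 *\<^sub>R ?H False) + (4 *\<^sub>R ?H False - 3 *\<^sub>R ?V False)"
      by (simp add: algebra_simps)
  qed
  have a: "pl_on {0..1/2} (draw e)" by (rule pl_on_interval_split[OF 1 2]) simp_all
  have b: "pl_on {1/2..1} (draw e)" by (rule pl_on_interval_split[OF 3 4]) simp_all
  show ?thesis by (rule pl_on_interval_split[OF a b]) simp_all
qed

lemma cell_draw_end:
  assumes s: "s \<in> rim c k" and r: "0 \<le> r" "r \<le> 1"
  shows "q = ctr c k + r *\<^sub>R (p0 s - ctr c k) \<Longrightarrow> cell_draw c q = cone_pt g (lab c k) r (e0 c s) (e0 c s) 0"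
    "q = ctr c k + r *\<^sub>R (p1 s - ctr c k) \<Longrightarrow> cell_draw c q = cone_pt g (lab c k) r (e1 c s) (e1 c s) 0"
proof -
  have b: "bd s 0 = p0 s" "bd s 1 = p1 s" by (simp_all add: bd_def)
  show "cell_draw c q = cone_pt g (lab c k) r (e0 c s) (e0 c s) 0" if "q = ctr c k + r *\<^sub>R (p0 s - ctr c k)"
    using cell_draw_rep[of c q k s r 0] s r that by (simp add: rep_def b cone_pt_nd)
  show "cell_draw c q = cone_pt g (lab c k) r (e1 c s) (e1 c s) 0" if "q = ctr c k + r *\<^sub>R (p1 s - ctr c k)"
    using cell_draw_rep[of c q k s r 1] s r that by (simp add: rep_def b cone_pt_nd)
qed

text \<open>The first half of a dart goes from the node of the corner through the link vertex
  \<open>st c j\<close> to the node of the edge. For \<open>j = 0\<close> the corner star is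
  \<open>GM\<close>.\<close>

lemma cell_draw_perim_start:
  assumes c: "c \<in> cells X" and j: "j < len c" and t: "0 \<le> t" "t \<le> 1/2"
  shows "cell_draw c (perim (len c) (real j + t)) = half (ed c j) (snd (dt c j)) t"
proof -
  have n: "0 < len c" and N: "1 \<le> real (len c)" using j by simp_all
  have tail: "dart_tail X (ed c j, snd (dt c j)) = vx c j" by (simp add: vx_def)
  note half = half_pieces[of t "ed c j" "snd (dt c j)", unfolded tail, folded st_def]
  have P: "perim (len c) (real j + t) = (4 * real j + 4 * t, 0)" if "j \<noteq> 0"
    using perim_pieces(3)[OF N, of "real j + t"] t j that by (simp add: Suc_le_eq)
  have S: "SD j 2 0 \<in> rim c (GC j)" "SD j 2 0 \<in> rim c (GE j)" if "j \<noteq> 0" using j that by simp_all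
  have T: "TL 0 \<in> rim c GM" "TL 0 \<in> rim c (GE 0)" using n by simp_all
  consider "t \<le> 1/4" | "1/4 \<le> t" by linarith
  then show ?thesis
  proof cases
    case 1
    have r: "0 \<le> 4 * t" "4 * t \<le> 1" using t 1 by simp_all
    show ?thesis
    proof (cases "j = 0")
      case True
      have "perim (len c) (real j + t) = ctr c GM + (4 * t) *\<^sub>R (p0 (TL 0) - ctr c GM)"
        using perim_pieces(1)[OF N t(1) 1] True by (simp add: algebra_simps)
      from cell_draw_end(1)[OF T(1) r this] show ?thesis
        unfolding half(1)[OF 1] by (simp add: True top_left_def vx_0[OF c n])
    next
      case False
      have "perim (len c) (real j + t) = ctr c (GC j) + (4 * t) *\<^sub>R (p0 (SD j 2 0) - ctr c (GC j))"
        unfolding P[OF False] by simp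
      from cell_draw_end(1)[OF S(1)[OF False] r this] show ?thesis
        unfolding half(1)[OF 1] by (simp add: side_def)
    qed
  next
    case 2
    have r: "0 \<le> 2 - 4 * t" "2 - 4 * t \<le> 1" using t 2 by simp_all
    show ?thesis
    proof (cases "j = 0")
      case True
      have "perim (len c) (real j + t) = ctr c (GE 0) + (2 - 4 * t) *\<^sub>R (p0 (TL 0) - ctr c (GE 0))"
        using perim_pieces(2)[OF N 2 t(2)] True by (simp add: algebra_simps)
      from cell_draw_end(1)[OF T(2) r this] show ?thesis
        unfolding half(2)[OF 2] by (simp add: True top_left_def)
    next
      case False
      have "perim (len c) (real j + t) = ctr c (GE j) + (2 - 4 * t) *\<^sub>R (p0 (SD j 2 0) - ctr c (GE j))"
        unfolding P[OF False] by simp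
      from cell_draw_end(1)[OF S(2)[OF False] r this] show ?thesis
        unfolding half(2)[OF 2] by (simp add: side_def)
    qed
  qed
qed

lemma cell_draw_perim_end:
  assumes c: "c \<in> cells X" and j: "j < len c" and t: "0 \<le> t" "t \<le> 1/2"
  shows "cell_draw c (perim (len c) (real j + 1 - t)) = half (ed c j) (\<not> snd (dt c j)) t"
proof -
  have n: "0 < len c" and N: "1 \<le> real (len c)" using j by simp_all
  have tail: "dart_tail X (ed c j, \<not> snd (dt c j)) = vx c (Suc j)"
    using head_dt[OF c n] by (simp add: dart_tail_flip)
  note half = half_pieces[of t "ed c j" "\<not> snd (dt c j)", unfolded tail, folded en_def]
  have P: "perim (len c) (real j + 1 - t) = (4 * real j + 4 - 4 * t, 0)" if "Suc j < len c"
  proof -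
    have "real j + 2 \<le> real (len c)" using that by linarith
    then show ?thesis using perim_pieces(3)[OF N, of "real j + 1 - t"] t by simp
  qed
  have S: "SD (Suc j) 0 0 \<in> rim c (GC (Suc j))" "SD (Suc j) 0 0 \<in> rim c (GE j)" if "Suc j < len c"
    using j that by simp_all
  have T: "TR j \<in> rim c GM" "TR j \<in> rim c (GE j)" using j by simp_all
  have last: "Suc j = len c" "real (len c) = real j + 1" if "\<not> Suc j < len c" using j that by linarith+
  consider "t \<le> 1/4" | "1/4 \<le> t" by linarith
  then show ?thesis
  proof cases
    case 1
    have r: "0 \<le> 4 * t" "4 * t \<le> 1" using t 1 by simp_all
    show ?thesis
    proof (cases "Suc j < len c")
      case False
      have "perim (len c) (real j + 1 - t) = ctr c GM + (4 * t) *\<^sub>R (p1 (TR j) - ctr c GM)"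
        using perim_pieces(5)[OF N, of "real j + 1 - t"] last(2)[OF False] t 1 by (simp add: algebra_simps)
      from cell_draw_end(2)[OF T(1) r this] show ?thesis
        unfolding half(1)[OF 1] by (simp add: last(1)[OF False] top_right_def vx_len[OF c n])
    next
      case True
      have "perim (len c) (real j + 1 - t) = ctr c (GC (Suc j)) + (4 * t) *\<^sub>R (p0 (SD (Suc j) 0 0) - ctr c (GC (Suc j)))"
        unfolding P[OF True] by simp
      from cell_draw_end(1)[OF S(1)[OF True] r this] show ?thesis
        unfolding half(1)[OF 1] by (simp add: side_def)
    qed
  next
    case 2
    have r: "0 \<le> 2 - 4 * t" "2 - 4 * t \<le> 1" using t 2 by simp_all
    show ?thesis
    proof (cases "Suc j < len c")
      case False
      have "perim (len c) (real j + 1 - t) = ctr c (GE j) + (2 - 4 * t) *\<^sub>R (p1 (TR j) - ctr c (GE j))"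
        using perim_pieces(4)[OF N, of "real j + 1 - t"] last(2)[OF False] t 2 by (simp add: algebra_simps)
      from cell_draw_end(2)[OF T(2) r this] show ?thesis
        unfolding half(2)[OF 2] by (simp add: last(1)[OF False] top_right_def)
    next
      case True
      have "perim (len c) (real j + 1 - t) = ctr c (GE j) + (2 - 4 * t) *\<^sub>R (p0 (SD (Suc j) 0 0) - ctr c (GE j))"
        unfolding P[OF True] by simp
      from cell_draw_end(1)[OF S(2)[OF True] r this] show ?thesis
        unfolding half(2)[OF 2] by (simp add: side_def)
    qed
  qed
qed

text \<open>The gluing condition: the drawings of cells and edges fit together to a map on the
  quotient.\<close>

lemma cell_draw_boundary:
  assumes c: "c \<in> cells X" and n: "0 < len c" and p: "l1 p = 1"
  defines "s \<equiv> real (len c) * circ p"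
  shows "cell_draw c (chart c p) = draw (fst (walk X c ! nat \<lfloor>s\<rfloor>))
      (if snd (walk X c ! nat \<lfloor>s\<rfloor>) then frac s else 1 - frac s)"
proof -
  note cp = l1_boundary_circ[OF p]
  obtain t where t: "0 \<le> t" "t < real (len c)" "loop c (circ p) = perim (len c) t"
    "t = real (len c) * circ p - real (off c) \<and> real (off c) \<le> real (len c) * circ p \<or>
     t = real (len c) * circ p - real (off c) + real (len c) \<and> real (len c) * circ p < real (off c)"
    by (rule loop_time[OF c n cp])
  define i where "i = nat \<lfloor>s\<rfloor>"
  define \<phi> where "\<phi> = frac s"
  have s0: "0 \<le> s" "s < real (len c)" using cp n by (simp_all add: s_def)
  have \<phi>: "0 \<le> \<phi>" "\<phi> \<le> 1" using frac_ge_0[of s] frac_lt_1[of s] unfolding \<phi>_def by linarith+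
  have "real i = of_int \<lfloor>s\<rfloor>" using s0(1) by (simp add: i_def)
  then have s: "s = real i + \<phi>" by (simp add: \<phi>_def frac_def)
  have i: "i < len c" using s s0(2) \<phi>(1) by linarith
  have \<phi>1: "\<phi> < 1" unfolding \<phi>_def by (rule frac_lt_1)
  \<comment> \<open>The position of the \<open>i\<close>-th dart in the rotated walk.\<close>
  define j where "j = (if off c \<le> i then i - off c else i + len c - off c)"
  have o: "off c < len c" by (rule off(1)[OF c n])
  have j: "j < len c" using i o by (auto simp: j_def)
  have dj: "dt c j = walk X c ! i"
  proof -
    have "off c + j = i \<or> off c + j = i + len c" using o by (auto simp: j_def)
    then have "(off c + j) mod len c = i" using i by auto
    then show ?thesis by (simp add: dt_def)
  qed
  have oi: "real (off c) \<le> s \<longleftrightarrow> off c \<le> i"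
  proof
    assume "real (off c) \<le> s"
    then have "real (off c) < real i + 1" using s \<phi>1 by linarith
    then show "off c \<le> i" by linarith
  qed (use s \<phi>(1) in linarith)
  have tj: "t = real j + \<phi>"
  proof (cases "off c \<le> i")
    case True
    then have "t = s - real (off c)" using t(4) oi s_def by linarith
    then show ?thesis using True s by (simp add: j_def of_nat_diff)
  next
    case False
    then have "t = s - real (off c) + real (len c)" using t(4) oi s_def by linarith
    then show ?thesis using False s o by (simp add: j_def of_nat_diff)
  qed
  have "chart c p = perim (len c) t" by (simp add: chart_def radial_boundary[OF p] t(3))
  moreover have "cell_draw c (perim (len c) t) = (if \<phi> \<le> 1/2 then half (ed c j) (snd (dt c j)) \<phi>
      else half (ed c j) (\<not> snd (dt c j)) (1 - \<phi>))"
  proof (cases "\<phi> \<le> 1/2")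
    case True
    then show ?thesis unfolding tj using cell_draw_perim_start[OF c j \<phi>(1)] by simp
  next
    case False
    have "cell_draw c (perim (len c) (real j + 1 - (1 - \<phi>))) = half (ed c j) (\<not> snd (dt c j)) (1 - \<phi>)"
      by (rule cell_draw_perim_end[OF c j]) (use False \<phi> in simp_all)
    moreover have "real j + 1 - (1 - \<phi>) = real j + \<phi>" by simp
    ultimately show ?thesis unfolding tj using False by simp
  qed
  ultimately show ?thesis
    using draw_dart[OF \<phi>, of "ed c j" "snd (dt c j)"] by (simp only: dj i_def \<phi>_def)
qed

end

section \<open>Spheres\<close>

text \<open>The signs of the coordinates are constant on each of the eight faces, so positive and
  negative parts are linear there.\<close>

lemma pl_on_octa:
  fixes a a' b b' c c' :: "'a::euclidean_space"
  shows "pl_on octa (\<lambda>q. max 0 (fst (fst q)) *\<^sub>R a + max 0 (- fst (fst q)) *\<^sub>R a'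
    + max 0 (snd (fst q)) *\<^sub>R b + max 0 (- snd (fst q)) *\<^sub>R b' + max 0 (snd q) *\<^sub>R c + max 0 (- snd q) *\<^sub>R c')"
    (is "pl_on octa ?f")
proof -
  let ?S = "{-1, 1} :: real set"
  define face where "face = (\<lambda>(\<sigma>, \<tau>, \<rho>). convex hull {((\<sigma>, 0), 0), ((0, \<tau>), 0), ((0, 0), \<rho>)} :: ((real \<times> real) \<times> real) set)"
  have face: "q \<in> face (\<sigma>, \<tau>, \<rho>) \<longleftrightarrow> (\<exists>x y z. q = ((x * \<sigma>, y * \<tau>), z * \<rho>) \<and> 0 \<le> x \<and> 0 \<le> y \<and> 0 \<le> z \<and> x + y + z = 1)" for q \<sigma> \<tau> \<rho>
    by (simp add: face_def convex_hull_3)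
  have "pl_on (\<Union>i\<in>?S \<times> ?S \<times> ?S. face i) ?f"
  proof (rule pl_on_UN)
    fix i assume "i \<in> ?S \<times> ?S \<times> ?S"
    then obtain \<sigma> \<tau> \<rho> where i: "i = (\<sigma>, \<tau>, \<rho>)" "\<sigma> = -1 \<or> \<sigma> = 1" "\<tau> = -1 \<or> \<tau> = 1" "\<rho> = -1 \<or> \<rho> = 1" by auto
    have m: "max 0 t *\<^sub>R u + max 0 (- t) *\<^sub>R u' = t *\<^sub>R (if s = 1 then u else - u')"
      if "t = x * s" "0 \<le> x" "s = -1 \<or> s = 1" for t x s and u u' :: 'a
      using that by (auto simp: max_def)
    let ?A = "\<lambda>q. fst (fst q) *\<^sub>R (if \<sigma> = 1 then a else - a') + snd (fst q) *\<^sub>R (if \<tau> = 1 then b else - b')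
       + snd q *\<^sub>R (if \<rho> = 1 then c else - c')"
    show "pl_on (face i) ?f"
    proof (rule pl_on_affine[where A = ?A and b = 0])
      show "polytope (face i)" unfolding i(1) face_def by (simp add: polytope_convex_hull)
      show "linear ?A" by (rule linearI) (simp_all add: algebra_simps)
      fix q assume "q \<in> face i"
      then obtain x y z where q: "0 \<le> x" "0 \<le> y" "0 \<le> z" "q = ((x * \<sigma>, y * \<tau>), z * \<rho>)"
        unfolding i(1) face by (elim exE conjE)
      show "?f q = ?A q + 0"
        using m[OF _ q(1) i(2), of "fst (fst q)" a a'] m[OF _ q(2) i(3), of "snd (fst q)" b b'] m[OF _ q(3) i(4), of "snd q" c c']
        by (simp add: q(4) add.assoc[symmetric])
    qed
  qed simp
  moreover have "(\<Union>i\<in>?S \<times> ?S \<times> ?S. face i) = octa"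
  proof (intro equalityI subsetI)
    fix q assume "q \<in> (\<Union>i\<in>?S \<times> ?S \<times> ?S. face i)"
    then obtain \<sigma> \<tau> \<rho> where i: "\<sigma> = -1 \<or> \<sigma> = 1" "\<tau> = -1 \<or> \<tau> = 1" "\<rho> = -1 \<or> \<rho> = 1" "q \<in> face (\<sigma>, \<tau>, \<rho>)"
      by (elim UN_E) auto
    from i(4) obtain x y z where q: "0 \<le> x" "0 \<le> y" "0 \<le> z" "x + y + z = 1" "q = ((x * \<sigma>, y * \<tau>), z * \<rho>)"
      unfolding face by (elim exE conjE)
    have "\<bar>x * \<sigma>\<bar> = x" "\<bar>y * \<tau>\<bar> = y" "\<bar>z * \<rho>\<bar> = z" using q(1-3) i(1-3) by auto
    then show "q \<in> octa" using q(4) by (simp add: q(5) octa_def l1_def)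
  next
    fix q :: "(real \<times> real) \<times> real" assume q: "q \<in> octa"
    define sg where "sg = (\<lambda>t::real. if 0 \<le> t then 1 else -1 :: real)"
    have sg: "\<bar>t\<bar> * sg t = t" "sg t \<in> ?S" for t by (simp_all add: sg_def)
    have "q \<in> face (sg (fst (fst q)), sg (snd (fst q)), sg (snd q))"
      unfolding face
      by (rule exI[of _ "\<bar>fst (fst q)\<bar>"], rule exI[of _ "\<bar>snd (fst q)\<bar>"], rule exI[of _ "\<bar>snd q\<bar>"])
         (use q in \<open>simp add: sg(1) octa_def l1_def\<close>)
    then show "q \<in> (\<Union>i\<in>?S \<times> ?S \<times> ?S. face i)" by (rule UN_I[rotated]) (simp only: mem_Times_iff fst_conv snd_conv sg(2) simp_thms)
  qed
  ultimately show ?thesis by simp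
qed

lemma collapse_octa: "p \<in> disk \<Longrightarrow> collapse p \<in> octa"
proof -
  assume p: "p \<in> disk"
  show ?thesis
  proof (cases "p = 0")
    case True
    then show ?thesis by (simp add: collapse_def octa_def l1_def)
  next
    case False
    then have l: "0 < l1 p" "l1 p \<le> 1" using p l1_nonneg[of p] l1_eq_0[of p] by (simp_all add: disk_def)
    then have "0 \<le> 2 * min (l1 p) (1 - l1 p) / l1 p" by simp
    then have "l1 (fst (collapse p)) = 2 * min (l1 p) (1 - l1 p)" using l by (simp only: collapse_def fst_conv l1_scale) simp
    then show ?thesis using l by (simp add: octa_def min_def) (simp add: collapse_def)
  qed
qed

lemma collapse_inj:
  assumes "l1 p < 1" "l1 p' < 1" "collapse p = collapse p'"
  shows "p = p'"
proof -
  have l: "l1 p = l1 p'" using assms(3) by (simp add: collapse_def)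
  show ?thesis
  proof (cases "p = 0 \<or> p' = 0")
    case True
    then show ?thesis using l l1_eq_0 by metis
  next
    case False
    then have "0 < l1 p'" using l1_nonneg[of p'] l1_eq_0[of p'] by linarith
    then have "2 * min (l1 p') (1 - l1 p') / l1 p' \<noteq> 0" using assms(2) by (simp add: min_def)
    moreover have "(2 * min (l1 p') (1 - l1 p') / l1 p') *\<^sub>R p = (2 * min (l1 p') (1 - l1 p') / l1 p') *\<^sub>R p'"
      using assms(3) l by (simp add: collapse_def)
    ultimately show ?thesis by (simp only: scaleR_cancel_left) simp
  qed
qed

text \<open>Up to level 1/2 the planar part just doubles \<open>p\<close>, so the division by
  \<open>l1 p\<close> is only apparent; beyond that level \<open>l1 p\<close> is bounded away from
  0.\<close>

lemma continuous_on_collapse: "continuous_on disk collapse"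
proof -
  have l1: "continuous_on A l1" for A unfolding l1_def by (intro continuous_intros)
  have cl: "closed {p. l1 p \<le> 1/2}" "closed {p. 1/2 \<le> l1 p \<and> l1 p \<le> 1}"
    by (intro closed_Collect_le closed_Collect_conj l1 continuous_intros)+
  have 1: "continuous_on {p. l1 p \<le> 1/2} collapse"
  proof (rule continuous_on_eq[where f = "\<lambda>p. (2 *\<^sub>R p, 1 - 2 * l1 p)"])
    show "continuous_on {p. l1 p \<le> 1/2} (\<lambda>p. (2 *\<^sub>R p, 1 - 2 * l1 p))"
      by (intro continuous_intros l1)
    fix p :: "real \<times> real" assume "p \<in> {p. l1 p \<le> 1/2}"
    then show "(2 *\<^sub>R p, 1 - 2 * l1 p) = collapse p"
      by (cases "p = 0") (simp_all add: collapse_def min_def l1_eq_0)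
  qed
  have 2: "continuous_on {p. 1/2 \<le> l1 p \<and> l1 p \<le> 1} collapse"
    unfolding collapse_def by (intro continuous_intros l1) auto
  have "disk = {p. l1 p \<le> 1/2} \<union> {p. 1/2 \<le> l1 p \<and> l1 p \<le> 1}" by (auto simp: disk_def)
  then show ?thesis using continuous_on_closed_Un[OF cl 1 2] by simp
qed

section \<open>The embedding\<close>

context two_apex_drawing
begin

text \<open>A suspension: the equator runs through four link vertices on the wall between the apex
  and an auxiliary disk, and the poles are the two nodes. The south pole, to which the boundary of
  the disk collapses, goes to the apex.\<close>

definition sphere_draw :: "'c \<Rightarrow> (real \<times> real) \<times> real \<Rightarrow> real ^ 4" where
  "sphere_draw c q = max 0 (fst (fst q)) *\<^sub>R g (Cor c 0 0 0) + max 0 (- fst (fst q)) *\<^sub>R g (Cor c 0 2 0)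
    + max 0 (snd (fst q)) *\<^sub>R g (Cor c 0 1 0) + max 0 (- snd (fst q)) *\<^sub>R g (Cor c 0 3 0)
    + max 0 (snd q) *\<^sub>R nd (NR c 0) + max 0 (- snd q) *\<^sub>R nd (NV (apex c))"

definition xlv :: "'c \<Rightarrow> (real \<times> real) \<times> real \<Rightarrow> ('e, 'c) lvert" where
  "xlv c q = Cor c 0 (if 0 \<le> fst (fst q) then 0 else 2) 0"
definition ylv :: "'c \<Rightarrow> (real \<times> real) \<times> real \<Rightarrow> ('e, 'c) lvert" where
  "ylv c q = Cor c 0 (if 0 \<le> snd (fst q) then 1 else 3) 0"
definition pole :: "'c \<Rightarrow> (real \<times> real) \<times> real \<Rightarrow> ('v, 'e, 'c) node" where
  "pole c q = (if 0 \<le> snd q then NR c 0 else NV (apex c))"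
definition yratio :: "(real \<times> real) \<times> real \<Rightarrow> real" where
  "yratio q = (if l1 (fst q) = 0 then 0 else \<bar>snd (fst q)\<bar> / l1 (fst q))"

lemma yratio:
  "0 \<le> yratio q" "yratio q \<le> 1" "l1 (fst q) * yratio q = \<bar>snd (fst q)\<bar>"
  "l1 (fst q) * (1 - yratio q) = \<bar>fst (fst q)\<bar>"
proof -
  have l: "0 \<le> l1 (fst q)" by (rule l1_nonneg)
  then show "0 \<le> yratio q" by (simp add: yratio_def)
  have "\<bar>snd (fst q)\<bar> \<le> l1 (fst q)" by (simp add: l1_def)
  then show "yratio q \<le> 1" using l by (simp add: yratio_def divide_le_eq)
  show e: "l1 (fst q) * yratio q = \<bar>snd (fst q)\<bar>" by (auto simp: yratio_def l1_def)
  show "l1 (fst q) * (1 - yratio q) = \<bar>fst (fst q)\<bar>"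
    using e by (simp add: right_diff_distrib) (simp add: l1_def)
qed

lemma sphere_draw_cone:
  assumes "q \<in> octa"
  shows "sphere_draw c q = cone_pt g (pole c q) (l1 (fst q)) (xlv c q) (ylv c q) (yratio q)"
proof -
  let ?s = "l1 (fst q)"
  have "cone_pt g (pole c q) ?s (xlv c q) (ylv c q) (yratio q)
    = (1 - ?s) *\<^sub>R nd (pole c q) + (?s * (1 - yratio q)) *\<^sub>R g (xlv c q) + (?s * yratio q) *\<^sub>R g (ylv c q)"
    by (simp add: cone_pt_nd scaleR_add_right)
  also have "1 - ?s = \<bar>snd q\<bar>" using assms by (simp add: octa_def)
  also have "\<bar>snd q\<bar> *\<^sub>R nd (pole c q) + (?s * (1 - yratio q)) *\<^sub>R g (xlv c q) + (?s * yratio q) *\<^sub>R g (ylv c q)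
     = sphere_draw c q"
    unfolding yratio by (simp add: sphere_draw_def pole_def xlv_def ylv_def max_def)
  finally show ?thesis by simp
qed

text \<open>\<open>xlv\<close> and \<open>ylv\<close> take at most one vertex of each opposite pair,
  so differences of weights return the signed coordinates.\<close>

lemma sphere_weights:
  fixes c q
  defines "W \<equiv> wt (xlv c q) (ylv c q) (yratio q)"
  shows "l1 (fst q) * (W (Cor c 0 0 0) - W (Cor c 0 2 0)) = fst (fst q)"
    "l1 (fst q) * (W (Cor c 0 1 0) - W (Cor c 0 3 0)) = snd (fst q)"
proof -
  have "W (Cor c 0 0 0) - W (Cor c 0 2 0) = (1 - yratio q) * (if 0 \<le> fst (fst q) then 1 else -1)"
    by (simp add: W_def wt_def xlv_def ylv_def)
  then have "l1 (fst q) * (W (Cor c 0 0 0) - W (Cor c 0 2 0)) = \<bar>fst (fst q)\<bar> * (if 0 \<le> fst (fst q) then 1 else -1)"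
    using yratio(4)[of q] by (metis mult.assoc)
  then show "l1 (fst q) * (W (Cor c 0 0 0) - W (Cor c 0 2 0)) = fst (fst q)" by (simp split: if_splits)
  have "W (Cor c 0 1 0) - W (Cor c 0 3 0) = yratio q * (if 0 \<le> snd (fst q) then 1 else -1)"
    by (simp add: W_def wt_def xlv_def ylv_def)
  then have "l1 (fst q) * (W (Cor c 0 1 0) - W (Cor c 0 3 0)) = \<bar>snd (fst q)\<bar> * (if 0 \<le> snd (fst q) then 1 else -1)"
    using yratio(3)[of q] by (metis mult.assoc)
  then show "l1 (fst q) * (W (Cor c 0 1 0) - W (Cor c 0 3 0)) = snd (fst q)" by (simp split: if_splits)
qed

fun emb :: "('v, 'e, 'c) point \<Rightarrow> real ^ 4" where
  "emb (Vert y) = nd (NV y)"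
| "emb (EdgePt e t) = draw e t"
| "emb (CellPt c p) = (if len c = 0 then sphere_draw c (collapse p) else cell_draw c (chart c p))"

lemma emb_edge: "0 \<le> t \<Longrightarrow> t \<le> 1 \<Longrightarrow> emb (edge_map X e t) = draw e t"
  by (auto simp: edge_map_def draw_ends)

lemma emb_cell:
  assumes c: "c \<in> cells X" and n: "0 < len c" and p: "p \<in> disk"
  shows "emb (cell_map X c p) = cell_draw c (chart c p)"
proof (cases "l1 p < 1")
  case True
  then show ?thesis using n by (simp add: cell_map_def)
next
  case False
  then have p1: "l1 p = 1" using p by (simp add: disk_def)
  let ?s = "real (length (walk X c)) * circ p"
  have ne: "walk X c \<noteq> []" using n by (auto simp: len_def)
  have f: "0 \<le> frac ?s" "frac ?s \<le> 1" using frac_ge_0[of ?s] frac_lt_1[of ?s] by linarith+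
  have "emb (cell_map X c p) = draw (fst (walk X c ! nat \<lfloor>?s\<rfloor>))
      (if snd (walk X c ! nat \<lfloor>?s\<rfloor>) then frac ?s else 1 - frac ?s)"
    using ne p1 f by (simp add: cell_map_def walk_map_def dart_map_def emb_edge del: frac_ge_0)
  also have "\<dots> = cell_draw c (chart c p)"
    using cell_draw_boundary[OF c n p1] by (simp add: len_def)
  finally show ?thesis .
qed

lemma emb_sphere:
  assumes c: "c \<in> cells X" and n: "len c = 0" and p: "p \<in> disk"
  shows "emb (cell_map X c p) = sphere_draw c (collapse p)"
proof (cases "l1 p < 1")
  case True
  then show ?thesis using n by (simp add: cell_map_def)
next
  case False
  then have p1: "l1 p = 1" using p by (simp add: disk_def)
  have e: "walk X c = []" using n by (simp add: len_def)
  \<comment> \<open>A trivial walk is incident with its base point only.\<close>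
  then have "apex c = base X c" using apex_incident[OF c] by (simp add: incident_def)
  then show ?thesis using p1 e by (simp add: cell_map_def walk_map_def collapse_def sphere_draw_def)
qed

lemma pl_on_sphere_draw: "pl_on octa (sphere_draw c)"
  using pl_on_octa by (simp add: sphere_draw_def[abs_def])

lemma pl_map_emb: "pl_map X emb"
proof -
  have "pl_on {0..1} (\<lambda>t. emb (edge_map X e t))" for e
    by (rule pl_on_cong[OF pl_on_draw[of e]]) (simp add: emb_edge)
  moreover have "\<exists>h. pl_on octa h \<and> (\<forall>p\<in>disk. emb (cell_map X c p) = h (collapse p))"
    if "c \<in> cells X" "walk X c = []" for c
    using pl_on_sphere_draw emb_sphere[OF that(1)] that(2) by (intro exI[of _ "sphere_draw c"]) (simp add: len_def)
  moreover have "pl_on disk (\<lambda>p. emb (cell_map X c p))" if c: "c \<in> cells X" "walk X c \<noteq> []" for c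
  proof -
    have n: "0 < len c" using c by (simp add: len_def)
    show ?thesis by (rule pl_on_cong[OF pl_on_cell[OF c(1) n]]) (simp add: emb_cell[OF c(1) n])
  qed
  ultimately show ?thesis unfolding pl_map_def by simp
qed

lemma continuous_emb: "continuous_map (cw_space X) euclidean emb"
proof (rule continuous_map_cw_space[OF fin])
  show "continuous_on {0..1} (\<lambda>t. emb (edge_map X e t))" if "e \<in> edges X" for e
    using pl_map_emb that unfolding pl_map_def by (intro pl_on_imp_continuous_on) simp
  show "continuous_on disk (\<lambda>p. emb (cell_map X c p))" if c: "c \<in> cells X" for c
  proof (cases "len c = 0")
    case True
    have "continuous_on disk (\<lambda>p. sphere_draw c (collapse p))"
      by (rule continuous_on_compose2[OF pl_on_imp_continuous_on[OF pl_on_sphere_draw] continuous_on_collapse])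
         (use collapse_octa in blast)
    then show ?thesis
      by (rule continuous_on_eq) (simp add: emb_sphere[OF c True])
  next
    case False
    then have n: "0 < len c" by simp
    have "continuous_on disk (\<lambda>p. cell_draw c (chart c p))"
      by (rule pl_on_imp_continuous_on[OF pl_on_cell[OF c n]])
    then show ?thesis
      by (rule continuous_on_eq) (simp add: emb_cell[OF c n])
  qed
qed

text \<open>
  Every point lies on a segment from a node to a point of a wall. Whether it is in the graph or in
  which 2-cell can be read off from the node if the parameter is 0, and from the link vertices of
  nonzero weight otherwise.
\<close>

definition coords :: "('v, 'e, 'c) point \<Rightarrow> ('v, 'e, 'c) node \<Rightarrow> real \<Rightarrow> ('e, 'c) lvert \<Rightarrow> ('e, 'c) lvert \<Rightarrow> real \<Rightarrow> bool" where
  "coords x N s \<alpha> \<beta> \<mu> \<longleftrightarrow> emb x = cone_pt g N s \<alpha> \<beta> \<mu> \<and> N \<in> nodes \<and> (s = 0 \<or> lk N \<alpha> \<beta>)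
     \<and> 0 \<le> \<mu> \<and> \<mu> \<le> 1 \<and> 0 \<le> s \<and> s \<le> 1"

lemma coords_unique:
  assumes "coords x N s \<alpha> \<beta> \<mu>" "coords x' N' s' \<alpha>' \<beta>' \<mu>'" "emb x = emb x'"
  shows "s = s'" "s \<noteq> 1 \<Longrightarrow> N = N'" "s \<noteq> 0 \<Longrightarrow> wt \<alpha> \<beta> \<mu> = wt \<alpha>' \<beta>' \<mu>'"
  using cone_pt_inj[OF g, of N s \<alpha> \<beta> \<mu> N' s' \<alpha>' \<beta>' \<mu>'] assms by (simp_all add: coords_def)

fun lcell :: "('e, 'c) lvert \<Rightarrow> 'c option" where
  "lcell (HE e b) = None" | "lcell (Mid c j) = Some c" | "lcell (Cor c j i y) = Some c"
fun ncell :: "('v, 'e, 'c) node \<Rightarrow> 'c option" where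
  "ncell (NR c j) = Some c" | "ncell _ = None"
fun pcell :: "('v, 'e, 'c) point \<Rightarrow> 'c option" where
  "pcell (CellPt c p) = Some c" | "pcell _ = None"

lemma lcell_None: "lcell \<kappa> = None \<longleftrightarrow> is_HE \<kappa>"
  by (cases \<kappa>) simp_all

definition locates :: "'c option \<Rightarrow> ('v, 'e, 'c) node \<Rightarrow> real \<Rightarrow> ('e, 'c) lvert \<Rightarrow> ('e, 'c) lvert \<Rightarrow> real \<Rightarrow> bool" where
  "locates o' N s \<alpha> \<beta> \<mu> \<longleftrightarrow> (s = 0 \<longrightarrow> ncell N = o') \<and>
     (s \<noteq> 0 \<longrightarrow> lcell \<alpha> \<in> {None, o'} \<and> lcell \<beta> \<in> {None, o'} \<and>
       (o' \<noteq> None \<longrightarrow> (\<exists>\<kappa>. \<not> is_HE \<kappa> \<and> wt \<alpha> \<beta> \<mu> \<kappa> \<noteq> 0)))"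

lemma locates_supp: "locates o' N s \<alpha> \<beta> \<mu> \<Longrightarrow> s \<noteq> 0 \<Longrightarrow> wt \<alpha> \<beta> \<mu> \<kappa> \<noteq> 0 \<Longrightarrow> lcell \<kappa> \<in> {None, o'}"
  using wt_0[of \<kappa> \<alpha> \<beta> \<mu>] unfolding locates_def by metis

lemma locates_unique:
  assumes x: "coords x N s \<alpha> \<beta> \<mu>" "locates (pcell x) N s \<alpha> \<beta> \<mu>"
    and x': "coords x' N' s' \<alpha>' \<beta>' \<mu>'" "locates (pcell x') N' s' \<alpha>' \<beta>' \<mu>'" and eq: "emb x = emb x'"
  shows "pcell x = pcell x'"
proof -
  note u = coords_unique[OF x(1) x'(1) eq]
  show ?thesis
  proof (cases "s = 0")
    case True
    then show ?thesis using u x(2) x'(2) by (simp add: locates_def)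
  next
    case False
    \<comment> \<open>A vertex inside a cell with nonzero weight belongs to the common support and
      hence to the cell of either point.\<close>
    have *: "b = a" if "locates a N s \<alpha> \<beta> \<mu>" "locates b M s \<gamma> \<delta> \<nu>" "wt \<alpha> \<beta> \<mu> = wt \<gamma> \<delta> \<nu>" "a \<noteq> None"
      for a b N M \<alpha> \<beta> \<mu> \<gamma> \<delta> \<nu>
    proof -
      obtain \<kappa> where k: "\<not> is_HE \<kappa>" "wt \<alpha> \<beta> \<mu> \<kappa> \<noteq> 0" using \<open>locates a N s \<alpha> \<beta> \<mu>\<close> \<open>a \<noteq> None\<close> False unfolding locates_def by metis
      have "lcell \<kappa> \<noteq> None" using k(1) lcell_None by metis
      moreover have "lcell \<kappa> \<in> {None, a}" by (rule locates_supp[OF that(1) False k(2)])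
      moreover have "lcell \<kappa> \<in> {None, b}" by (rule locates_supp[OF that(2) False]) (use k(2) that(3) in simp)
      ultimately show ?thesis by auto
    qed
    have w: "wt \<alpha> \<beta> \<mu> = wt \<alpha>' \<beta>' \<mu>'" using u(3) False .
    show ?thesis
      using *[OF x(2) x'(2)[folded u(1)] w] *[OF x'(2)[folded u(1)] x(2) w[symmetric]] by metis
  qed
qed

text \<open>Inverts the parametrization \<open>half\<close>: the time from the end is
  \<open>s / 4\<close> in the star of the vertex and \<open>(2 - s) / 4\<close> in that of the
  edge.\<close>

fun graph_pt :: "('v, 'e, 'c) node \<Rightarrow> real \<Rightarrow> 'e \<Rightarrow> bool \<Rightarrow> ('v, 'e, 'c) point" where
  "graph_pt (NV y) s e b = (if s = 0 then Vert y else EdgePt e (if b then s / 4 else 1 - s / 4))"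
| "graph_pt (NE e') s e b = EdgePt e' (if b then (2 - s) / 4 else 1 - (2 - s) / 4)"
| "graph_pt (NR c j) s e b = undefined"

definition graph_coords :: "('v, 'e, 'c) point \<Rightarrow> ('v, 'e, 'c) node \<Rightarrow> real \<Rightarrow> 'e \<Rightarrow> bool \<Rightarrow> bool" where
  "graph_coords x N s e b \<longleftrightarrow> coords x N s (HE e b) (HE e b) 0 \<and> x = graph_pt N s e b
     \<and> (N = NE e \<or> (\<exists>y. N = NV y))"

lemma lk_HE:
  assumes "e \<in> edges X"
  shows "lk (NV (dart_tail X (e, b))) (HE e b) (HE e b)" "lk (NE e) (HE e b) (HE e b)"
proof -
  show "lk (NV (dart_tail X (e, b))) (HE e b) (HE e b)"
    by (rule lk_intro[where N' = "NE e"]) (use assms in simp_all)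
  show "lk (NE e) (HE e b) (HE e b)"
    by (rule lk_intro[where N' = "NV (dart_tail X (e, b))"]) (use assms in simp_all)
qed

lemma half_coords:
  assumes e: "e \<in> edges X" and t: "0 < t" "t \<le> 1/2" and x: "x = EdgePt e (if b then t else 1 - t)"
    and h: "emb x = half e b t"
  shows "\<exists>N s e b. graph_coords x N s e b"
proof (cases "t \<le> 1/4")
  case True
  have "graph_coords x (NV (dart_tail X (e, b))) (4 * t) e b"
    using e t True x h half_pieces(1)[OF True] lk_HE[OF e] dart_tail_verts[OF e]
    by (simp add: graph_coords_def coords_def)
  then show ?thesis by (intro exI)
next
  case False
  have "graph_coords x (NE e) (2 - 4 * t) e b"
    using e t False x h half_pieces(2)[of t] lk_HE[OF e]
    by (simp add: graph_coords_def coords_def)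
  then show ?thesis by (intro exI)
qed

lemma graph_coords_ex:
  assumes "x \<in> points X" "pcell x = None"
  shows "\<exists>N s e b. graph_coords x N s e b"
proof (cases x)
  case (Vert y)
  then have "y \<in> verts X" using assms(1) by (auto simp: points_def)
  then have "graph_coords x (NV y) 0 undefined undefined"
    using Vert by (simp add: graph_coords_def coords_def cone_pt_0)
  then show ?thesis by (intro exI)
next
  case (EdgePt e t)
  then have e: "e \<in> edges X" "0 < t" "t < 1" using assms(1) by (auto simp: points_def)
  show ?thesis
  proof (cases "t \<le> 1/2")
    case True
    show ?thesis by (rule half_coords[OF e(1,2) True, of _ True]) (simp_all add: EdgePt draw_pieces(1)[OF True])
  next
    case False
    show ?thesis
      by (rule half_coords[OF e(1), of "1 - t" _ False]) (use e False in \<open>simp_all add: EdgePt draw_pieces(2)\<close>)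
  qed
qed (use assms in simp)

lemma graph_locates: "graph_coords x N s e b \<Longrightarrow> locates None N s (HE e b) (HE e b) 0"
  by (auto simp: graph_coords_def locates_def)

lemma graph_inj:
  assumes x: "graph_coords x N s e b" "graph_coords x' N' s' e' b'" and eq: "emb x = emb x'"
  shows "x = x'"
proof -
  have X: "coords x N s (HE e b) (HE e b) 0" "x = graph_pt N s e b" "N = NE e \<or> (\<exists>y. N = NV y)"
    "coords x' N' s' (HE e' b') (HE e' b') 0" "x' = graph_pt N' s' e' b'" "N' = NE e' \<or> (\<exists>y. N' = NV y)"
    using x unfolding graph_coords_def by blast+
  note u = coords_unique[OF X(1,4) eq]
  have he: "e = e' \<and> b = b'" if "s \<noteq> 0"
  proof -
    show ?thesis using fun_cong[OF u(3)[OF that], of "HE e b"] by (simp add: wt_def split: if_splits)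
  qed
  consider "s = 0" | "s \<noteq> 0" "s \<noteq> 1" | "s = 1" by blast
  then show ?thesis
  proof cases
    case 1
    then show ?thesis using u(1,2) X(2,3,5,6) by (cases N) auto
  next
    case 2
    then show ?thesis using u(1,2) he X(2,5) by simp
  next
    case 3
    \<comment> \<open>At \<open>s = 1\<close> the node may be that of the vertex or that of the
      edge; both formulas give the time 1/4 from the end.\<close>
    have *: "graph_pt M 1 e b = graph_pt (NE e) 1 e b" if "M = NE e \<or> (\<exists>z. M = NV z)" for M
      using that by auto
    have "e' = e" "b' = b" "s' = 1" using he 3 u(1) by simp_all
    then show ?thesis using *[OF X(3)] *[of N'] X(2,5,6) 3 by simp
  qed
qed

lemma cell_coords:
  assumes c: "c \<in> cells X" and n: "0 < len c" and r: "rep c (chart c p) k s r \<mu>" and p: "l1 p < 1"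
  shows "coords (CellPt c p) (lab c k) r (e0 c s) (e1 c s) \<mu>"
    "locates (Some c) (lab c k) r (e0 c s) (e1 c s) \<mu>"
proof -
  have s: "s \<in> rim c k" "0 \<le> r" "r \<le> 1" "0 \<le> \<mu>" "\<mu> \<le> 1" using r by (simp_all add: rep_def)
  have "rim c k \<noteq> {}" using s(1) by blast
  then show "coords (CellPt c p) (lab c k) r (e0 c s) (e1 c s) \<mu>"
    using s n by (simp add: coords_def cell_draw_rep[OF r] lk_rim[OF c n s(1)] lab_nodes[OF c])
  have h: "pent c (chart c p - mid c) < 1" using p by (simp add: pent_chart[OF c n])
  note I = interior_rep[OF n h r]
  have "lcell (e0 c s) \<in> {None, Some c} \<and> lcell (e1 c s) \<in> {None, Some c}"
    using s(1) by (cases rule: rim_cases) (auto simp: top_left_def top_right_def side_def st_def en_def)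
  moreover have "r = 0 \<Longrightarrow> ncell (lab c k) = Some c" using I(1) by auto
  ultimately show "locates (Some c) (lab c k) r (e0 c s) (e1 c s) \<mu>" using I(2) by (simp add: locates_def)
qed

text \<open>At a node, an interior point must belong to an auxiliary disk, whose node names its
  corner. In a wall \<open>bd_decode\<close> suffices. In between, the node identifies the region,
  since regions with the same node do not touch.\<close>

lemma cell_inj:
  assumes c: "c \<in> cells X" and n: "0 < len c" and p: "l1 p < 1" "l1 p' < 1"
    and eq: "emb (CellPt c p) = emb (CellPt c p')"
  shows "p = p'"
proof -
  have h: "pent c (chart c q - mid c) < 1" if "l1 q < 1" for q using that by (simp add: pent_chart[OF c n])
  obtain k s r \<mu> where R: "rep c (chart c p) k s r \<mu>" using pent_cover[OF n less_imp_le[OF h[OF p(1)]]] by metis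
  obtain k' s' r' \<mu>' where R': "rep c (chart c p') k' s' r' \<mu>'" using pent_cover[OF n less_imp_le[OF h[OF p(2)]]] by metis
  have S: "s \<in> rim c k" "0 \<le> \<mu>" "\<mu> \<le> 1" "chart c p = ctr c k + r *\<^sub>R (bd s \<mu> - ctr c k)"
    "s' \<in> rim c k'" "0 \<le> \<mu>'" "\<mu>' \<le> 1" "chart c p' = ctr c k' + r' *\<^sub>R (bd s' \<mu>' - ctr c k')"
    using R R' by (simp_all add: rep_def)
  note u = coords_unique[OF cell_coords(1)[OF c n R p(1)] cell_coords(1)[OF c n R' p(2)] eq]
  note I = interior_rep[OF n h[OF p(1)] R] and I' = interior_rep[OF n h[OF p(2)] R']
  have "chart c p = chart c p'"
  proof (cases "r = 0")
    case True
    then obtain i j where "k = GR i" "k' = GR j" using I(1) I'(1) u(1) by metis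
    then show ?thesis using u(1,2) True S(4,8) by simp
  next
    case False
    obtain \<kappa> where "\<not> is_HE \<kappa>" "wt (e0 c s) (e1 c s) \<mu> \<kappa> \<noteq> 0" using I(2)[OF False] by metis
    then have b: "bd s \<mu> = bd s' \<mu>'" by (rule bd_decode[OF S(1,5) u(3)[OF False]])
    show ?thesis
    proof (cases "r = 1")
      case True
      then show ?thesis using b u(1) S(4,8) by simp
    next
      case False
      have "zone c k (bd s \<mu>)" "zone c k' (bd s \<mu>)"
        using zone_rim(1)[OF S(1-3)] zone_rim(1)[OF S(5-7)] b by simp_all
      then have "k = k'" using zones_lab u(2)[OF False] by metis
      then show ?thesis using b u(1) S(4,8) by simp
    qed
  qed
  then show ?thesis by (rule chart_inj[OF c n])
qed

lemma sphere_coords: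
  assumes c: "c \<in> cells X" and n: "len c = 0" and p: "l1 p < 1"
  defines "q \<equiv> collapse p"
  shows "coords (CellPt c p) (pole c q) (l1 (fst q)) (xlv c q) (ylv c q) (yratio q)"
    "locates (Some c) (pole c q) (l1 (fst q)) (xlv c q) (ylv c q) (yratio q)"
    "l1 (fst q) = 0 \<Longrightarrow> pole c q = NR c 0"
proof -
  have q: "q \<in> octa" using p by (simp add: q_def collapse_octa disk_def)
  have l: "l1 (fst q) + \<bar>snd q\<bar> = 1" using q by (simp add: octa_def)
  \<comment> \<open>The open disk misses the south pole, so its only pole is
    \<open>NR c 0\<close>.\<close>
  have s: "-1 < snd q" using p by (simp add: q_def collapse_def)
  have N: "pole c q \<in> nodes" using c by (simp add: pole_def apex_verts)
  have nds: "nds (xlv c q) = {NV (apex c), NR c 0}" "nds (ylv c q) = {NV (apex c), NR c 0}"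
    using n by (simp_all add: xlv_def ylv_def)
  have LV: "xlv c q \<in> LV" "ylv c q \<in> LV" using c by (simp_all add: xlv_def ylv_def)
  have k: "lk (pole c q) (xlv c q) (ylv c q)"
    by (rule lk_intro[OF LV, where N' = "if 0 \<le> snd q then NV (apex c) else NR c 0"])
       (simp_all add: nds pole_def del: nds.simps)
  show "coords (CellPt c p) (pole c q) (l1 (fst q)) (xlv c q) (ylv c q) (yratio q)"
    using n l sphere_draw_cone[OF q, of c] N k yratio(1,2)[of q]
    by (simp add: coords_def q_def[symmetric] l1_nonneg)
  show pl: "pole c q = NR c 0" if "l1 (fst q) = 0"
    using l s that by (auto simp: pole_def)
  have "\<exists>\<kappa>. \<not> is_HE \<kappa> \<and> wt (xlv c q) (ylv c q) (yratio q) \<kappa> \<noteq> 0"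
  proof (cases "yratio q = 1")
    case True
    then have "wt (xlv c q) (ylv c q) (yratio q) (ylv c q) \<noteq> 0" by (simp add: wt_def)
    moreover have "\<not> is_HE (ylv c q)" by (simp add: ylv_def)
    ultimately show ?thesis by metis
  next
    case False
    have "xlv c q \<noteq> ylv c q" by (simp add: xlv_def ylv_def)
    then have "wt (xlv c q) (ylv c q) (yratio q) (xlv c q) \<noteq> 0" using False by (simp add: wt_def)
    moreover have "\<not> is_HE (xlv c q)" by (simp add: xlv_def)
    ultimately show ?thesis by metis
  qed
  then show "locates (Some c) (pole c q) (l1 (fst q)) (xlv c q) (ylv c q) (yratio q)"
    using pl by (simp add: locates_def xlv_def ylv_def)
qed

lemma sphere_inj:
  assumes c: "c \<in> cells X" and n: "len c = 0" and p: "l1 p < 1" "l1 p' < 1"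
    and eq: "emb (CellPt c p) = emb (CellPt c p')"
  shows "p = p'"
proof -
  define q where "q = collapse p"
  define q' where "q' = collapse p'"
  note C = sphere_coords[OF c n p(1), folded q_def] and C' = sphere_coords[OF c n p(2), folded q'_def]
  note u = coords_unique[OF C(1) C'(1) eq]
  have "q \<in> octa" "q' \<in> octa" using p by (simp_all add: q_def q'_def collapse_octa disk_def)
  then have o: "l1 (fst q) + \<bar>snd q\<bar> = 1" "l1 (fst q') + \<bar>snd q'\<bar> = 1" by (simp_all add: octa_def)
  have "fst q = fst q'"
  proof (cases "l1 (fst q) = 0")
    case True
    then show ?thesis using u(1) l1_eq_0 by metis
  next
    case False
    show ?thesis
      using sphere_weights[where c = c and q = q] sphere_weights[where c = c and q = q'] u(1) u(3)[OF False] by (simp add: prod_eq_iff)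
  qed
  moreover have "snd q = snd q'"
  proof (cases "l1 (fst q) = 1")
    case True
    then show ?thesis using o u(1) by simp
  next
    case False
    then have "0 \<le> snd q \<longleftrightarrow> 0 \<le> snd q'" using u(2)[OF False] by (simp add: pole_def split: if_splits)
    then show ?thesis using o u(1) by linarith
  qed
  ultimately have "q = q'" by (simp add: prod_eq_iff)
  then show ?thesis using collapse_inj[OF p] by (simp add: q_def q'_def)
qed

section \<open>Injectivity across all cells and the graph\<close>

lemma located:
  assumes "x \<in> points X"
  obtains N s \<alpha> \<beta> \<mu> where "coords x N s \<alpha> \<beta> \<mu>" "locates (pcell x) N s \<alpha> \<beta> \<mu>"
proof (cases "pcell x")
  case None
  then obtain N s e b where G: "graph_coords x N s e b" using graph_coords_ex[OF assms None] by (elim exE)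
  have "coords x N s (HE e b) (HE e b) 0" using G unfolding graph_coords_def by blast
  then show thesis by (rule that) (use graph_locates[OF G] None in simp)
next
  case (Some c)
  then obtain p where x: "x = CellPt c p" by (cases x) simp_all
  then have c: "c \<in> cells X" "l1 p < 1" using assms by (auto simp: points_def)
  show thesis
  proof (cases "len c = 0")
    case True
    show ?thesis using that sphere_coords(1,2)[OF c(1) True c(2)] unfolding x pcell.simps by blast
  next
    case False
    then have n: "0 < len c" by simp
    have "pent c (chart c p - mid c) \<le> 1" using c(2) by (simp add: pent_chart[OF c(1) n])
    then obtain k s r \<mu> where R: "rep c (chart c p) k s r \<mu>" using pent_cover[OF n] by metis
    show ?thesis using that cell_coords[OF c(1) n R c(2)] unfolding x pcell.simps by blast
  qed
qed

lemma inj_emb: "inj_on emb (points X)"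
proof (rule inj_onI)
  fix x x' assume x: "x \<in> points X" "x' \<in> points X" and eq: "emb x = emb x'"
  obtain N s \<alpha> \<beta> \<mu> where C: "coords x N s \<alpha> \<beta> \<mu>" "locates (pcell x) N s \<alpha> \<beta> \<mu>" by (rule located[OF x(1)])
  obtain N' s' \<alpha>' \<beta>' \<mu>' where C': "coords x' N' s' \<alpha>' \<beta>' \<mu>'" "locates (pcell x') N' s' \<alpha>' \<beta>' \<mu>'"
    by (rule located[OF x(2)])
  have pc: "pcell x = pcell x'" by (rule locates_unique[OF C C' eq])
  show "x = x'"
  proof (cases "pcell x")
    case None
    obtain N s e b where "graph_coords x N s e b" using graph_coords_ex[OF x(1) None] by (elim exE)
    moreover obtain N' s' e' b' where "graph_coords x' N' s' e' b'"
      using graph_coords_ex[OF x(2)] None pc by (metis (no_types))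
    ultimately show ?thesis using eq by (rule graph_inj)
  next
    case (Some c)
    then obtain p where p: "x = CellPt c p" by (cases x) simp_all
    obtain p' where p': "x' = CellPt c p'" using Some pc by (cases x') simp_all
    have c: "c \<in> cells X" "l1 p < 1" "l1 p' < 1" using x p p' by (auto simp: points_def)
    show ?thesis
      using cell_inj[OF c(1) _ c(2,3)] sphere_inj[OF c(1) _ c(2,3)] eq unfolding p p' by (cases "len c = 0") simp_all
  qed
qed

lemma pl_embedding_emb: "pl_embedding X emb"
proof -
  have "embedding_map (cw_space X) euclidean emb"
    by (rule continuous_imp_embedding_map[OF continuous_emb compact_space_cw_space[OF fin]])
       (simp_all add: topspace_cw_space[OF fin] inj_emb Hausdorff_space_euclidean)
  then show ?thesis using pl_map_emb by (simp add: pl_embedding_def)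
qed

end

theorem theorem3p5:
  fixes X :: "('v, 'e, 'c) complex2" and v w :: 'v
  assumes "finite_complex2 X"
    and "v \<in> verts X" and "w \<in> verts X"
    and "\<forall>c\<in>cells X. incident X c v \<or> incident X c w"
  shows "\<exists>f :: ('v, 'e, 'c) point \<Rightarrow> real ^ 4. pl_embedding X f"
proof -
  interpret two_apex X v w by unfold_locales (use assms in simp_all)
  obtain g where "admissible g" using admissible_ex by (elim exE)
  then interpret two_apex_drawing X v w g by unfold_locales
  show ?thesis by (rule exI) (rule pl_embedding_emb)
qed

end
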